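(* \textsc{MinIGL} restricted to instances whose input graph is a tree is fixed-parameter tractable with respect to the parameter $n/k$: there is an algorithm (on a real RAM) that, given a tree $T$ with $n$ vertices, an integer $k$ and a target $\tau$, decides whether there is a set $S$ of $k$ vertices with $IGL(T-S)\le\tau$ in time $f(n/k)\cdot n^{O(1)}$ for some computable function $f$.
   Context: For a graph $G=(V,E)$, $d_G(u,v)$ is the number of edges of a shortest $u$–$v$ path, or $\infty$ if none exists, with $1/\infty=0$. The Inverse Geodesic Length is $IGL(G)=\sum_{\{u,v\}\subseteq V}\frac{1}{d_G(u,v)}$ (sum over unordered pairs of distinct vertices). \textsc{MinIGL}: given a graph $G$, an integer $k$ and a real $\tau$, decide whether there is a set $S$ of exactly $k$ vertices with $IGL(G-S)\le\tau$. A real RAM supports addition, subtraction, multiplication, division and comparison of real numbers in constant time (but not rounding or modulo). *)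

theory Defs
  imports Complex_Main "HOL-Library.Extended_Nat"
begin

section \<open>Graphs, distances and the inverse geodesic length\<close>

record 'a graph =
  verts :: "'a set"
  edges :: "'a set set"

definition simple_graph :: "'a graph \<Rightarrow> bool" where
  "simple_graph G \<longleftrightarrow> finite (verts G) \<and> (\<forall>e\<in>edges G. e \<subseteq> verts G \<and> card e = 2)"

abbreviation adjacent :: "'a graph \<Rightarrow> 'a \<Rightarrow> 'a \<Rightarrow> bool" where
  "adjacent G u v \<equiv> {u, v} \<in> edges G"

definition path_between :: "'a graph \<Rightarrow> 'a \<Rightarrow> 'a list \<Rightarrow> 'a \<Rightarrow> bool" where
  "path_between G u p v \<longleftrightarrow> p \<noteq> [] \<and> hd p = u \<and> last p = v \<and>
     set p \<subseteq> verts G \<and> distinct p \<and> successively (adjacent G) p"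

definition cycle :: "'a graph \<Rightarrow> 'a list \<Rightarrow> bool" where
  "cycle G p \<longleftrightarrow> length p \<ge> 3 \<and> set p \<subseteq> verts G \<and> distinct p \<and>
     successively (adjacent G) p \<and> adjacent G (last p) (hd p)"

definition connected_graph :: "'a graph \<Rightarrow> bool" where
  "connected_graph G \<longleftrightarrow> verts G \<noteq> {} \<and>
     (\<forall>u\<in>verts G. \<forall>v\<in>verts G. \<exists>p. path_between G u p v)"

definition tree :: "'a graph \<Rightarrow> bool" where
  "tree G \<longleftrightarrow> simple_graph G \<and> connected_graph G \<and> (\<nexists>p. cycle G p)"

(* The infimum of the empty set is \<infinity>. *)
definition gdist :: "'a graph \<Rightarrow> 'a \<Rightarrow> 'a \<Rightarrow> enat" where
  "gdist G u v = (INF p\<in>{p. path_between G u p v}. enat (length p - 1))"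

definition inv_enat :: "enat \<Rightarrow> real" where
  "inv_enat d = (case d of enat n \<Rightarrow> 1 / real n | \<infinity> \<Rightarrow> 0)"

(* The restriction u < v selects each unordered pair of distinct vertices once. *)
definition IGL :: "'a::linorder graph \<Rightarrow> real" where
  "IGL G = (\<Sum>(u, v) \<in> {(u, v). u \<in> verts G \<and> v \<in> verts G \<and> u < v}. inv_enat (gdist G u v))"

definition delete_verts :: "'a graph \<Rightarrow> 'a set \<Rightarrow> 'a graph" where
  "delete_verts G S = \<lparr>verts = verts G - S, edges = {e \<in> edges G. e \<inter> S = {}}\<rparr>"

definition MinIGL :: "'a::linorder graph \<Rightarrow> int \<Rightarrow> real \<Rightarrow> bool" where
  "MinIGL G k \<tau> \<longleftrightarrow> (\<exists>S \<subseteq> verts G. int (card S) = k \<and> IGL (delete_verts G S) \<le> \<tau>)"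


section \<open>The real RAM\<close>

(* Every memory cell holds a real number and every instruction takes one time step.
   Only integer literals occur in programs: arbitrary real literals would make
   the model non-uniform. *)
datatype instr =
    Const nat int          (* M[a] := c *)
  | Copy nat nat           (* M[a] := M[b] *)
  | Load nat nat           (* M[a] := M[M[b]] *)
  | Store nat nat          (* M[M[a]] := M[b] *)
  | Add nat nat nat        (* M[a] := M[b] + M[c] *)
  | Sub nat nat nat
  | Mul nat nat nat
  | Div nat nat nat
  | Jump nat
  | JumpLess nat nat nat   (* if M[a] < M[b] goto l *)
  | Halt bool              (* accept or reject *)

type_synonym program = "instr list"
type_synonym memory = "nat \<Rightarrow> real"
type_synonym config = "nat \<times> memory"

(* There is no rounding: the machine gets stuck when it divides by zero or uses
   a cell as an address whose content is not a natural number. *)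
inductive exec :: "instr \<Rightarrow> config \<Rightarrow> config \<Rightarrow> bool" where
  "exec (Const a c) (pc, M) (Suc pc, M(a := real_of_int c))"
| "exec (Copy a b) (pc, M) (Suc pc, M(a := M b))"
| "M b = real i \<Longrightarrow> exec (Load a b) (pc, M) (Suc pc, M(a := M i))"
| "M a = real i \<Longrightarrow> exec (Store a b) (pc, M) (Suc pc, M(i := M b))"
| "exec (Add a b c) (pc, M) (Suc pc, M(a := M b + M c))"
| "exec (Sub a b c) (pc, M) (Suc pc, M(a := M b - M c))"
| "exec (Mul a b c) (pc, M) (Suc pc, M(a := M b * M c))"
| "M c \<noteq> 0 \<Longrightarrow> exec (Div a b c) (pc, M) (Suc pc, M(a := M b / M c))"
| "exec (Jump l) (pc, M) (l, M)"
| "exec (JumpLess a b l) (pc, M) (if M a < M b then l else Suc pc, M)"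

definition step :: "program \<Rightarrow> config \<Rightarrow> config \<Rightarrow> bool" where
  "step P c c' \<longleftrightarrow> fst c < length P \<and> exec (P ! fst c) c c'"

lemma step_deterministic: "step P c c' \<Longrightarrow> step P c c'' \<Longrightarrow> c' = c''"
  unfolding step_def by (auto elim!: exec.cases)

definition halts_with :: "program \<Rightarrow> memory \<Rightarrow> nat \<Rightarrow> bool \<Rightarrow> bool" where
  "halts_with P M t b \<longleftrightarrow>
     (\<exists>pc M'. (step P ^^ t) (0, M) (pc, M') \<and> pc < length P \<and> P ! pc = Halt b)"


section \<open>Encoding of instances\<close>

(* An edge list lists every edge exactly once, in arbitrary order and orientation. *)
definition edge_list :: "'a graph \<Rightarrow> ('a \<times> 'a) list \<Rightarrow> bool" where
  "edge_list G es \<longleftrightarrow> distinct (map (\<lambda>(u, v). {u, v}) es) \<and> (\<lambda>(u, v). {u, v}) ` set es = edges G"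

definition input_cells :: "nat \<Rightarrow> (nat \<times> nat) list \<Rightarrow> int \<Rightarrow> real \<Rightarrow> real list" where
  "input_cells n es k \<tau> =
     [real n, real_of_int k, \<tau>, real (length es)] @ concat (map (\<lambda>(u, v). [real u, real v]) es)"

definition initial_memory :: "real list \<Rightarrow> memory" where
  "initial_memory xs i = (if i < length xs then xs ! i else 0)"


section \<open>Computable functions on the natural numbers\<close>

(* Kleene's partial recursive functions *)
datatype recf =
    Zero
  | Succ
  | Proj nat
  | Comp recf "recf list"
  | PrimRec recf recf
  | Mu recf

inductive rec_eval :: "recf \<Rightarrow> nat list \<Rightarrow> nat \<Rightarrow> bool" where
  "rec_eval Zero xs 0"
| "rec_eval Succ [x] (Suc x)"
| "i < length xs \<Longrightarrow> rec_eval (Proj i) xs (xs ! i)"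
| "list_all2 (\<lambda>g y. rec_eval g xs y) gs ys \<Longrightarrow> rec_eval f ys z \<Longrightarrow> rec_eval (Comp f gs) xs z"
| "rec_eval g xs y \<Longrightarrow> rec_eval (PrimRec g h) (0 # xs) y"
| "rec_eval (PrimRec g h) (n # xs) y \<Longrightarrow> rec_eval h (n # y # xs) z \<Longrightarrow>
     rec_eval (PrimRec g h) (Suc n # xs) z"
| "rec_eval g (n # xs) 0 \<Longrightarrow> (\<forall>m<n. \<exists>y>0. rec_eval g (m # xs) y) \<Longrightarrow> rec_eval (Mu g) xs n"

definition computable :: "(nat \<Rightarrow> nat) \<Rightarrow> bool" where
  "computable f \<longleftrightarrow> (\<exists>r. \<forall>x. rec_eval r [x] (f x))"

end

theory Submission
  imports Defs
begin

text \<open>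
  Let \<open>q = \<lceil>n/k\<rceil>\<close>. The vertices whose nearest deleted ancestor is \<open>s\<close> form a territory of \<open>s\<close>, and some
  deleted vertex has a territory of size at most \<open>q\<close>. Deleting instead of it a vertex of a component with \<open>m\<close>
  vertices gains at least the harmonic number \<open>H(m - 1)\<close> and loses an amount bounded in terms of \<open>q\<close>, so an
  optimal deletion set leaves only components of size at most some \<open>B\<close> that depends on \<open>q\<close> alone. A dynamic
  program over the tree therefore only has to remember, for the component of the current root, how many
  of its vertices lie at each distance: joining two components by an edge adds \<open>1/(i + j + 1)\<close> for every pair
  of vertices at distances \<open>i\<close> and \<open>j\<close> from the ends of the edge. A profile is stored as a number in
  base \<open>B + 1\<close>, so that shifting a profile by one level is a multiplication.
  The dynamic program is written in a small language with bounded loops that compiles to the real RAM. As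
  every loop makes at most \<open>W\<close> iterations, the running time is at most a constant times \<open>W\<close> to the nesting depth.
\<close>

section \<open>Distances and the inverse geodesic length\<close>

text \<open>Restoring a deleted vertex \<open>s\<close> connects its territory with the component of
  its parent, and nothing bounds that component beforehand. This forces two thresholds. A graph with
  \<open>c\<close> vertices has inverse geodesic length at most \<open>c^2\<close>, while the
  harmonic number of \<open>4^g\<close> exceeds \<open>g\<close>. So if the parent's component has
  more than \<open>B1 = 4^(q^2)\<close> vertices, deleting the parent instead of \<open>s\<close> is
  profitable; otherwise restoring \<open>s\<close> affects at most \<open>q + B1\<close> vertices,
  and a component with more than \<open>B = 4^((q + B1)^2)\<close> vertices can pay for that. For
  \<open>k \<le> 0\<close> the choice \<open>q = n + 1\<close> makes the bound vacuous, so the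
  decision is right for every integer \<open>k\<close>. The machine neither rounds nor takes
  remainders: \<open>q\<close> is found by search, and the digits of all codes are tabulated by
  counting. Tables hold only the least value for each number of deletions and profile, which
  suffices because the additional cost of a merge depends on the profiles alone. The input lists
  edges in arbitrary order and occupies the register cells, so it is first moved away and then
  scanned repeatedly.\<close>

lemma simple_graph_edge:
  "simple_graph G \<Longrightarrow> {u, v} \<in> edges G \<Longrightarrow> u \<in> verts G \<and> v \<in> verts G \<and> u \<noteq> v"
  unfolding simple_graph_def by fastforce

lemma path_between_verts: "path_between G u p v \<Longrightarrow> u \<in> verts G \<and> v \<in> verts G"
  unfolding path_between_def using hd_in_set last_in_set by blast

lemma gdist_le: "path_between G u p v \<Longrightarrow> gdist G u v \<le> enat (length p - 1)"
  unfolding gdist_def by (rule INF_lower) simp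

text \<open>A nonempty set of extended naturals attains its infimum, and the infimum of the empty
  set is \<infinity>; a finite distance therefore comes from a path.\<close>

lemma gdist_path:
  assumes "gdist G u v \<noteq> \<infinity>"
  obtains p where "path_between G u p v" "gdist G u v = enat (length p - 1)"
proof -
  let ?A = "(\<lambda>p. enat (length p - 1)) ` {p. path_between G u p v}"
  have "?A \<noteq> {}"
  proof
    assume e: "?A = {}"
    show False using assms unfolding gdist_def e by (simp add: Inf_enat_def)
  qed
  then have "Inf ?A \<in> ?A"
    unfolding Inf_enat_def by (auto intro: LeastI)
  then show ?thesis using that unfolding gdist_def by blast
qed

lemma gdist_infinity: "u \<notin> verts G \<or> v \<notin> verts G \<Longrightarrow> gdist G u v = \<infinity>"
  by (meson gdist_path path_between_verts)

lemma gdist_self: "v \<in> verts G \<Longrightarrow> gdist G v v = 0"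
proof -
  assume "v \<in> verts G"
  then have "path_between G v [v] v" by (simp add: path_between_def)
  from gdist_le[OF this] show ?thesis by (simp add: zero_enat_def[symmetric])
qed

lemma gdist_eq_0: "gdist G u v = 0 \<Longrightarrow> u = v"
proof -
  assume a: "gdist G u v = 0"
  then obtain p where p: "path_between G u p v" "length p - 1 = 0"
    using gdist_path[of G u v] by (auto simp: zero_enat_def)
  then obtain x where "p = [x]" unfolding path_between_def
    by (cases p) auto
  then show ?thesis using p by (auto simp: path_between_def)
qed

lemma gdist_ge_1: "u \<noteq> v \<Longrightarrow> 1 \<le> gdist G u v"
  using gdist_eq_0[of G u v] by (metis ileI1 one_eSuc zero_less_iff_neq_zero)

lemma path_between_rev: "path_between G u p v \<Longrightarrow> path_between G v (rev p) u"
  unfolding path_between_def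
  by (auto simp: hd_rev last_rev insert_commute)

lemma gdist_sym: "gdist G u v = gdist G v u"
proof -
  have "gdist G a b \<le> gdist G b a" for a b
  proof (cases "gdist G b a = \<infinity>")
    case False
    then obtain p where "path_between G b p a" "gdist G b a = enat (length p - 1)"
      by (rule gdist_path)
    then show ?thesis using gdist_le[OF path_between_rev] by fastforce
  qed simp
  then show ?thesis by (meson order.antisym)
qed

lemma path_between_prefix:
  assumes "path_between G u ((a @ [w]) @ b) v"
  shows "path_between G u (a @ [w]) w"
proof -
  have "successively (adjacent G) (a @ [w])"
    using assms successively_append_iff[of "adjacent G" "a @ [w]" b] by (simp add: path_between_def)
  then show ?thesis using assms unfolding path_between_def by (cases a) auto
qed

text \<open>Paths visit no vertex twice, so if \<open>w\<close> already occurs on \<open>p\<close>,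
  the path is cut at \<open>w\<close> instead of being extended.\<close>

lemma path_between_snoc:
  assumes p: "path_between G u p v" and vw: "adjacent G v w" and w: "w \<in> verts G"
  obtains p' where "path_between G u p' w" "length p' \<le> Suc (length p)"
proof (cases "w \<in> set p")
  case False
  have "path_between G u (p @ [w]) w"
    using assms False unfolding path_between_def by (auto simp: successively_append_iff)
  then show ?thesis using that by simp
next
  case True
  then obtain a b where "p = a @ w # b" by (meson split_list)
  then have ab: "p = (a @ [w]) @ b" by simp
  have "path_between G u (a @ [w]) w"
    using p unfolding ab by (rule path_between_prefix)
  then show ?thesis using that ab by simp
qed

lemma gdist_step:
  assumes vw: "adjacent G v w" and w: "w \<in> verts G"
  shows "gdist G u w \<le> gdist G u v + 1"
proof (cases "gdist G u v = \<infinity>")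
  case False
  then obtain p where p: "path_between G u p v" "gdist G u v = enat (length p - 1)"
    by (rule gdist_path)
  obtain p' where p': "path_between G u p' w" "length p' \<le> Suc (length p)"
    using path_between_snoc[OF p(1) vw w] .
  have "p \<noteq> []" using p by (simp add: path_between_def)
  then have "enat (length p' - 1) \<le> gdist G u v + 1"
    using p p' by (cases p) (auto simp: one_enat_def)
  then show ?thesis using gdist_le[OF p'(1)] by (rule order_trans[rotated])
qed simp

text \<open>The growth is summed along a shortest path. This is the source of all lower bounds on
  distances: the triangle inequality and the distances in joins are instances with a suitable
  \<open>f\<close>.\<close>

lemma gdist_lipschitz:
  fixes f :: "'a \<Rightarrow> enat"
  assumes "\<And>y z. y \<in> verts G \<Longrightarrow> z \<in> verts G \<Longrightarrow> adjacent G y z \<Longrightarrow> f z \<le> f y + 1"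
  shows "f v \<le> f u + gdist G u v"
proof (cases "gdist G u v = \<infinity>")
  case False
  then obtain p where p: "path_between G u p v" "gdist G u v = enat (length p - 1)"
    by (rule gdist_path)
  have "set p \<subseteq> verts G \<Longrightarrow> successively (adjacent G) p \<Longrightarrow> p \<noteq> [] \<Longrightarrow>
      f (last p) \<le> f (hd p) + enat (length p - 1)"
  proof (induction p)
    case (Cons x p)
    show ?case
    proof (cases "p = []")
      case False
      then obtain y p' where y: "p = y # p'" by (cases p) auto
      have "f (last p) \<le> f y + enat (length p - 1)"
        using Cons y by simp
      also have "f y \<le> f x + 1" using assms Cons.prems y by simp
      finally have "f (last p) \<le> f x + 1 + enat (length p - 1)"
        by (simp add: add_right_mono)
      then show ?thesis using y
        by (simp add: one_enat_def add.assoc)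
    qed (simp add: zero_enat_def[symmetric])
  qed simp
  then show ?thesis using p unfolding path_between_def by auto
qed simp

lemma gdist_triangle: "gdist G u w \<le> gdist G u v + gdist G v w"
  by (rule gdist_lipschitz[where f = "gdist G u"]) (rule gdist_step)

lemma gdist_adjacent: "adjacent G u v \<Longrightarrow> u \<in> verts G \<Longrightarrow> v \<in> verts G \<Longrightarrow> gdist G u v \<le> 1"
  using gdist_step[of u v G u] by (simp add: gdist_self)

lemma gdist_antimono:
  assumes "verts G \<subseteq> verts H" "edges G \<subseteq> edges H"
  shows "gdist H u v \<le> gdist G u v"
proof -
  have "path_between H u p v" if "path_between G u p v" for p
    using that assms unfolding path_between_def
    by (auto intro: successively_mono)
  then show ?thesis unfolding gdist_def by (intro INF_superset_mono) auto
qed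

text \<open>The witness is the last vertex but one on a shortest path. Iteration shows that every
  distance below an attained one is attained as well.\<close>

lemma gdist_pred:
  assumes "gdist G u v = enat (Suc d)"
  obtains w where "gdist G u w = enat d" "w \<in> verts G"
proof -
  obtain p where p: "path_between G u p v" "gdist G u v = enat (length p - 1)"
    using assms gdist_path[of G u v] by auto
  then have l: "length p = Suc (Suc d)" using assms by simp
  then obtain a b where ab: "p = a @ [b]" and a: "length a = Suc d"
    by (metis length_Suc_conv_rev)
  obtain a' w where aw: "a = a' @ [w]" and a': "length a' = d" using a
    by (metis length_Suc_conv_rev)
  have b: "b = v" using p ab by (simp add: path_between_def)
  have pa: "path_between G u a w"
    using p(1) unfolding ab aw by (rule path_between_prefix)
  have "adjacent G w v" "v \<in> verts G"
    using p(1) unfolding ab aw b path_between_def by (auto simp: successively_append_iff)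
  then have "enat (Suc d) \<le> gdist G u w + 1" using gdist_step[of w v G u] assms by simp
  moreover have "gdist G u w \<le> enat d" using gdist_le[OF pa] a by simp
  ultimately have "gdist G u w = enat d"
    by (cases "gdist G u w") (auto simp: one_enat_def)
  moreover have "w \<in> verts G" using pa path_between_verts by metis
  ultimately show ?thesis using that by blast
qed

section \<open>Reciprocal distances and their sum\<close>

lemma inv_enat_nonneg: "0 \<le> inv_enat d"
  by (cases d) (auto simp: inv_enat_def)

lemma inv_enat_le_1: "inv_enat d \<le> 1"
proof (cases d)
  case (enat n)
  then show ?thesis by (cases n) (auto simp: inv_enat_def)
qed (auto simp: inv_enat_def)

lemma inv_enat_0 [simp]: "inv_enat 0 = 0"
  by (simp add: inv_enat_def zero_enat_def)

lemma inv_enat_infinity [simp]: "inv_enat \<infinity> = 0"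
  by (simp add: inv_enat_def)

text \<open>The value at distance 0 is 0 and not infinite, so monotonicity only starts at distance
  1.\<close>

lemma inv_enat_antimono: "1 \<le> a \<Longrightarrow> a \<le> b \<Longrightarrow> inv_enat b \<le> inv_enat a"
  by (cases a; cases b) (auto simp: inv_enat_def one_enat_def frac_le)

text \<open>Since \<^term>\<open>1 / real 0 = 0\<close>, the diagonal does not contribute.\<close>

lemma IGL_double:
  assumes "finite (verts G)"
  shows "2 * IGL G = (\<Sum>u\<in>verts G. \<Sum>v\<in>verts G. inv_enat (gdist G u v))"
proof -
  let ?f = "\<lambda>(u, v). inv_enat (gdist G u v)"
  let ?A = "{(u, v). u \<in> verts G \<and> v \<in> verts G \<and> u < v}"
  let ?B = "{(u, v). u \<in> verts G \<and> v \<in> verts G \<and> v < u}"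
  let ?C = "{(u, v). u \<in> verts G \<and> v \<in> verts G \<and> u = v}"
  have fin: "finite (verts G \<times> verts G)" using assms by simp
  have fins: "finite ?A" "finite ?B" "finite ?C"
    by (rule finite_subset[OF _ fin]; auto)+
  have "(\<Sum>u\<in>verts G. \<Sum>v\<in>verts G. inv_enat (gdist G u v)) = sum ?f (verts G \<times> verts G)"
    by (simp add: sum.cartesian_product)
  also have "verts G \<times> verts G = (?A \<union> ?B) \<union> ?C" by auto
  also have "sum ?f ((?A \<union> ?B) \<union> ?C) = sum ?f ?A + sum ?f ?B + sum ?f ?C"
  proof -
    have "sum ?f (?A \<union> ?B) = sum ?f ?A + sum ?f ?B"
      by (rule sum.union_disjoint) (use fins in auto)
    moreover have "sum ?f ((?A \<union> ?B) \<union> ?C) = sum ?f (?A \<union> ?B) + sum ?f ?C"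
      by (rule sum.union_disjoint) (use fins in auto)
    ultimately show ?thesis by simp
  qed
  also have "sum ?f ?C = 0"
    by (rule sum.neutral) (auto simp: gdist_self)
  also have "sum ?f ?B = sum ?f ?A"
    by (rule sum.reindex_bij_witness[where i = prod.swap and j = prod.swap])
       (auto simp: gdist_sym)
  finally show ?thesis unfolding IGL_def by simp
qed

lemma IGL_nonneg: "0 \<le> IGL G"
  unfolding IGL_def by (rule sum_nonneg) (auto simp: inv_enat_nonneg)

section \<open>Joining two disjoint graphs by an edge\<close>

definition join :: "'a graph \<Rightarrow> 'a graph \<Rightarrow> 'a \<Rightarrow> 'a \<Rightarrow> 'a graph" where
  "join G H p c = \<lparr>verts = verts G \<union> verts H,
     edges = edges G \<union> edges H \<union> (if p \<in> verts G \<and> c \<in> verts H then {{p, c}} else {})\<rparr>"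

lemma join_sel [simp]:
  "verts (join G H p c) = verts G \<union> verts H"
  "edges (join G H p c) = edges G \<union> edges H \<union> (if p \<in> verts G \<and> c \<in> verts H then {{p, c}} else {})"
  by (simp_all add: join_def)

lemma join_commute: "join G H p c = join H G c p"
  unfolding join_def by (auto simp: insert_commute)

lemma simple_graph_join:
  "simple_graph G \<Longrightarrow> simple_graph H \<Longrightarrow> verts G \<inter> verts H = {} \<Longrightarrow> simple_graph (join G H p c)"
  unfolding simple_graph_def by (auto simp: card_insert_if)

context
  fixes G H :: "'a graph"
  assumes simple: "simple_graph G" "simple_graph H" and disj: "verts G \<inter> verts H = {}"
begin

text \<open>As a function of \<open>z\<close>, the left-hand side is 0 at \<open>x\<close> and grows
  by at most 1 along every edge of the join, the connecting one included. If the connecting edge is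
  absent, one of its ends is missing and the second branch is \<infinity>.\<close>

lemma gdist_join_lower:
  assumes x: "x \<in> verts G"
  shows "(if z \<in> verts G then gdist G x z else gdist G x p + 1 + gdist H c z) \<le> gdist (join G H p c) x z"
proof -
  let ?f = "\<lambda>z. if z \<in> verts G then gdist G x z else gdist G x p + 1 + gdist H c z"
  have "?f z \<le> ?f x + gdist (join G H p c) x z"
  proof (rule gdist_lipschitz)
    fix y z assume "y \<in> verts (join G H p c)" "z \<in> verts (join G H p c)" "adjacent (join G H p c) y z"
    then consider "{y, z} \<in> edges G" | "{y, z} \<in> edges H"
      | "{y, z} = {p, c}" "p \<in> verts G" "c \<in> verts H"
      by (auto split: if_splits)
    then show "?f z \<le> ?f y + 1"
    proof cases
      case 1
      then show ?thesis using simple_graph_edge[OF simple(1) 1] gdist_step[OF 1, of x] by simp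
    next
      case 2
      then have "y \<in> verts H" "z \<in> verts H" using simple_graph_edge[OF simple(2) 2] by auto
      moreover from this have "y \<notin> verts G" "z \<notin> verts G" using disj by auto
      ultimately show ?thesis using add_left_mono[OF gdist_step[OF 2, of c]]
        by (simp add: add.assoc)
    next
      case 3
      then have "c \<notin> verts G" using disj by auto
      moreover from 3 have "y = p \<and> z = c \<or> y = c \<and> z = p" by (simp add: doubleton_eq_iff)
      ultimately show ?thesis using 3(2,3)
        by (elim disjE conjE) (simp_all add: gdist_self add.assoc)
    qed
  qed
  then show ?thesis using x by (simp add: gdist_self)
qed

lemma gdist_join_left:
  assumes "x \<in> verts G" "y \<in> verts G"
  shows "gdist (join G H p c) x y = gdist G x y"
  using gdist_join_lower[OF assms(1), of y p c] assms gdist_antimono[of G "join G H p c" x y]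
  by (auto intro: order.antisym)

lemma gdist_join_cross_le:
  assumes "x \<in> verts G" "y \<in> verts H"
  shows "gdist (join G H p c) x y \<le> gdist G x p + 1 + gdist H c y"
proof (cases "p \<in> verts G \<and> c \<in> verts H")
  case True
  let ?J = "join G H p c"
  have "gdist ?J x y \<le> gdist ?J x p + (gdist ?J p c + gdist ?J c y)"
    by (meson gdist_triangle add_left_mono order_trans)
  also have "\<dots> \<le> gdist G x p + (1 + gdist H c y)"
    using True by (intro add_mono gdist_antimono gdist_adjacent) auto
  finally show ?thesis by (simp add: add.assoc)
next
  case False
  then have "gdist G x p = \<infinity> \<or> gdist H c y = \<infinity>" using gdist_infinity by metis
  then show ?thesis by auto
qed

lemma gdist_join_cross:
  assumes "x \<in> verts G" "y \<in> verts H"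
  shows "gdist (join G H p c) x y = gdist G x p + 1 + gdist H c y"
proof (rule order.antisym[OF gdist_join_cross_le[OF assms]])
  have "y \<notin> verts G" using assms disj by auto
  then show "gdist G x p + 1 + gdist H c y \<le> gdist (join G H p c) x y"
    using gdist_join_lower[OF assms(1), of y p c] by simp
qed

end

lemma gdist_join_right:
  assumes "simple_graph G" "simple_graph H" "verts G \<inter> verts H = {}" "x \<in> verts H" "y \<in> verts H"
  shows "gdist (join G H p c) x y = gdist H x y"
  using gdist_join_left[of H G x y c p] assms by (auto simp: join_commute[of G H])

text \<open>Summation over ordered pairs avoids comparing vertices of the two sides in the linear
  order. Of the four blocks the two mixed ones agree by symmetry, so halving leaves one of
  them.\<close>

lemma IGL_join:
  assumes "simple_graph G" "simple_graph H" "verts G \<inter> verts H = {}"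
  shows "IGL (join G H p c) = IGL G + IGL H +
    (\<Sum>x\<in>verts G. \<Sum>y\<in>verts H. inv_enat (gdist G p x + 1 + gdist H c y))"
proof -
  let ?J = "join G H p c" and ?A = "verts G" and ?B = "verts H"
  let ?d = "\<lambda>x y. inv_enat (gdist ?J x y)"
  have fin: "finite ?A" "finite ?B" using assms by (auto simp: simple_graph_def)
  have split: "(\<Sum>v\<in>?A \<union> ?B. f v) = (\<Sum>v\<in>?A. f v) + (\<Sum>v\<in>?B. f v)" for f :: "'a \<Rightarrow> real"
    by (rule sum.union_disjoint) (use fin assms in auto)
  have AA: "(\<Sum>x\<in>?A. \<Sum>y\<in>?A. ?d x y) = 2 * IGL G"
    by (subst IGL_double[OF fin(1)]) (auto intro!: sum.cong simp: gdist_join_left[OF assms])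
  have BB: "(\<Sum>x\<in>?B. \<Sum>y\<in>?B. ?d x y) = 2 * IGL H"
    by (subst IGL_double[OF fin(2)]) (auto intro!: sum.cong simp: gdist_join_right[OF assms])
  have AB: "(\<Sum>x\<in>?A. \<Sum>y\<in>?B. ?d x y) =
      (\<Sum>x\<in>?A. \<Sum>y\<in>?B. inv_enat (gdist G p x + 1 + gdist H c y))"
    by (auto intro!: sum.cong simp: gdist_join_cross[OF assms] gdist_sym[of G _ p])
  have BA: "(\<Sum>x\<in>?B. \<Sum>y\<in>?A. ?d x y) = (\<Sum>x\<in>?A. \<Sum>y\<in>?B. ?d x y)"
    by (subst sum.swap) (simp add: gdist_sym)
  have "2 * IGL ?J = (\<Sum>x\<in>?A \<union> ?B. \<Sum>y\<in>?A \<union> ?B. ?d x y)"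
    by (subst IGL_double) (use fin in auto)
  also have "\<dots> = 2 * IGL G + 2 * IGL H + 2 * (\<Sum>x\<in>?A. \<Sum>y\<in>?B. ?d x y)"
    by (simp only: split sum.distrib AA BB BA)
  finally show ?thesis using AB by simp
qed

section \<open>Deleting vertices\<close>

lemma delete_verts_sel [simp]:
  "verts (delete_verts G S) = verts G - S" "edges (delete_verts G S) = {e \<in> edges G. e \<inter> S = {}}"
  by (simp_all add: delete_verts_def)

lemma simple_graph_delete: "simple_graph G \<Longrightarrow> simple_graph (delete_verts G S)"
  unfolding simple_graph_def by auto

text \<open>Deletion commutes with joining because a join contains the connecting edge only if both
  its ends are present.\<close>

lemma delete_verts_join:
  assumes "simple_graph G" "simple_graph H" "verts G \<inter> verts H = {}" "S \<subseteq> verts G" "S' \<subseteq> verts H"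
  shows "delete_verts (join G H p c) (S \<union> S') = join (delete_verts G S) (delete_verts H S') p c"
proof -
  have "e \<inter> S' = {}" if "e \<in> edges G" for e using that assms unfolding simple_graph_def by blast
  moreover have "e \<inter> S = {}" if "e \<in> edges H" for e using that assms unfolding simple_graph_def by blast
  moreover have "c \<notin> S" if "c \<in> verts H" using that assms by auto
  moreover have "p \<notin> S'" if "p \<in> verts G" using that assms by auto
  moreover have "{p, c} \<inter> (S \<union> S') = {} \<longleftrightarrow> p \<notin> S \<and> c \<notin> S \<and> p \<notin> S' \<and> c \<notin> S'" by auto
  ultimately have "edges (delete_verts (join G H p c) (S \<union> S')) =
      edges (join (delete_verts G S) (delete_verts H S') p c)"
    by (simp add: Int_Un_distrib) blast
  moreover have "verts G - (S \<union> S') = verts G - S" "verts H - (S \<union> S') = verts H - S'"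
    using assms(3-5) by auto
  then have "verts (delete_verts (join G H p c) (S \<union> S')) =
      verts (join (delete_verts G S) (delete_verts H S') p c)"
    by (simp add: Un_Diff)
  ultimately show ?thesis by simp
qed

section \<open>Optimal deletion sets leave small components\<close>

lemma less_power_4: "x < (4::nat) ^ x"
  by (rule less_exp[THEN less_le_trans]) (simp add: power_mono)

text \<open>Empty if \<open>u\<close> is not a vertex, which later covers the case that the root of
  a cluster has been deleted.\<close>

definition comp_of :: "'a graph \<Rightarrow> 'a \<Rightarrow> 'a set" where
  "comp_of G u = {x \<in> verts G. gdist G u x \<noteq> \<infinity>}"

lemma comp_of_subset: "comp_of G u \<subseteq> verts G"
  unfolding comp_of_def by auto

lemma comp_of_self: "u \<in> verts G \<Longrightarrow> u \<in> comp_of G u"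
  unfolding comp_of_def by (simp add: gdist_self zero_enat_def)

lemma comp_of_eq: "x \<in> comp_of G u \<Longrightarrow> comp_of G x = comp_of G u"
proof -
  assume x: "x \<in> comp_of G u"
  then have "gdist G u x \<noteq> \<infinity>" "gdist G x u \<noteq> \<infinity>"
    by (simp_all add: comp_of_def gdist_sym[of G x u])
  then have "gdist G x y = \<infinity> \<longleftrightarrow> gdist G u y = \<infinity>" for y
    using gdist_triangle[of G u y x] gdist_triangle[of G x y u]
    by (metis enat_ord_code(3) enat_ord_simps(5) order_antisym plus_eq_infty_iff_enat)
  then show ?thesis by (auto simp: comp_of_def)
qed

lemma comp_of_edge: "{x, y} \<in> edges G \<Longrightarrow> y \<in> verts G \<Longrightarrow> x \<in> comp_of G u \<Longrightarrow> y \<in> comp_of G u"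
  using gdist_step[of x y G u] unfolding comp_of_def
  by (metis (mono_tags, lifting) enat_ord_simps(5) infinity_ne_i1 mem_Collect_eq plus_eq_infty_iff_enat)

text \<open>Induction on the size of \<open>C\<close>, removing an element with the largest value of
  \<open>d\<close>. That value is at most \<open>card C\<close>, so the removed term is at least the
  last term of the harmonic sum.\<close>

lemma harmonic_le_sum:
  fixes d :: "'a \<Rightarrow> nat"
  assumes "finite C" "\<forall>y\<in>C. 1 \<le> d y" "\<forall>y\<in>C. 1 < d y \<longrightarrow> (\<exists>z\<in>C. Suc (d z) = d y)"
  shows "(\<Sum>i = 1..card C. 1 / real i) \<le> (\<Sum>y\<in>C. 1 / real (d y))"
  using assms
proof (induction "card C" arbitrary: C)
  case (Suc m)
  then have C: "C \<noteq> {}" by auto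
  note d3 = Suc.prems(3)
  obtain y where y: "y \<in> C" "\<forall>z\<in>C. d z \<le> d y"
  proof -
    have "Max (d ` C) \<in> d ` C" using C Suc.prems(1) by (intro Max_in) auto
    then obtain y where "y \<in> C" "Max (d ` C) = d y" by auto
    moreover have "\<forall>z\<in>C. d z \<le> Max (d ` C)" using Suc.prems(1) by simp
    ultimately show ?thesis using that[of y] by simp
  qed
  \<comment> \<open>Descending from \<open>y\<close> through predecessors meets every value from 1
    to \<open>d y\<close>, so \<open>C\<close> has at least \<open>d y\<close> elements.\<close>
  have "d y - j \<in> d ` C" if "j < d y" for j
    using that
  proof (induction j)
    case (Suc j)
    then obtain x where "x \<in> C" "d x = d y - j" by auto
    moreover from this have "1 < d x" using Suc.prems by linarith
    ultimately obtain z where "z \<in> C" "Suc (d z) = d x" using d3 by blast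
    with \<open>d x = d y - j\<close> have "z \<in> C" "Suc (d z) = d y - j" by simp_all
    then show ?case by (auto simp: image_iff intro!: bexI[of _ z])
  qed (use y in auto)
  then have "{1..d y} \<subseteq> d ` C"
    by (metis Suc_le_eq One_nat_def atLeastAtMost_iff diff_diff_cancel diff_less less_le_trans subsetI)
  then have "card {1..d y} \<le> card (d ` C)" using Suc.prems(1) by (intro card_mono) auto
  also have "\<dots> \<le> card C" using Suc.prems(1) by (rule card_image_le)
  finally have dy: "d y \<le> card C" by simp
  have m: "m = card (C - {y})" using Suc y by simp
  have "(\<Sum>i = 1..card (C - {y}). 1 / real i) \<le> (\<Sum>z\<in>C - {y}. 1 / real (d z))"
  proof (rule Suc.hyps(1)[OF m])
    \<comment> \<open>Predecessors survive the removal: the predecessor of some \<open>x\<close> has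
      a smaller value than \<open>x\<close>, hence is not the maximal element
      \<open>y\<close>.\<close>
    show "\<forall>x\<in>C - {y}. 1 < d x \<longrightarrow> (\<exists>z\<in>C - {y}. Suc (d z) = d x)"
    proof (intro ballI impI)
      fix x assume x: "x \<in> C - {y}" "1 < d x"
      then obtain z where "z \<in> C" "Suc (d z) = d x" using Suc.prems by auto
      moreover from this have "z \<noteq> y" using y x by force
      ultimately show "\<exists>z\<in>C - {y}. Suc (d z) = d x" by auto
    qed
  qed (use Suc.prems in auto)
  moreover have "1 / real (card C) \<le> 1 / real (d y)"
    using dy Suc.prems y by (intro divide_left_mono) (auto simp: Suc_le_eq)
  moreover have "(\<Sum>z\<in>C. 1 / real (d z)) = (\<Sum>z\<in>C - {y}. 1 / real (d z)) + 1 / real (d y)"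
    using y Suc.prems(1) by (simp add: sum.remove)
  moreover have "(\<Sum>i = 1..card C. 1 / real i) = (\<Sum>i = 1..card (C - {y}). 1 / real i) + 1 / real (card C)"
    unfolding m[symmetric] using Suc.hyps(2) by (simp flip: Suc.hyps(2))
  ultimately show ?case by linarith
qed simp

text \<open>Oresme's argument: the \<open>2 ^ k\<close> terms between \<open>2 ^ k\<close> and
  \<open>2 ^ Suc k\<close> are each at least \<open>1 / 2 ^ Suc k\<close> and together contribute at
  least one half.\<close>

lemma harmonic_power_2: "1 + real k / 2 \<le> (\<Sum>i = 1..2 ^ k. 1 / real i)"
proof (induction k)
  case (Suc k)
  have "(\<Sum>i \<in> {1..2 ^ Suc k}. 1 / real i) =
      (\<Sum>i \<in> {1..2 ^ k}. 1 / real i) + (\<Sum>i \<in> {2 ^ k<..2 ^ Suc k}. 1 / real i)"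
    by (subst sum.union_disjoint[symmetric]) (auto intro!: sum.cong)
  moreover have "(\<Sum>i \<in> {2 ^ k<..(2::nat) ^ Suc k}. 1 / (2::real) ^ Suc k)
      \<le> (\<Sum>i \<in> {2 ^ k<..2 ^ Suc k}. 1 / real i)"
  proof (rule sum_mono)
    fix i :: nat assume i: "i \<in> {2 ^ k<..2 ^ Suc k}"
    then have "real i \<le> real (2 ^ Suc k)" unfolding of_nat_le_iff by auto
    then show "1 / (2::real) ^ Suc k \<le> 1 / real i" using i by (intro divide_left_mono) auto
  qed
  ultimately show ?case using Suc by (simp add: field_simps)
qed simp

text \<open>Since \<open>4 ^ g = 2 ^ (2 * g)\<close>, the dyadic bound gives \<open>1 + g\<close>.
  This is why the thresholds are powers of 4: the exponent is the guaranteed gain.\<close>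

lemma harmonic_power_4:
  assumes "4 ^ g \<le> m"
  shows "real g < (\<Sum>i = 1..m. 1 / real i)"
proof -
  have "real g < 1 + real (2 * g) / 2" by simp
  also have "\<dots> \<le> (\<Sum>i = 1..2 ^ (2 * g). 1 / real i)" by (rule harmonic_power_2)
  also have "\<dots> \<le> (\<Sum>i = 1..m. 1 / real i)"
    by (rule sum_mono2) (use assms in \<open>auto simp: power_mult\<close>)
  finally show ?thesis .
qed

lemma harmonic_le_sum_gdist:
  assumes "finite (verts G)" "c \<in> verts G"
  shows "(\<Sum>i = 1..card (comp_of G c) - 1. 1 / real i) \<le> (\<Sum>y\<in>comp_of G c - {c}. inv_enat (gdist G c y))"
proof -
  let ?C = "comp_of G c - {c}" and ?d = "\<lambda>y. the_enat (gdist G c y)"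
  have d: "gdist G c y = enat (?d y)" if "y \<in> ?C" for y
    using that by (auto simp: comp_of_def)
  have d1: "1 \<le> ?d y" if "y \<in> ?C" for y
  proof -
    obtain e where "gdist G c y = enat e" using d[OF \<open>y \<in> ?C\<close>] by blast
    then show ?thesis using \<open>y \<in> ?C\<close> gdist_ge_1[of c y G] by (auto simp: one_enat_def)
  qed
  have fin: "finite (comp_of G c)" using assms comp_of_subset finite_subset by metis
  have "(\<Sum>i = 1..card ?C. 1 / real i) \<le> (\<Sum>y\<in>?C. 1 / real (?d y))"
  proof (rule harmonic_le_sum)
    show "\<forall>y\<in>?C. 1 < ?d y \<longrightarrow> (\<exists>z\<in>?C. Suc (?d z) = ?d y)"
    proof (intro ballI impI)
      fix y assume y: "y \<in> ?C" "1 < ?d y"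
      obtain e where e: "?d y = Suc e" "e \<noteq> 0" using y(2) by (cases "?d y") auto
      have "gdist G c y = enat (Suc e)" using d[OF y(1)] e by simp
      then obtain z where z: "gdist G c z = enat e" "z \<in> verts G"
        by (rule gdist_pred)
      moreover have "z \<noteq> c" using z e assms by (auto simp: gdist_self zero_enat_def)
      ultimately show "\<exists>z\<in>?C. Suc (?d z) = ?d y" using e
        by (intro bexI[of _ z]) (auto simp: comp_of_def)
    qed
  qed (use fin d1 in auto)
  also have "\<dots> = (\<Sum>y\<in>?C. inv_enat (gdist G c y))"
    by (rule sum.cong) (auto simp: comp_of_def inv_enat_def)
  finally show ?thesis using assms fin comp_of_self[of c G] by simp
qed

text \<open>Each pair contributes at most 1. The bound is crude, but only a bound in terms of the
  number of vertices is wanted for the loss in an exchange.\<close>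

lemma IGL_le_square:
  assumes "finite (verts G)"
  shows "IGL G \<le> real (card (verts G)) ^ 2"
proof -
  have "2 * IGL G \<le> (\<Sum>u\<in>verts G. \<Sum>v\<in>verts G. 1)"
    unfolding IGL_double[OF assms] by (intro sum_mono inv_enat_le_1)
  also have "\<dots> = real (card (verts G)) ^ 2" by (simp add: power2_eq_square)
  finally show ?thesis using IGL_nonneg[of G] by linarith
qed

section \<open>Induced subgraphs and the gain from removing a vertex\<close>

definition induce :: "'a graph \<Rightarrow> 'a set \<Rightarrow> 'a graph" where
  "induce G A = delete_verts G (- A)"

lemma induce_sel [simp]:
  "verts (induce G A) = verts G \<inter> A" "edges (induce G A) = {e \<in> edges G. e \<subseteq> A}"
  unfolding induce_def by auto

lemma simple_graph_induce: "simple_graph G \<Longrightarrow> simple_graph (induce G A)"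
  unfolding induce_def by (rule simple_graph_delete)

lemma delete_verts_eq_induce: "simple_graph G \<Longrightarrow> delete_verts G S = induce G (verts G - S)"
  unfolding induce_def delete_verts_def simple_graph_def by (auto; blast)

text \<open>A disjoint union without edges in between is a join whose connecting edge is absent,
  because \<open>p\<close> is no vertex of the left part. The lemmas on joins then apply, with all
  distances across equal to \<infinity>.\<close>

lemma induce_union:
  assumes "simple_graph G" "A \<inter> B = {}" and "p \<notin> A"
    and no: "\<And>x y. {x, y} \<in> edges G \<Longrightarrow> x \<in> A \<Longrightarrow> y \<in> B \<Longrightarrow> False"
  shows "induce G (A \<union> B) = join (induce G A) (induce G B) p c"
proof -
  have "e \<subseteq> A \<or> e \<subseteq> B" if "e \<in> edges G" "e \<subseteq> A \<union> B" for e
  proof -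
    have "card e = 2" using that(1) assms(1) unfolding simple_graph_def by blast
    then obtain x y where e: "e = {x, y}" by (meson card_2_iff)
    then have "{x, y} \<in> edges G" "{y, x} \<in> edges G" using that(1) by (simp_all add: insert_commute)
    then have "\<not> (x \<in> A \<and> y \<in> B)" "\<not> (y \<in> A \<and> x \<in> B)" using no by blast+
    then show ?thesis using that(2) unfolding e by simp blast
  qed
  then have "e \<in> edges G \<and> e \<subseteq> A \<union> B \<longleftrightarrow> e \<in> edges G \<and> (e \<subseteq> A \<or> e \<subseteq> B)" for e
    by (meson subset_trans sup_ge1 sup_ge2)
  then have "{e \<in> edges G. e \<subseteq> A \<union> B} = {e \<in> edges G. e \<subseteq> A} \<union> {e \<in> edges G. e \<subseteq> B}"
    by (simp add: set_eq_iff) metis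
  then have "edges (induce G (A \<union> B)) = edges (join (induce G A) (induce G B) p c)"
    using assms(3) by simp
  moreover have "verts (induce G (A \<union> B)) = verts (join (induce G A) (induce G B) p c)" by auto
  ultimately show ?thesis by simp
qed

context
  fixes G :: "'a graph" and A B
  assumes simple: "simple_graph G" and disj: "A \<inter> B = {}"
    and no: "\<And>x y. {x, y} \<in> edges G \<Longrightarrow> x \<in> A \<Longrightarrow> y \<in> B \<Longrightarrow> False"
begin

lemma comp_of_induce_union:
  assumes u: "u \<in> verts G \<inter> A" "p \<notin> A"
  shows "comp_of (induce G (A \<union> B)) u = comp_of (induce G A) u"
proof -
  note * = simple_graph_induce[OF simple, of A] simple_graph_induce[OF simple, of B]
  have d: "verts (induce G A) \<inter> verts (induce G B) = {}" using disj by auto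
  let ?J = "join (induce G A) (induce G B) p p"
  have eq: "induce G (A \<union> B) = ?J" by (rule induce_union[OF simple disj u(2) no])
  have "gdist ?J u x = gdist (induce G A) u x" if "x \<in> verts (induce G A)" for x
    by (rule gdist_join_left[OF * d]) (use that u in auto)
  moreover have "gdist ?J u x = \<infinity>" if "x \<in> verts (induce G B)" for x
    using gdist_join_cross[OF * d, of u x p p] u that gdist_infinity[of p "induce G A" p]
      gdist_infinity[of u "induce G A" p] by auto
  ultimately show ?thesis unfolding eq comp_of_def by auto
qed

end

lemma IGL_induce_union:
  assumes "simple_graph G" "A \<inter> B = {}" and "p \<notin> A"
    and "\<And>x y. {x, y} \<in> edges G \<Longrightarrow> x \<in> A \<Longrightarrow> y \<in> B \<Longrightarrow> False"
  shows "IGL (induce G (A \<union> B)) = IGL (induce G A) + IGL (induce G B)"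
proof -
  have d: "verts (induce G A) \<inter> verts (induce G B) = {}" using assms(2) by auto
  have "gdist (induce G A) p x = \<infinity>" for x
    using gdist_infinity[of p "induce G A" x] assms by auto
  moreover have "induce G (A \<union> B) = join (induce G A) (induce G B) p p"
    by (rule induce_union[OF assms])
  ultimately show ?thesis
    using IGL_join[OF simple_graph_induce simple_graph_induce d] assms(1) by simp
qed

text \<open>Distances between the remaining vertices can only grow, so their terms do not increase,
  and all terms of pairs with \<open>c\<close> disappear. The latter sum to at least a harmonic
  number of the component size minus one.\<close>

lemma IGL_induce_remove:
  assumes G: "simple_graph G" and c: "c \<in> A" "A \<subseteq> verts G"
    and comp: "4 ^ g < card (comp_of (induce G A) c)"
  shows "IGL (induce G (A - {c})) + real g < IGL (induce G A)"
proof -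
  let ?H = "induce G A" and ?K = "induce G (A - {c})"
  let ?C = "comp_of ?H c - {c}"
  have fin: "finite (verts G)" using G by (simp add: simple_graph_def)
  have finA: "finite A" using fin c finite_subset by auto
  have V: "verts ?H = insert c (A - {c})" "verts ?K = A - {c}" "finite (A - {c})" using c finA by auto
  \<comment> \<open>The diagonal is treated separately because \<open>inv_enat\<close> is not
    antitone at 0.\<close>
  have mono: "inv_enat (gdist ?K x y) \<le> inv_enat (gdist ?H x y)" if "x \<in> A - {c}" for x y
  proof (cases "x = y")
    case True
    moreover have "y \<in> verts ?K" "y \<in> verts ?H" using True that c by auto
    ultimately show ?thesis by (simp add: gdist_self del: induce_sel)
  next
    case False
    then show ?thesis
      by (intro inv_enat_antimono gdist_ge_1 gdist_antimono) auto
  qed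
  have "2 * IGL ?H = (\<Sum>x\<in>A - {c}. \<Sum>y\<in>A - {c}. inv_enat (gdist ?H x y))
      + 2 * (\<Sum>y\<in>A - {c}. inv_enat (gdist ?H c y))"
  proof -
    have "2 * IGL ?H = (\<Sum>x\<in>insert c (A - {c}). \<Sum>y\<in>insert c (A - {c}). inv_enat (gdist ?H x y))"
      using IGL_double[of ?H] V by simp
    moreover have "(\<Sum>x\<in>A - {c}. inv_enat (gdist ?H x c)) = (\<Sum>y\<in>A - {c}. inv_enat (gdist ?H c y))"
      by (rule sum.cong[OF refl], rule arg_cong[where f = inv_enat], rule gdist_sym)
    moreover have "gdist ?H c c = 0" using V by (intro gdist_self) simp
    ultimately show ?thesis
      using V(3) by (simp add: sum.distrib del: insert_Diff_single)
  qed
  moreover have "2 * IGL ?K = (\<Sum>x\<in>A - {c}. \<Sum>y\<in>A - {c}. inv_enat (gdist ?K x y))"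
    using IGL_double[of ?K] V by simp
  moreover have "\<dots> \<le> (\<Sum>x\<in>A - {c}. \<Sum>y\<in>A - {c}. inv_enat (gdist ?H x y))"
    by (intro sum_mono mono) auto
  moreover have "(\<Sum>y\<in>?C. inv_enat (gdist ?H c y)) \<le> (\<Sum>y\<in>A - {c}. inv_enat (gdist ?H c y))"
    by (rule sum_mono2) (use finA in \<open>auto simp: comp_of_def inv_enat_nonneg\<close>)
  moreover have "(\<Sum>i = 1..card (comp_of ?H c) - 1. 1 / real i) \<le> (\<Sum>y\<in>?C. inv_enat (gdist ?H c y))"
    by (rule harmonic_le_sum_gdist) (use fin c in auto)
  moreover have "real g < (\<Sum>i = 1..card (comp_of ?H c) - 1. 1 / real i)"
    by (rule harmonic_power_4) (use comp in linarith)
  ultimately show ?thesis by linarith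
qed

text \<open>The tree is rooted at 0 and given by an order in which its edges can be attached: edge
  \<open>i\<close> hangs the new vertex \<open>C i\<close> below the older vertex
  \<open>P i\<close>. Connectedness and acyclicity are built into this order, so proofs proceed by
  induction along it.\<close>

locale grown_tree =
  fixes T :: "nat graph" and P C :: "nat \<Rightarrow> nat" and m :: nat
  assumes simple: "simple_graph T"
    and verts_T: "verts T = insert 0 (C ` {..<m})"
    and edges_T: "edges T = (\<lambda>i. {P i, C i}) ` {..<m}"
    and parent: "i < m \<Longrightarrow> P i \<in> insert 0 (C ` {..<i})"
    and child: "i < m \<Longrightarrow> C i \<notin> insert 0 (C ` {..<i})"
begin

lemma finite_verts: "finite (verts T)"
  by (simp add: verts_T)

lemma inj_C: "inj_on C {..<m}"
proof (rule inj_onI)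
  fix i j assume "i \<in> {..<m}" "j \<in> {..<m}" "C i = C j"
  then show "i = j" using child[of i] child[of j] imageI[of i "{..<j}" C] imageI[of j "{..<i}" C]
    by (cases i j rule: linorder_cases) auto
qed

lemma card_verts: "card (verts T) = Suc m"
proof -
  have "0 \<notin> C ` {..<m}" using child by force
  then show ?thesis by (simp add: verts_T card_image[OF inj_C])
qed

text \<open>The nearest deleted ancestor, the vertex itself included, or \<open>None\<close>.
  Attaching the edges in order guarantees that the value of the parent is known when the child is
  reached.\<close>

fun nearest :: "nat set \<Rightarrow> nat \<Rightarrow> nat \<Rightarrow> nat option" where
  "nearest S 0 = (\<lambda>x. if x = 0 \<and> 0 \<in> S then Some 0 else None)"
| "nearest S (Suc i) = (nearest S i)(C i := if C i \<in> S then Some (C i) else nearest S i (P i))"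

lemma nearest_stable:
  assumes "i \<le> j" "j \<le> m" "x \<in> insert 0 (C ` {..<i})"
  shows "nearest S j x = nearest S i x"
  using assms(1,2)
proof (induction rule: dec_induct)
  case (step j)
  have "C ` {..<i} \<subseteq> C ` {..<j}" using step by auto
  then have "C j \<noteq> x" using child[of j] step assms(3) by auto
  then show ?case using step by simp
qed simp

lemma nearest_root: "nearest S m 0 = (if 0 \<in> S then Some 0 else None)"
  using nearest_stable[of 0 m 0 S] by simp

lemma nearest_child:
  assumes "i < m"
  shows "nearest S m (C i) = (if C i \<in> S then Some (C i) else nearest S m (P i))"
  using nearest_stable[of "Suc i" m "C i" S] nearest_stable[of i m "P i" S] parent[OF assms] assms
  by auto

lemma nearest_self: "s \<in> S \<Longrightarrow> s \<in> verts T \<Longrightarrow> nearest S m s = Some s"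
  unfolding verts_T using nearest_root[of S] nearest_child[of _ S] by auto

definition territory :: "nat set \<Rightarrow> nat \<Rightarrow> nat set" where
  "territory S s = {x \<in> verts T. nearest S m x = Some s}"

lemma territory_self: "s \<in> S \<Longrightarrow> s \<in> verts T \<Longrightarrow> s \<in> territory S s"
  by (simp add: territory_def nearest_self)

lemma territory_other: "x \<in> territory S s \<Longrightarrow> x \<in> S \<Longrightarrow> x = s"
  using nearest_self[of x S] by (auto simp: territory_def)

text \<open>An undeleted child inherits the value of its parent, so going down without entering
  \<open>S\<close> stays inside the territory. Going up from an undeleted vertex stays inside for
  the same reason. The only way out leads from \<open>s\<close> to its parent.\<close>

lemma territory_exit:
  "\<exists>p. \<forall>x y. {x, y} \<in> edges T \<longrightarrow> x \<in> territory S s \<longrightarrow> y \<notin> S \<longrightarrow>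
    y \<notin> territory S s \<longrightarrow> x = s \<and> y = p"
proof -
  \<comment> \<open>\<open>p\<close> is the parent of \<open>s\<close>, with default 0 if
    \<open>s\<close> is not a child.\<close>
  define p where "p = (if s \<in> C ` {..<m} then P (inv_into {..<m} C s) else 0)"
  have "x = s \<and> y = p"
    if e: "{x, y} \<in> edges T" and x: "x \<in> territory S s" and y: "y \<notin> S" "y \<notin> territory S s" for x y
  proof -
    obtain i where i: "i < m" "{x, y} = {P i, C i}" using e edges_T by auto
    have V: "x \<in> verts T" "y \<in> verts T" using e simple simple_graph_edge by metis+
    from i consider "x = P i" "y = C i" | "x = C i" "y = P i" by (auto simp: doubleton_eq_iff)
    then show ?thesis
    proof cases
      case 1
      then show ?thesis using nearest_child[OF i(1), of S] x y V by (auto simp: territory_def)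
    next
      case 2
      then have "x \<in> S"
        using nearest_child[OF i(1), of S] x y V by (auto simp: territory_def split: if_splits)
      then have "x = s" using x territory_other by auto
      moreover from this have "p = P i"
        unfolding p_def using 2 i inv_into_f_f[OF inj_C, of i] by auto
      ultimately show ?thesis using 2 by simp
    qed
  qed
  then show ?thesis by blast
qed

text \<open>The territories are disjoint, so if each had more than \<open>q\<close> elements there
  would be more than \<open>q * card S\<close> vertices.\<close>

lemma small_territory:
  assumes "S \<subseteq> verts T" "0 < card S" "card (verts T) \<le> q * card S"
  obtains s where "s \<in> S" "card (territory S s) \<le> q"
proof -
  have fin: "finite S" using assms finite_verts finite_subset by auto
  have fint: "finite (territory S s)" for s
    using finite_verts by (simp add: territory_def)
  have "\<exists>s\<in>S. card (territory S s) \<le> q"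
  proof (rule ccontr)
    assume "\<not> ?thesis"
    then have "(\<Sum>s\<in>S. Suc q) \<le> (\<Sum>s\<in>S. card (territory S s))"
      by (intro sum_mono) auto
    also have "\<dots> = card (\<Union>s\<in>S. territory S s)"
      by (rule card_UN_disjoint[symmetric]) (use fin fint in \<open>auto simp: territory_def\<close>)
    also have "\<dots> \<le> card (verts T)"
      by (rule card_mono) (use finite_verts in \<open>auto simp: territory_def\<close>)
    finally show False using assms by (simp add: mult.commute[of q])
  qed
  then show ?thesis using that by blast
qed

text \<open>
  If a component were too large, deleting one of its vertices instead of a vertex \<open>s\<close> with small
  territory would pay off: the gain is at least a harmonic number, and the loss is bounded
  in terms of the territory and of the component of the parent \<open>p\<close> of \<open>s\<close>. If the latter
  component is itself too large, it is \<open>p\<close> that gets deleted.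
\<close>

lemma optimal_imp_small_components:
  assumes S: "S \<subseteq> verts T" "0 < card S" "card (verts T) \<le> q * card S"
    and opt: "\<And>S'. S' \<subseteq> verts T \<Longrightarrow> card S' = card S \<Longrightarrow> IGL (delete_verts T S) \<le> IGL (delete_verts T S')"
    and B1: "B1 = 4 ^ (q\<^sup>2)" and B: "B = 4 ^ ((q + B1)\<^sup>2)"
    and u: "u \<in> verts T - S"
  shows "card (comp_of (delete_verts T S) u) \<le> B"
proof (rule ccontr)
  assume big: "\<not> ?thesis"
  obtain s where s: "s \<in> S" "card (territory S s) \<le> q"
    using small_territory[OF S] .
  obtain p where p: "\<And>x y. {x, y} \<in> edges T \<Longrightarrow> x \<in> territory S s \<Longrightarrow> y \<notin> S \<Longrightarrow>
    y \<notin> territory S s \<Longrightarrow> x = s \<and> y = p" using territory_exit[where S = S and s = s] by blast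
  have qq: "x \<le> x\<^sup>2" for x :: nat by (simp add: power2_eq_square)
  have qB1: "q \<le> B1" using less_power_4[of "q\<^sup>2"] qq[of q] B1 by linarith
  have B1B: "q + B1 \<le> B" using less_power_4[of "(q + B1)\<^sup>2"] qq[of "q + B1"] B by linarith
  let ?V = "verts T" and ?ig = "\<lambda>A. IGL (induce T A)"
  define Y where "Y = territory S s"
  \<comment> \<open>\<open>Y\<close> is what an exchange has to reckon with once \<open>s\<close> is
    restored, and \<open>Z\<close> collects the surviving vertices outside \<open>Y\<close>. An edge
    between the two can only be \<open>{s, p}\<close>.\<close>
  define Z where "Z = ?V - S - Y"
  have finV: "finite ?V" by (rule finite_verts)
  have finS: "finite S" using S finV finite_subset by auto
  have YV: "Y \<subseteq> ?V" "s \<in> Y" "Y \<inter> S = {s}" and ZV: "Z \<subseteq> ?V" "Z \<inter> Y = {}" "Z \<inter> S = {}"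
    using territory_self[OF s(1)] s S territory_other[where S = S and s = s]
    unfolding Y_def Z_def by (auto simp: territory_def)
  have sZ: "s \<notin> Z" using YV ZV by auto
  have VS: "?V - S = (Y - {s}) \<union> Z" unfolding Z_def using YV by auto
  have finYZ: "finite Y" "finite Z" using YV ZV finV finite_subset by metis+
  have ig_le: "?ig A \<le> real (c\<^sup>2)" if "A \<subseteq> ?V" "card A \<le> c" for A c
  proof -
    have "?ig A \<le> real (card (?V \<inter> A)) ^ 2" using IGL_le_square[of "induce T A"] finV by simp
    also have "?V \<inter> A = A" using that by auto
    also have "real (card A) ^ 2 \<le> real c ^ 2" using that by (intro power_mono) auto
    finally show ?thesis by simp
  qed
  have swap: "?ig (?V - S) \<le> ?ig (?V - insert x (S - {s}))" if "x \<in> ?V - S" for x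
  proof -
    have "insert x (S - {s}) \<subseteq> ?V" "card (insert x (S - {s})) = card S"
      using that S s finS by (auto simp: card_insert_if card_gt_0_iff)
    then show ?thesis using opt[of "insert x (S - {s})"] delete_verts_eq_induce[OF simple] by metis
  qed
  have YZp: "x = s \<and> y = p" if "{x, y} \<in> edges T" "x \<in> Y" "y \<in> Z" for x y
    using p[of x y] ZV that unfolding Y_def[symmetric] by auto
  then have YZ: "{x, y} \<in> edges T \<Longrightarrow> x \<in> Y - {s} \<Longrightarrow> y \<in> Z \<Longrightarrow> False" for x y
    by blast
  then have YZ': "{x, y} \<in> edges T \<Longrightarrow> x \<in> Z \<Longrightarrow> y \<in> Y - {s} \<Longrightarrow> False" for x y
    by (metis insert_commute)
  have igVS: "?ig (?V - S) = ?ig (Y - {s}) + ?ig Z"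
    unfolding VS by (rule IGL_induce_union[OF simple _ _ YZ, where p = s]) (use ZV in auto)
  then have igZ: "?ig Z \<le> ?ig (?V - S)" using IGL_nonneg[of "induce T (Y - {s})"] by linarith
  show False
  proof (cases "p \<in> Z \<and> B1 < card (comp_of (induce T Z) p)")
    case True
    \<comment> \<open>The exchange deletes \<open>p\<close>, the only vertex of \<open>Z\<close>
      that \<open>Y\<close> can touch. Hence \<open>Y\<close> stays separate and contributes at most
      \<open>q^2\<close>, while the removal of \<open>p\<close> gains more than \<open>q^2\<close>
      on \<open>Z\<close>.\<close>
    have "?V - insert p (S - {s}) = Y \<union> (Z - {p})"
      using True YV ZV unfolding Z_def by auto
    moreover have "?ig (Y \<union> (Z - {p})) = ?ig Y + ?ig (Z - {p})"
      by (rule IGL_induce_union[OF simple, where p = p]) (use ZV YV True in \<open>auto dest: YZp\<close>)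
    moreover have "?ig Y \<le> real (q\<^sup>2)" by (rule ig_le) (use YV s in \<open>auto simp: Y_def\<close>)
    moreover have "?ig (Z - {p}) + real (q\<^sup>2) < ?ig Z"
      by (rule IGL_induce_remove[OF simple]) (use True ZV B1 in auto)
    moreover have "?ig (?V - S) \<le> ?ig (?V - insert p (S - {s}))"
      by (rule swap) (use True ZV in auto)
    ultimately show False using igZ by simp
  next
    case False
    \<comment> \<open>\<open>K\<close> is the part of \<open>Z\<close> that restoring
      \<open>s\<close> attaches to \<open>Y\<close>; it is empty if \<open>p\<close> does not
      survive.\<close>
    define K where "K = (if p \<in> Z then comp_of (induce T Z) p else {})"
    have K: "card K \<le> B1" "K \<subseteq> Z" using False comp_of_subset[of "induce T Z" p] unfolding K_def by auto
    have del: "delete_verts T S = induce T (Y - {s} \<union> Z)"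
      unfolding delete_verts_eq_induce[OF simple] VS ..
    \<comment> \<open>The oversized component cannot lie within \<open>Y\<close>, which has at most
      \<open>q\<close> vertices.\<close>
    have uZ: "u \<in> Z"
    proof (rule ccontr)
      assume "u \<notin> Z"
      then have "u \<in> ?V \<inter> (Y - {s})" using u VS by auto
      then have "comp_of (delete_verts T S) u = comp_of (induce T (Y - {s})) u"
        unfolding del by (intro comp_of_induce_union[OF simple _ YZ, where p = s]) (use ZV in auto)
      moreover have "card (comp_of (induce T (Y - {s})) u) \<le> card Y"
        using comp_of_subset[of "induce T (Y - {s})" u] finYZ by (intro card_mono) auto
      ultimately have "card (comp_of (delete_verts T S) u) \<le> card Y" by simp
      then show False using big s qB1 B1B unfolding Y_def by linarith
    qed
    have "comp_of (delete_verts T S) u = comp_of (induce T Z) u"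
      unfolding del Un_commute[of "Y - {s}"]
      by (intro comp_of_induce_union[OF simple _ YZ', where p = s]) (use ZV uZ sZ in auto)
    with big have bigZ: "B < card (comp_of (induce T Z) u)" by simp
    \<comment> \<open>\<open>K\<close> has at most \<open>B1 \<le> B\<close> vertices, so the
      oversized component of \<open>u\<close> is a different one and is not affected by restoring
      \<open>s\<close>.\<close>
    have uK: "u \<notin> K"
    proof
      assume a: "u \<in> K"
      then have "p \<in> Z" "u \<in> comp_of (induce T Z) p" unfolding K_def by (auto split: if_splits)
      then show False using comp_of_eq[of u "induce T Z" p] bigZ K a B1B unfolding K_def by auto
    qed
    have KZ: "False" if "{x, y} \<in> edges T" "x \<in> K" "y \<in> Z - K" for x y
    proof -
      have "p \<in> Z" using that by (auto simp: K_def split: if_splits)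
      moreover have "{x, y} \<in> edges (induce T Z)" using that K by auto
      ultimately show False using comp_of_edge[of x y "induce T Z" p] that ZV unfolding K_def by auto
    qed
    have KZ': "{x, y} \<in> edges T \<Longrightarrow> x \<in> Z - K \<Longrightarrow> y \<in> K \<Longrightarrow> False" for x y
      using KZ by (metis insert_commute)
    have Zeq: "Z = (Z - K) \<union> K" using K by auto
    have "comp_of (induce T ((Z - K) \<union> K)) u = comp_of (induce T (Z - K)) u"
      by (intro comp_of_induce_union[OF simple _ KZ', where p = s])
         (use ZV uZ sZ uK in auto)
    then have bigK: "4 ^ ((q + B1)\<^sup>2) < card (comp_of (induce T (Z - K)) u)"
      using bigZ Zeq B by simp
    have "?ig ((Z - K) \<union> K) = ?ig (Z - K) + ?ig K"
      by (rule IGL_induce_union[OF simple _ _ KZ', where p = s]) (use sZ in auto)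
    then have 1: "?ig (Z - K) \<le> ?ig Z" using Zeq IGL_nonneg[of "induce T K"] by simp
    have 2: "?ig (Z - K - {u}) + real ((q + B1)\<^sup>2) < ?ig (Z - K)"
      by (rule IGL_induce_remove[OF simple _ _ bigK]) (use uZ uK ZV in auto)
    \<comment> \<open>Everything that the restored \<open>s\<close> can be connected to lies in
      these \<open>q + B1\<close> vertices. The exponent in \<open>B\<close> is chosen to outweigh
      their square.\<close>
    have "card (Y \<union> K) \<le> q + B1"
      using card_Un_le[of Y K] s K unfolding Y_def by linarith
    then have 3: "?ig (Y \<union> K) \<le> real ((q + B1)\<^sup>2)"
      by (intro ig_le) (use YV K ZV in auto)
    have "u \<notin> Y" using uZ ZV by auto
    then have 4: "?ig ((Y \<union> K) \<union> (Z - K - {u})) = ?ig (Y \<union> K) + ?ig (Z - K - {u})"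
    proof (intro IGL_induce_union[OF simple, where p = u])
      fix x y assume e: "{x, y} \<in> edges T" and "x \<in> Y \<union> K" and y: "y \<in> Z - K - {u}"
      then consider "x \<in> K" | "x \<in> Y" by auto
      then show False
      proof cases
        case 1
        then show False using KZ e y by auto
      next
        case 2
        then have "y = p" using p[of x y] e y ZV unfolding Y_def by auto
        moreover from this have "p \<in> K" using y ZV comp_of_self[of p "induce T Z"] by (auto simp: K_def)
        ultimately show False using y by auto
      qed
    qed (use ZV K uK in auto)
    have "?V - insert u (S - {s}) = (Y \<union> K) \<union> (Z - K - {u})"
      using uZ uK K YV ZV unfolding Z_def by auto
    moreover have "?ig (?V - S) \<le> ?ig (?V - insert u (S - {s}))"
      by (rule swap) (use uZ ZV in auto)
    ultimately show False using 1 2 3 4 igZ by simp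
  qed
qed

end

section \<open>Distance profiles and merging\<close>

definition dist_nat :: "'a graph \<Rightarrow> 'a \<Rightarrow> 'a \<Rightarrow> nat" where
  "dist_nat G v x = the_enat (gdist G v x)"

lemma gdist_eq_dist_nat: "x \<in> comp_of G v \<Longrightarrow> gdist G v x = enat (dist_nat G v x)"
  by (auto simp: comp_of_def dist_nat_def)

definition profile :: "'a graph \<Rightarrow> 'a \<Rightarrow> nat \<Rightarrow> nat" where
  "profile G v d = card {x \<in> comp_of G v. dist_nat G v x = d}"

text \<open>The generating polynomial of the distance profile, evaluated at \<open>B + 1\<close>. If
  the component has at most \<open>B\<close> vertices, all coefficients are digits in this base and
  the profile can be read off.\<close>

definition code :: "nat \<Rightarrow> 'a graph \<Rightarrow> 'a \<Rightarrow> nat" where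
  "code B G v = (\<Sum>x\<in>comp_of G v. Suc B ^ dist_nat G v x)"

definition small_comps :: "nat \<Rightarrow> 'a graph \<Rightarrow> bool" where
  "small_comps B G \<longleftrightarrow> (\<forall>u\<in>verts G. card (comp_of G u) \<le> B)"

definition digit :: "nat \<Rightarrow> nat \<Rightarrow> nat \<Rightarrow> nat" where
  "digit B c i = c div Suc B ^ i mod Suc B"

definition digit_sum :: "nat \<Rightarrow> nat \<Rightarrow> nat" where
  "digit_sum B c = (\<Sum>i<B. digit B c i)"

definition cross :: "nat \<Rightarrow> nat \<Rightarrow> nat \<Rightarrow> real" where
  "cross B c d = (\<Sum>i<B. \<Sum>j<B. real (digit B c i) * real (digit B d j) / real (i + j + 1))"

lemma positional:
  assumes "\<And>i. a i < b"
  shows "(\<Sum>i<m. a i * b ^ i) < b ^ m \<and> (\<forall>i<m. (\<Sum>i<m. a i * b ^ i) div b ^ i mod b = (a i :: nat))"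
  using assms
proof (induction m arbitrary: a)
  case (Suc m)
  let ?r = "\<Sum>i<m. a (Suc i) * b ^ i"
  have b: "0 < b" using Suc.prems[of 0] by simp
  have eq: "(\<Sum>i<Suc m. a i * b ^ i) = a 0 + b * ?r"
    by (simp add: sum.lessThan_Suc_shift sum_distrib_left mult_ac del: sum.lessThan_Suc)
  have IH: "?r < b ^ m" "\<forall>i<m. ?r div b ^ i mod b = a (Suc i)"
    using Suc.IH[of "\<lambda>i. a (Suc i)"] Suc.prems by auto
  have "a 0 + b * ?r < b * Suc ?r" using Suc.prems[of 0] by simp
  also have "\<dots> \<le> b * b ^ m" using IH(1) by (intro mult_le_mono2) simp
  finally have lt: "a 0 + b * ?r < b ^ Suc m" by simp
  have "(a 0 + b * ?r) div b ^ i mod b = a i" if "i < Suc m" for i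
  proof (cases i)
    case 0
    then show ?thesis using Suc.prems[of 0] by simp
  next
    case (Suc i')
    have "(a 0 + b * ?r) div b = ?r" using Suc.prems[of 0] b by simp
    then show ?thesis using Suc IH(2) that by (simp add: div_mult2_eq)
  qed
  then show ?case unfolding eq using lt by blast
qed simp

text \<open>Every smaller distance from \<open>v\<close> occurs in the component as well. Hence in a
  component with at most \<open>B\<close> vertices all distances are below \<open>B\<close>, and
  \<open>B\<close> digits suffice.\<close>

lemma dist_nat_less_card:
  assumes "finite (verts G)" "x \<in> comp_of G v"
  shows "dist_nat G v x < card (comp_of G v)"
proof -
  have "d \<le> dist_nat G v x \<Longrightarrow> dist_nat G v x - d \<in> dist_nat G v ` comp_of G v" for d
  proof (induction d)
    case (Suc d)
    then obtain y where y: "y \<in> comp_of G v" "dist_nat G v y = dist_nat G v x - d" by auto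
    then have "gdist G v y = enat (Suc (dist_nat G v x - Suc d))"
      using gdist_eq_dist_nat[OF y(1)] Suc.prems by simp
    then obtain w where w: "gdist G v w = enat (dist_nat G v x - Suc d)" "w \<in> verts G"
      by (rule gdist_pred)
    then have "w \<in> comp_of G v" "dist_nat G v w = dist_nat G v x - Suc d"
      by (auto simp: comp_of_def dist_nat_def)
    then show ?case by (metis image_eqI)
  qed (use assms in auto)
  then have "{..dist_nat G v x} \<subseteq> dist_nat G v ` comp_of G v"
    by (metis atMost_iff diff_diff_cancel diff_le_self subsetI)
  moreover have fin: "finite (comp_of G v)" using assms comp_of_subset finite_subset by metis
  ultimately have "card {..dist_nat G v x} \<le> card (dist_nat G v ` comp_of G v)"
    by (intro card_mono) auto
  also have "\<dots> \<le> card (comp_of G v)" using fin by (rule card_image_le)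
  finally show ?thesis by simp
qed

lemma comp_of_outside: "v \<notin> verts G \<Longrightarrow> comp_of G v = {}"
  using gdist_infinity[of v G] by (auto simp: comp_of_def)

context
  fixes G :: "'a graph" and B :: nat
  assumes fin: "finite (verts G)" and small: "small_comps B G"
begin

lemma card_comp_of_le: "card (comp_of G v) \<le> B"
  using small comp_of_outside[of v G] by (cases "v \<in> verts G") (auto simp: small_comps_def)

lemma finite_comp_of: "finite (comp_of G v)"
  using fin comp_of_subset finite_subset by metis

text \<open>The vertices are grouped by distance. The semiring is left open because codes and sizes
  are natural numbers and reciprocal distances are reals.\<close>

lemma sum_comp_of_eq_profile:
  fixes f :: "nat \<Rightarrow> 'b::comm_semiring_1"
  shows "(\<Sum>x\<in>comp_of G v. f (dist_nat G v x)) = (\<Sum>i<B. of_nat (profile G v i) * f i)"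
proof -
  have "dist_nat G v ` comp_of G v \<subseteq> {..<B}"
    using dist_nat_less_card[OF fin] card_comp_of_le[of v] by fastforce
  then have "(\<Sum>x\<in>comp_of G v. f (dist_nat G v x)) =
      (\<Sum>i<B. \<Sum>x\<in>{x \<in> comp_of G v. dist_nat G v x = i}. f (dist_nat G v x))"
    by (intro sum.group[symmetric] finite_comp_of) auto
  also have "\<dots> = (\<Sum>i<B. of_nat (profile G v i) * f i)"
    by (intro sum.cong) (auto simp: profile_def)
  finally show ?thesis .
qed

lemma profile_less: "profile G v i < Suc B"
proof -
  have "profile G v i \<le> card (comp_of G v)"
    unfolding profile_def by (intro card_mono finite_comp_of) auto
  then show ?thesis using card_comp_of_le[of v] by linarith
qed

lemma code_eq_sum: "code B G v = (\<Sum>i<B. profile G v i * Suc B ^ i)"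
  unfolding code_def by (subst sum_comp_of_eq_profile[where f = "\<lambda>i. Suc B ^ i"]) simp

lemma code_less: "code B G v < Suc B ^ B"
  unfolding code_eq_sum using positional[of "profile G v" "Suc B" B] profile_less by blast

lemma digit_code: "i < B \<Longrightarrow> digit B (code B G v) i = profile G v i"
  unfolding code_eq_sum digit_def using positional[of "profile G v" "Suc B" B] profile_less by blast

lemma digit_sum_code: "digit_sum B (code B G v) = card (comp_of G v)"
  using sum_comp_of_eq_profile[where f = "\<lambda>_. 1::nat" and v = v]
  by (simp add: digit_sum_def digit_code)

text \<open>A present vertex contributes the summand 1 for itself, so the code 0 is free to mark a
  deleted root.\<close>

lemma code_eq_0_iff: "code B G v = 0 \<longleftrightarrow> v \<notin> verts G"
proof (cases "v \<in> verts G")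
  case True
  then have "v \<in> comp_of G v" by (rule comp_of_self)
  then show ?thesis using True finite_comp_of by (auto simp: code_def)
qed (simp add: code_def comp_of_outside)

end

text \<open>Pairs outside the components of \<open>p\<close> and \<open>c\<close> contribute 0,
  since their distance is \<infinity>. The others are grouped by distance, once on each
  side.\<close>

lemma cross_code:
  assumes "finite (verts G)" "small_comps B G" "finite (verts H)" "small_comps B H"
  shows "cross B (code B G p) (code B H c) =
    (\<Sum>x\<in>verts G. \<Sum>y\<in>verts H. inv_enat (gdist G p x + 1 + gdist H c y))"
proof -
  let ?A = "comp_of G p" and ?B = "comp_of H c"
  have "(\<Sum>x\<in>verts G. \<Sum>y\<in>verts H. inv_enat (gdist G p x + 1 + gdist H c y)) =
      (\<Sum>x\<in>?A. \<Sum>y\<in>verts H. inv_enat (gdist G p x + 1 + gdist H c y))"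
    by (rule sum.mono_neutral_right) (use assms in \<open>auto simp: comp_of_def\<close>)
  also have "\<dots> = (\<Sum>x\<in>?A. \<Sum>y\<in>?B. inv_enat (gdist G p x + 1 + gdist H c y))"
    by (intro sum.cong refl sum.mono_neutral_right) (use assms in \<open>auto simp: comp_of_def\<close>)
  also have "\<dots> = (\<Sum>x\<in>?A. \<Sum>y\<in>?B. 1 / real (dist_nat G p x + dist_nat H c y + 1))"
    by (intro sum.cong refl) (simp add: gdist_eq_dist_nat one_enat_def inv_enat_def)
  also have "\<dots> = (\<Sum>x\<in>?A. \<Sum>j<B. real (profile H c j) * (1 / real (dist_nat G p x + j + 1)))"
    by (intro sum.cong refl sum_comp_of_eq_profile[OF assms(3,4)])
  also have "\<dots> = (\<Sum>i<B. real (profile G p i) * (\<Sum>j<B. real (profile H c j) * (1 / real (i + j + 1))))"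
    by (rule sum_comp_of_eq_profile[OF assms(1,2)])
  also have "\<dots> = cross B (code B G p) (code B H c)"
    unfolding cross_def
    by (intro sum.cong refl)
       (simp add: sum_distrib_left digit_code[OF assms(1,2)] digit_code[OF assms(3,4)])
  finally show ?thesis by simp
qed

section \<open>Joins seen from the root: components, codes and sizes\<close>

context
  fixes G H :: "'a graph" and p c :: 'a
  assumes simple: "simple_graph G" "simple_graph H" and disj: "verts G \<inter> verts H = {}"
begin

lemma finite_G: "finite (verts G)" and finite_H: "finite (verts H)"
  using simple by (auto simp: simple_graph_def)

lemma comp_of_join_left:
  assumes "u \<in> verts G"
  shows "comp_of (join G H p c) u = comp_of G u \<union> (if p \<in> comp_of G u then comp_of H c else {})"
proof -
  have 1: "gdist (join G H p c) u x = gdist G u x" if "x \<in> verts G" for x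
    using gdist_join_left[OF simple disj assms that] .
  have 2: "gdist (join G H p c) u x = gdist G u p + 1 + gdist H c x" if "x \<in> verts H" for x
    using gdist_join_cross[OF simple disj assms that] .
  have "p \<in> comp_of G u \<longleftrightarrow> gdist G u p \<noteq> \<infinity>"
    using gdist_infinity[of u G p] by (cases "p \<in> verts G") (auto simp: comp_of_def)
  then have 3: "p \<notin> comp_of G u \<longleftrightarrow> gdist G u p = \<infinity>" by simp
  show ?thesis
    unfolding comp_of_def[of "join G H p c"] join_sel
    by (cases "p \<in> comp_of G u") (use 1 2 3 in \<open>auto simp: comp_of_def plus_eq_infty_iff_enat one_enat_def\<close>)
qed

lemma dist_nat_join:
  assumes "p \<in> verts G"
  shows "x \<in> comp_of G p \<Longrightarrow> dist_nat (join G H p c) p x = dist_nat G p x"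
    and "x \<in> comp_of H c \<Longrightarrow> dist_nat (join G H p c) p x = Suc (dist_nat H c x)"
proof -
  assume "x \<in> comp_of G p"
  then show "dist_nat (join G H p c) p x = dist_nat G p x"
    using gdist_join_left[OF simple disj assms, of x p c] by (simp add: dist_nat_def comp_of_def)
next
  assume x: "x \<in> comp_of H c"
  then have "gdist (join G H p c) p x = 1 + enat (dist_nat H c x)"
    using gdist_join_cross[OF simple disj assms, of x p c] gdist_eq_dist_nat[OF x] assms
    by (simp add: gdist_self comp_of_def)
  then show "dist_nat (join G H p c) p x = Suc (dist_nat H c x)"
    by (simp add: dist_nat_def one_enat_def)
qed

lemma comp_of_disjoint: "comp_of G u \<inter> comp_of H v = {}"
  using disj comp_of_subset[of G u] comp_of_subset[of H v] by auto

lemma code_join: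
  assumes "p \<in> verts G"
  shows "code B (join G H p c) p = code B G p + Suc B * code B H c"
proof -
  have "finite (comp_of G p)" "finite (comp_of H c)"
    using finite_G finite_H comp_of_subset finite_subset by metis+
  then have "code B (join G H p c) p =
      (\<Sum>x\<in>comp_of G p. Suc B ^ dist_nat (join G H p c) p x)
      + (\<Sum>x\<in>comp_of H c. Suc B ^ dist_nat (join G H p c) p x)"
    unfolding code_def comp_of_join_left[OF assms] using comp_of_self[OF assms]
    by (simp add: sum.union_disjoint comp_of_disjoint)
  also have "\<dots> = (\<Sum>x\<in>comp_of G p. Suc B ^ dist_nat G p x)
      + (\<Sum>x\<in>comp_of H c. Suc B * Suc B ^ dist_nat H c x)"
    by (intro arg_cong2[where f = "(+)"] sum.cong refl) (simp_all add: dist_nat_join[OF assms])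
  finally show ?thesis by (simp add: code_def sum_distrib_left)
qed

end

lemma comp_of_join_right:
  assumes "simple_graph G" "simple_graph H" "verts G \<inter> verts H = {}" "u \<in> verts H"
  shows "comp_of (join G H p c) u = comp_of H u \<union> (if c \<in> comp_of H u then comp_of G p else {})"
  unfolding join_commute[of G H]
  by (rule comp_of_join_left) (use assms in auto)

text \<open>Only the components of \<open>p\<close> and \<open>c\<close> are united. If
  \<open>c\<close> is deleted, its component is empty and the size condition merely repeats the
  bound for the component of \<open>p\<close>.\<close>

lemma small_comps_join:
  assumes G: "simple_graph G" "simple_graph H" "verts G \<inter> verts H = {}"
  shows "small_comps B (join G H p c) \<longleftrightarrow> small_comps B G \<and> small_comps B H \<and>
    (p \<in> verts G \<longrightarrow> card (comp_of G p) + card (comp_of H c) \<le> B)"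
proof -
  have fin: "finite (comp_of G u)" "finite (comp_of H u)" for u
    using finite_G[OF G] finite_H[OF G] comp_of_subset finite_subset by metis+
  have card: "card (comp_of G u \<union> comp_of H v) = card (comp_of G u) + card (comp_of H v)" for u v
    by (intro card_Un_disjoint fin comp_of_disjoint[OF G])
  have L: "card (comp_of (join G H p c) u) =
      card (comp_of G u) + (if p \<in> comp_of G u then card (comp_of H c) else 0)" if "u \<in> verts G" for u
    using card by (simp add: comp_of_join_left[OF G that])
  have R: "card (comp_of (join G H p c) u) =
      card (comp_of H u) + (if c \<in> comp_of H u then card (comp_of G p) else 0)" if "u \<in> verts H" for u
    using card[of p u] by (simp add: comp_of_join_right[OF G that] Un_commute)
  show ?thesis
  proof (intro iffI conjI impI)
    assume J: "small_comps B (join G H p c)"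
    then have JL: "card (comp_of (join G H p c) u) \<le> B" if "u \<in> verts G \<union> verts H" for u
      using that by (auto simp: small_comps_def)
    show "small_comps B G" unfolding small_comps_def using JL L by (metis UnI1 add_leD1)
    show "small_comps B H" unfolding small_comps_def using JL R by (metis UnI2 add_leD1)
    assume "p \<in> verts G"
    then show "card (comp_of G p) + card (comp_of H c) \<le> B"
      using JL[of p] L[of p] comp_of_self[of p G] by simp
  next
    assume a: "small_comps B G \<and> small_comps B H \<and>
      (p \<in> verts G \<longrightarrow> card (comp_of G p) + card (comp_of H c) \<le> B)"
    show "small_comps B (join G H p c)"
      unfolding small_comps_def
    proof
      fix u assume "u \<in> verts (join G H p c)"
      then consider "u \<in> verts G" | "u \<in> verts H" by auto
      then show "card (comp_of (join G H p c) u) \<le> B"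
      proof cases
        case 1
        show ?thesis
        proof (cases "p \<in> comp_of G u")
          case True
          have "card (comp_of G p) + card (comp_of H c) \<le> B"
            using a subsetD[OF comp_of_subset True] by blast
          then show ?thesis unfolding L[OF 1] comp_of_eq[OF True] using True by simp
        qed (use a L[OF 1] 1 in \<open>simp add: small_comps_def\<close>)
      next
        case 2
        show ?thesis
        proof (cases "c \<in> comp_of H u")
          case True
          have "card (comp_of G p) + card (comp_of H c) \<le> B"
          proof (cases "p \<in> verts G")
            case False
            moreover have "card (comp_of H u) \<le> B" using a 2 unfolding small_comps_def by blast
            ultimately show ?thesis unfolding comp_of_eq[OF True] by (simp add: comp_of_outside)
          qed (use a in blast)
          then show ?thesis unfolding R[OF 2] comp_of_eq[OF True] using True by simp
        qed (use a R[OF 2] 2 in \<open>simp add: small_comps_def\<close>)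
      qed
    qed
  qed
qed

text \<open>The triples \<open>(j, d, w)\<close> for which deleting some \<open>j\<close> vertices leaves only small components,
  inverse geodesic length \<open>w\<close>, and a component of \<open>v\<close> whose distance profile is encoded by \<open>d\<close>
  (with \<open>d = 0\<close> if \<open>v\<close> itself is deleted).\<close>

definition outcomes :: "nat \<Rightarrow> 'a::linorder graph \<Rightarrow> 'a \<Rightarrow> (nat \<times> nat \<times> real) set" where
  "outcomes B G v = {(card S, code B (delete_verts G S) v, IGL (delete_verts G S)) | S.
     S \<subseteq> verts G \<and> small_comps B (delete_verts G S)}"

text \<open>The case \<open>d = 0\<close> is that of a deleted \<open>p\<close>: the connecting edge
  is absent, so there is no size test and the root stays deleted; \<open>cross\<close> is 0 then, as
  all digits of 0 vanish.\<close>

definition merge :: "nat \<Rightarrow> (nat \<times> nat \<times> real) set \<Rightarrow> (nat \<times> nat \<times> real) set \<Rightarrow> (nat \<times> nat \<times> real) set" where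
  "merge B X Y = {(j + j', if d = 0 then 0 else d + Suc B * d', w + w' + cross B d d') | j d w j' d' w'.
     (j, d, w) \<in> X \<and> (j', d', w') \<in> Y \<and> (d \<noteq> 0 \<longrightarrow> digit_sum B d + digit_sum B d' \<le> B)}"

lemma outcomesI:
  "S \<subseteq> verts G \<Longrightarrow> small_comps B (delete_verts G S) \<Longrightarrow>
    (card S, code B (delete_verts G S) v, IGL (delete_verts G S)) \<in> outcomes B G v"
  unfolding outcomes_def by blast

lemma mergeI:
  "(j, d, w) \<in> X \<Longrightarrow> (j', d', w') \<in> Y \<Longrightarrow> (d \<noteq> 0 \<Longrightarrow> digit_sum B d + digit_sum B d' \<le> B) \<Longrightarrow>
    (j + j', if d = 0 then 0 else d + Suc B * d', w + w' + cross B d d') \<in> merge B X Y"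
  unfolding merge_def by blast

text \<open>A deletion set of the join is the union of its traces on the two sides, and deletion
  commutes with joining. Smallness, code and inverse geodesic length of the result depend on each
  side only through its triple, which is what makes the dynamic program possible.\<close>

lemma outcomes_join:
  assumes G: "simple_graph G" "simple_graph H" "verts G \<inter> verts H = {}" and p: "p \<in> verts G"
  shows "outcomes B (join G H p c) p = merge B (outcomes B G p) (outcomes B H c)"
proof -
  have fin: "finite (verts G)" "finite (verts H)" using G by (auto simp: simple_graph_def)
  have main: "small_comps B J' \<longleftrightarrow> small_comps B G' \<and> small_comps B H' \<and>
        (code B G' p \<noteq> 0 \<longrightarrow> digit_sum B (code B G' p) + digit_sum B (code B H' c) \<le> B)" (is ?t1)
    and main2: "small_comps B G' \<Longrightarrow> small_comps B H' \<Longrightarrow>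
        code B J' p = (if code B G' p = 0 then 0 else code B G' p + Suc B * code B H' c) \<and>
        IGL J' = IGL G' + IGL H' + cross B (code B G' p) (code B H' c)" (is "_ \<Longrightarrow> _ \<Longrightarrow> ?t2")
    if S: "S \<subseteq> verts G" "S' \<subseteq> verts H" and GH: "G' = delete_verts G S" "H' = delete_verts H S'"
      "J' = delete_verts (join G H p c) (S \<union> S')"
    for S S' G' H' J'
  proof -
    have s: "simple_graph G'" "simple_graph H'" using G by (simp_all add: GH simple_graph_delete)
    have d: "verts G' \<inter> verts H' = {}" using G(3) by (auto simp: GH)
    have J: "J' = join G' H' p c" unfolding GH by (rule delete_verts_join[OF G S])
    have f: "finite (verts G')" "finite (verts H')" using s by (auto simp: simple_graph_def)
    show ?t1 unfolding J small_comps_join[OF s d]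
      using code_eq_0_iff[OF f(1), of B p] digit_sum_code[OF f(1), of B p] digit_sum_code[OF f(2), of B c]
      by auto
    assume sm: "small_comps B G'" "small_comps B H'"
    have "p \<notin> verts H'" using p G(3) GH by auto
    then have "p \<notin> verts G' \<Longrightarrow> code B J' p = 0"
      unfolding J by (simp add: code_def comp_of_outside)
    then show ?t2
      unfolding J IGL_join[OF s d] cross_code[OF f(1) sm(1) f(2) sm(2), symmetric]
      using code_join[OF s d, of p B c] code_eq_0_iff[OF f(1) sm(1), of p] by auto
  qed
  have card_disj: "card (S \<union> S') = card S + card S'" if "S \<subseteq> verts G" "S' \<subseteq> verts H" for S S'
  proof (rule card_Un_disjoint)
    show "finite S" "finite S'" using that fin by (meson finite_subset)+
    show "S \<inter> S' = {}" using that G(3) by blast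
  qed
  show ?thesis
  proof (intro equalityI subsetI)
    fix t assume "t \<in> outcomes B (join G H p c) p"
    then obtain S where S: "S \<subseteq> verts G \<union> verts H" and sm: "small_comps B (delete_verts (join G H p c) S)"
      and t: "t = (card S, code B (delete_verts (join G H p c) S) p, IGL (delete_verts (join G H p c) S))"
      unfolding outcomes_def by auto
    define S1 S2 where "S1 = S \<inter> verts G" and "S2 = S \<inter> verts H"
    have S12: "S1 \<subseteq> verts G" "S2 \<subseteq> verts H" "S = S1 \<union> S2" using S unfolding S1_def S2_def by auto
    have card: "card S = card S1 + card S2"
      unfolding S12(3) by (rule card_disj[OF S12(1,2)])
    have sm': "small_comps B (delete_verts G S1)" "small_comps B (delete_verts H S2)"
      "code B (delete_verts G S1) p \<noteq> 0 \<Longrightarrow>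
        digit_sum B (code B (delete_verts G S1) p) + digit_sum B (code B (delete_verts H S2) c) \<le> B"
      using main[OF S12(1,2) refl refl refl] sm unfolding S12(3) by blast+
    show "t \<in> merge B (outcomes B G p) (outcomes B H c)"
      using mergeI[OF outcomesI[OF S12(1) sm'(1)] outcomesI[OF S12(2) sm'(2)] sm'(3)]
        main2[OF S12(1,2) refl refl refl sm'(1,2)]
      unfolding t card S12(3)[symmetric] by simp
  next
    fix t assume "t \<in> merge B (outcomes B G p) (outcomes B H c)"
    then obtain S1 S2 where S: "S1 \<subseteq> verts G" "S2 \<subseteq> verts H"
      and sm: "small_comps B (delete_verts G S1)" "small_comps B (delete_verts H S2)"
      and le: "code B (delete_verts G S1) p \<noteq> 0 \<longrightarrow>
          digit_sum B (code B (delete_verts G S1) p) + digit_sum B (code B (delete_verts H S2) c) \<le> B"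
      and t: "t = (card S1 + card S2, if code B (delete_verts G S1) p = 0 then 0
          else code B (delete_verts G S1) p + Suc B * code B (delete_verts H S2) c,
        IGL (delete_verts G S1) + IGL (delete_verts H S2) +
          cross B (code B (delete_verts G S1) p) (code B (delete_verts H S2) c))"
      unfolding merge_def outcomes_def by blast
    have "t = (card (S1 \<union> S2), code B (delete_verts (join G H p c) (S1 \<union> S2)) p,
        IGL (delete_verts (join G H p c) (S1 \<union> S2)))"
      using main2[OF S refl refl refl sm] card_disj[OF S] unfolding t by simp
    moreover have "small_comps B (delete_verts (join G H p c) (S1 \<union> S2))"
      using main[OF S refl refl refl] sm le by blast
    moreover have "S1 \<union> S2 \<subseteq> verts (join G H p c)" using S by auto
    ultimately show "t \<in> outcomes B (join G H p c) p" using outcomesI by metis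
  qed
qed

lemma outcomes_range:
  assumes "finite (verts G)" "(j, d, w) \<in> outcomes B G v"
  shows "j \<le> card (verts G)" "d < Suc B ^ B" "0 \<le> w"
proof -
  obtain S where S: "S \<subseteq> verts G" "small_comps B (delete_verts G S)" "j = card S"
    "d = code B (delete_verts G S) v" "w = IGL (delete_verts G S)"
    using assms(2) unfolding outcomes_def by auto
  show "j \<le> card (verts G)" using S assms(1) by (simp add: card_mono)
  show "d < Suc B ^ B" unfolding S(4) by (rule code_less) (use S assms(1) in auto)
  show "0 \<le> w" unfolding S(5) by (rule IGL_nonneg)
qed

definition single :: "'a \<Rightarrow> 'a graph" where
  "single v = \<lparr>verts = {v}, edges = {}\<rparr>"

lemma outcomes_single:
  assumes "1 \<le> B"
  shows "outcomes B (single v) v = {(0, 1, 0), (1, 0, 0)}"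
proof -
  have 0: "delete_verts (single v) {} = single v" by (simp add: delete_verts_def single_def)
  have c: "comp_of (single v) v = {v}"
    using comp_of_self[of v "single v"] comp_of_subset[of "single v" v] by (auto simp: single_def)
  have "gdist (single v) v v = 0" by (rule gdist_self) (simp add: single_def)
  then have "code B (single v) v = 1" by (simp add: code_def c dist_nat_def zero_enat_def)
  moreover have "IGL (single v) = 0" unfolding IGL_def by (rule sum.neutral) (auto simp: single_def)
  moreover have "small_comps B (single v)" using assms c by (simp add: small_comps_def single_def)
  moreover have "code B (delete_verts (single v) {v}) v = 0"
    by (simp add: code_def comp_of_outside single_def)
  moreover have "IGL (delete_verts (single v) {v}) = 0"
    unfolding IGL_def by (rule sum.neutral) (auto simp: single_def)
  moreover have "small_comps B (delete_verts (single v) {v})"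
    by (simp add: small_comps_def single_def)
  moreover have "S \<subseteq> verts (single v) \<longleftrightarrow> S = {} \<or> S = {v}" for S by (auto simp: single_def)
  ultimately show ?thesis unfolding outcomes_def
    by (auto simp: 0 intro: exI[of _ "{}"] exI[of _ "{v}"])
qed

lemma UN_remove: "p \<in> A \<Longrightarrow> (\<Union>v\<in>A. f v) = f p \<union> (\<Union>v\<in>A - {p}. f v)"
  by blast

lemma UN_fun_upd:
  assumes "p \<in> A" "\<And>v. K' v = (if v = p then J else K v)"
  shows "(\<Union>v\<in>A. f (K' v)) = f J \<union> (\<Union>v\<in>A - {p}. f (K v))"
proof -
  have "(\<Union>v\<in>A - {p}. f (K' v)) = (\<Union>v\<in>A - {p}. f (K v))"
    by (rule SUP_cong) (simp_all add: assms(2))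
  moreover have "(\<Union>v\<in>A. f (K' v)) = f (K' p) \<union> (\<Union>v\<in>A - {p}. f (K' v))"
    by (rule UN_remove) (rule assms(1))
  ultimately show ?thesis by (simp add: assms(2))
qed

context grown_tree
begin

text \<open>The edges are contracted in reverse order of growth.\<close>

fun cluster :: "nat \<Rightarrow> nat \<Rightarrow> nat graph" where
  "cluster 0 v = single v"
| "cluster (Suc r) v = (let i = m - Suc r in
     if v = P i then join (cluster r (P i)) (cluster r (C i)) (P i) (C i) else cluster r v)"

text \<open>The vertices that still represent a cluster after \<open>r\<close> contractions. Because
  the youngest edges are contracted first, every remaining edge joins two roots, so only distances
  from roots matter later.\<close>

definition roots :: "nat \<Rightarrow> nat set" where
  "roots r = insert 0 (C ` {..<m - r})"

lemma roots_Suc: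
  assumes "r < m"
  shows "roots r = insert (C (m - Suc r)) (roots (Suc r))" "C (m - Suc r) \<notin> roots (Suc r)"
    "P (m - Suc r) \<in> roots (Suc r)"
proof -
  have "{..<m - r} = insert (m - Suc r) {..<m - Suc r}" using assms by auto
  then show "roots r = insert (C (m - Suc r)) (roots (Suc r))" unfolding roots_def by auto
qed (use assms child[of "m - Suc r"] parent[of "m - Suc r"] in \<open>auto simp: roots_def\<close>)

text \<open>Disjointness of the clusters is what the lemmas on joins require; the statements on the
  unions of vertices and edges identify the last cluster with \<open>T\<close>.\<close>

lemma cluster_invariants:
  "r \<le> m \<Longrightarrow> (\<forall>v\<in>roots r. simple_graph (cluster r v) \<and> v \<in> verts (cluster r v)) \<and>
    (\<forall>v\<in>roots r. \<forall>w\<in>roots r. v \<noteq> w \<longrightarrow> verts (cluster r v) \<inter> verts (cluster r w) = {}) \<and>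
    (\<Union>v\<in>roots r. verts (cluster r v)) = verts T \<and>
    (\<Union>v\<in>roots r. edges (cluster r v)) = (\<lambda>i. {P i, C i}) ` {m - r..<m}"
proof (induction r)
  case 0
  then show ?case by (auto simp: roots_def single_def verts_T simple_graph_def)
next
  case (Suc r)
  let ?i = "m - Suc r"
  let ?p = "P ?i" and ?c = "C ?i" and ?K = "cluster r"
  let ?J = "join (?K ?p) (?K ?c) ?p ?c"
  have r: "r < m" using Suc.prems by simp
  have IH: "\<And>v. v \<in> roots r \<Longrightarrow> simple_graph (?K v)" "\<And>v. v \<in> roots r \<Longrightarrow> v \<in> verts (?K v)"
    "\<And>v w. v \<in> roots r \<Longrightarrow> w \<in> roots r \<Longrightarrow> v \<noteq> w \<Longrightarrow> verts (?K v) \<inter> verts (?K w) = {}"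
    "(\<Union>v\<in>roots r. verts (?K v)) = verts T"
    "(\<Union>v\<in>roots r. edges (?K v)) = (\<lambda>i. {P i, C i}) ` {m - r..<m}"
    using Suc.IH r by simp_all
  note R = roots_Suc[OF r]
  have pc: "?p \<in> roots r" "?c \<in> roots r" "?p \<noteq> ?c" using R by auto
  have K: "cluster (Suc r) v = (if v = ?p then ?J else ?K v)" for v by (simp add: Let_def)
  have J: "verts ?J = verts (?K ?p) \<union> verts (?K ?c)"
    "edges ?J = edges (?K ?p) \<union> edges (?K ?c) \<union> {{?p, ?c}}"
    using IH(2) pc by simp_all
  have "simple_graph ?J" using IH(1,3) pc by (intro simple_graph_join) auto
  then have 1: "\<forall>v\<in>roots (Suc r). simple_graph (cluster (Suc r) v) \<and> v \<in> verts (cluster (Suc r) v)"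
    unfolding K using IH(1,2) R J by auto
  have d: "verts (?K v) \<inter> verts ?J = {}" if "v \<in> roots (Suc r)" "v \<noteq> ?p" for v
  proof -
    have "v \<noteq> ?c" "v \<in> roots r" using that R by auto
    then show ?thesis using IH(3)[of v ?p] IH(3)[of v ?c] that pc J(1) by auto
  qed
  have 2: "\<forall>v\<in>roots (Suc r). \<forall>w\<in>roots (Suc r). v \<noteq> w \<longrightarrow>
      verts (cluster (Suc r) v) \<inter> verts (cluster (Suc r) w) = {}"
  proof (intro ballI impI)
    fix v w assume vw: "v \<in> roots (Suc r)" "w \<in> roots (Suc r)" "v \<noteq> w"
    consider "v = ?p" | "w = ?p" | "v \<noteq> ?p" "w \<noteq> ?p" by blast
    then show "verts (cluster (Suc r) v) \<inter> verts (cluster (Suc r) w) = {}"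
    proof cases
      case 1
      then show ?thesis unfolding K using d[of w] vw by auto
    next
      case 2
      then show ?thesis unfolding K using d[of v] vw by auto
    next
      case 3
      then show ?thesis unfolding K using IH(3)[of v w] vw R(1) by auto
    qed
  qed
  have split_verts: "(\<Union>v\<in>roots (Suc r). verts (cluster (Suc r) v)) =
      verts ?J \<union> (\<Union>v\<in>roots (Suc r) - {?p}. verts (?K v))"
    "(\<Union>v\<in>roots r. verts (?K v)) =
      verts (?K ?c) \<union> (verts (?K ?p) \<union> (\<Union>v\<in>roots (Suc r) - {?p}. verts (?K v)))"
    by (rule UN_fun_upd[OF R(3) K])
       (simp only: R(1) UN_insert UN_remove[OF R(3), of "\<lambda>v. verts (?K v)"])
  have split_edges: "(\<Union>v\<in>roots (Suc r). edges (cluster (Suc r) v)) =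
      edges ?J \<union> (\<Union>v\<in>roots (Suc r) - {?p}. edges (?K v))"
    "(\<Union>v\<in>roots r. edges (?K v)) =
      edges (?K ?c) \<union> (edges (?K ?p) \<union> (\<Union>v\<in>roots (Suc r) - {?p}. edges (?K v)))"
    by (rule UN_fun_upd[OF R(3) K])
       (simp only: R(1) UN_insert UN_remove[OF R(3), of "\<lambda>v. edges (?K v)"])
  have 3: "(\<Union>v\<in>roots (Suc r). verts (cluster (Suc r) v)) = verts T"
    unfolding split_verts(1) J IH(4)[symmetric] split_verts(2) by blast
  have "{m - Suc r..<m} = insert ?i {m - r..<m}" using r by auto
  then have 4: "(\<Union>v\<in>roots (Suc r). edges (cluster (Suc r) v)) = (\<lambda>i. {P i, C i}) ` {m - Suc r..<m}"
    unfolding split_edges(1) J by (simp only: image_insert IH(5)[symmetric] split_edges(2)) blast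
  show ?case by (intro conjI 1 2 3 4)
qed

lemma cluster_final: "cluster m 0 = T"
proof -
  have R: "roots m = {0}" by (simp add: roots_def)
  note * = cluster_invariants[OF order_refl, unfolded R, THEN conjunct2, THEN conjunct2]
  have "verts (cluster m 0) = verts T" using *[THEN conjunct1] by simp
  moreover have "edges (cluster m 0) = edges T"
    using *[THEN conjunct2] by (simp add: edges_T atLeast0LessThan)
  ultimately show ?thesis by (intro graph.equality) simp_all
qed

lemma cluster_simple: "r \<le> m \<Longrightarrow> v \<in> roots r \<Longrightarrow> simple_graph (cluster r v)"
  by (rule cluster_invariants[THEN conjunct1, rule_format, THEN conjunct1])

lemma self_in_cluster: "r \<le> m \<Longrightarrow> v \<in> roots r \<Longrightarrow> v \<in> verts (cluster r v)"
  by (rule cluster_invariants[THEN conjunct1, rule_format, THEN conjunct2])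

lemma cluster_disjoint:
  "r \<le> m \<Longrightarrow> v \<in> roots r \<Longrightarrow> w \<in> roots r \<Longrightarrow> v \<noteq> w \<Longrightarrow> verts (cluster r v) \<inter> verts (cluster r w) = {}"
  by (rule cluster_invariants[THEN conjunct2, THEN conjunct1, rule_format])

lemma card_cluster_le:
  assumes "r \<le> m" "v \<in> roots r"
  shows "card (verts (cluster r v)) \<le> Suc m"
proof -
  have "verts (cluster r v) \<subseteq> verts T" 
    using cluster_invariants[OF assms(1), THEN conjunct2, THEN conjunct2, THEN conjunct1] assms(2) by blast
  then show ?thesis using card_mono[OF finite_verts] card_verts by metis
qed

text \<open>The recurrence of the dynamic program: one merge per contracted edge.\<close>

lemma outcomes_cluster:
  assumes "r < m" "v \<in> roots (Suc r)"
  shows "outcomes B (cluster (Suc r) v) v = (if v = P (m - Suc r)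
    then merge B (outcomes B (cluster r v) v) (outcomes B (cluster r (C (m - Suc r))) (C (m - Suc r)))
    else outcomes B (cluster r v) v)"
proof -
  let ?p = "P (m - Suc r)" and ?c = "C (m - Suc r)"
  have pc: "?p \<in> roots r" "?c \<in> roots r" "?p \<noteq> ?c" and r: "r \<le> m"
    using roots_Suc[OF assms(1)] assms(1) by auto
  have "outcomes B (join (cluster r ?p) (cluster r ?c) ?p ?c) ?p =
      merge B (outcomes B (cluster r ?p) ?p) (outcomes B (cluster r ?c) ?c)"
    by (rule outcomes_join[OF cluster_simple[OF r] cluster_simple[OF r] cluster_disjoint[OF r] self_in_cluster[OF r]])
      (fact pc)+
  then show ?thesis by (simp add: Let_def)
qed

end

section \<open>A structured language for the real RAM\<close>

text \<open>Variables for natural numbers are kept apart from those for reals because the machine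
  gets stuck on addresses that are not natural numbers.\<close>

datatype nvar = Vn | Vi | Vj | Vj1 | Vj2 | Vc1 | Vc2 | Vs1 | Vs2 | Vt | Vq | Vg | VB1 | VB | Vb | VN
  | Vx0 | Vm | Vu | Vv | Vcnt | Vn1 | Vrow | Vtot | Vp | Vc | Vr | Vs | Vd | Vidx | Vans | VP

datatype rvar = Rk | Rtau | Rw1 | Rw2 | Rx | Rw

datatype arr = Inp | Vis | Par | Chi | Tab | New | Dig | Pow

datatype nexp = NNum nat | NVar nvar | NPlus nexp nexp | NMinus nexp nexp | NTimes nexp nexp
  | NGet arr nexp

datatype rexp = RNum int | RVar rvar | OfNat nexp | RPlus rexp rexp | RTimes rexp rexp
  | RDivide rexp rexp | RGet arr nexp

datatype com = Skip | NAssign nvar nexp | RAssign rvar rexp | Put arr nexp rexp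
  | Seq com com (infixr ";;" 60) | Cond rexp rexp com com | For nvar nvar com

type_synonym nenv = "nvar \<Rightarrow> nat"
type_synonym renv = "rvar \<Rightarrow> real"
type_synonym arrays = "arr \<Rightarrow> nat \<Rightarrow> real"
type_synonym assn = "nenv \<Rightarrow> renv \<Rightarrow> arrays \<Rightarrow> bool"

primrec neval :: "nexp \<Rightarrow> nenv \<Rightarrow> arrays \<Rightarrow> nat" where
  "neval (NNum c) \<nu> \<alpha> = c"
| "neval (NVar x) \<nu> \<alpha> = \<nu> x"
| "neval (NPlus e f) \<nu> \<alpha> = neval e \<nu> \<alpha> + neval f \<nu> \<alpha>"
| "neval (NMinus e f) \<nu> \<alpha> = neval e \<nu> \<alpha> - neval f \<nu> \<alpha>"
| "neval (NTimes e f) \<nu> \<alpha> = neval e \<nu> \<alpha> * neval f \<nu> \<alpha>"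
| "neval (NGet a e) \<nu> \<alpha> = nat \<lfloor>\<alpha> a (neval e \<nu> \<alpha>)\<rfloor>"

text \<open>Excludes the cases in which \<open>neval\<close> would differ from the machine:
  truncated subtraction, and the floor of a cell that does not hold a natural number.\<close>

primrec ndef :: "nexp \<Rightarrow> nenv \<Rightarrow> arrays \<Rightarrow> bool" where
  "ndef (NNum c) \<nu> \<alpha> \<longleftrightarrow> True"
| "ndef (NVar x) \<nu> \<alpha> \<longleftrightarrow> True"
| "ndef (NPlus e f) \<nu> \<alpha> \<longleftrightarrow> ndef e \<nu> \<alpha> \<and> ndef f \<nu> \<alpha>"
| "ndef (NMinus e f) \<nu> \<alpha> \<longleftrightarrow> ndef e \<nu> \<alpha> \<and> ndef f \<nu> \<alpha> \<and> neval f \<nu> \<alpha> \<le> neval e \<nu> \<alpha>"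
| "ndef (NTimes e f) \<nu> \<alpha> \<longleftrightarrow> ndef e \<nu> \<alpha> \<and> ndef f \<nu> \<alpha>"
| "ndef (NGet a e) \<nu> \<alpha> \<longleftrightarrow> ndef e \<nu> \<alpha> \<and> \<alpha> a (neval e \<nu> \<alpha>) \<in> \<nat>"

primrec reval :: "rexp \<Rightarrow> nenv \<Rightarrow> renv \<Rightarrow> arrays \<Rightarrow> real" where
  "reval (RNum c) \<nu> \<rho> \<alpha> = real_of_int c"
| "reval (RVar x) \<nu> \<rho> \<alpha> = \<rho> x"
| "reval (OfNat e) \<nu> \<rho> \<alpha> = real (neval e \<nu> \<alpha>)"
| "reval (RPlus e f) \<nu> \<rho> \<alpha> = reval e \<nu> \<rho> \<alpha> + reval f \<nu> \<rho> \<alpha>"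
| "reval (RTimes e f) \<nu> \<rho> \<alpha> = reval e \<nu> \<rho> \<alpha> * reval f \<nu> \<rho> \<alpha>"
| "reval (RDivide e f) \<nu> \<rho> \<alpha> = reval e \<nu> \<rho> \<alpha> / reval f \<nu> \<rho> \<alpha>"
| "reval (RGet a e) \<nu> \<rho> \<alpha> = \<alpha> a (neval e \<nu> \<alpha>)"

primrec rdef :: "rexp \<Rightarrow> nenv \<Rightarrow> renv \<Rightarrow> arrays \<Rightarrow> bool" where
  "rdef (RNum c) \<nu> \<rho> \<alpha> \<longleftrightarrow> True"
| "rdef (RVar x) \<nu> \<rho> \<alpha> \<longleftrightarrow> True"
| "rdef (OfNat e) \<nu> \<rho> \<alpha> \<longleftrightarrow> ndef e \<nu> \<alpha>"
| "rdef (RPlus e f) \<nu> \<rho> \<alpha> \<longleftrightarrow> rdef e \<nu> \<rho> \<alpha> \<and> rdef f \<nu> \<rho> \<alpha>"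
| "rdef (RTimes e f) \<nu> \<rho> \<alpha> \<longleftrightarrow> rdef e \<nu> \<rho> \<alpha> \<and> rdef f \<nu> \<rho> \<alpha>"
| "rdef (RDivide e f) \<nu> \<rho> \<alpha> \<longleftrightarrow> rdef e \<nu> \<rho> \<alpha> \<and> rdef f \<nu> \<rho> \<alpha> \<and> reval f \<nu> \<rho> \<alpha> \<noteq> 0"
| "rdef (RGet a e) \<nu> \<rho> \<alpha> \<longleftrightarrow> ndef e \<nu> \<alpha>"

text \<open>\<open>for_wp F x b N k\<close> describes the last \<open>k\<close> of \<open>N\<close> iterations.\<close>

primrec for_wp :: "(assn \<Rightarrow> assn) \<Rightarrow> nvar \<Rightarrow> nvar \<Rightarrow> nat \<Rightarrow> nat \<Rightarrow> assn \<Rightarrow> assn" where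
  "for_wp F x b N 0 Q \<nu> \<rho> \<alpha> \<longleftrightarrow> \<nu> x = N \<and> \<nu> b = N \<and> Q \<nu> \<rho> \<alpha>"
| "for_wp F x b N (Suc k) Q \<nu> \<rho> \<alpha> \<longleftrightarrow> \<nu> x + Suc k = N \<and> \<nu> b = N \<and>
     F (\<lambda>\<nu>'. for_wp F x b N k Q (\<nu>'(x := Suc (\<nu>' x)))) \<nu> \<rho> \<alpha>"

text \<open>Weakest precondition for total correctness, where in addition no loop is allowed to make
  more than \<open>W\<close> iterations.\<close>

primrec wp :: "nat \<Rightarrow> com \<Rightarrow> assn \<Rightarrow> assn" where
  "wp W Skip = (\<lambda>Q. Q)"
| "wp W (NAssign x e) = (\<lambda>Q \<nu> \<rho> \<alpha>. ndef e \<nu> \<alpha> \<and> Q (\<nu>(x := neval e \<nu> \<alpha>)) \<rho> \<alpha>)"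
| "wp W (RAssign x e) = (\<lambda>Q \<nu> \<rho> \<alpha>. rdef e \<nu> \<rho> \<alpha> \<and> Q \<nu> (\<rho>(x := reval e \<nu> \<rho> \<alpha>)) \<alpha>)"
| "wp W (Put a i e) = (\<lambda>Q \<nu> \<rho> \<alpha>. ndef i \<nu> \<alpha> \<and> rdef e \<nu> \<rho> \<alpha> \<and>
     Q \<nu> \<rho> (\<alpha>(a := (\<alpha> a)(neval i \<nu> \<alpha> := reval e \<nu> \<rho> \<alpha>))))"
| "wp W (c ;; d) = (\<lambda>Q. wp W c (wp W d Q))"
| "wp W (Cond e f c d) = (\<lambda>Q \<nu> \<rho> \<alpha>. rdef e \<nu> \<rho> \<alpha> \<and> rdef f \<nu> \<rho> \<alpha> \<and>
     (if reval e \<nu> \<rho> \<alpha> < reval f \<nu> \<rho> \<alpha> then wp W c Q \<nu> \<rho> \<alpha> else wp W d Q \<nu> \<rho> \<alpha>))"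
| "wp W (For x b c) = (\<lambda>Q \<nu> \<rho> \<alpha>. \<nu> b \<le> W \<and> for_wp (wp W c) x b (\<nu> b) (\<nu> b) Q (\<nu>(x := 0)) \<rho> \<alpha>)"

primrec nmods :: "com \<Rightarrow> nvar set" where
  "nmods Skip = {}"
| "nmods (NAssign x e) = {x}"
| "nmods (RAssign x e) = {}"
| "nmods (Put a i e) = {}"
| "nmods (c ;; d) = nmods c \<union> nmods d"
| "nmods (Cond e f c d) = nmods c \<union> nmods d"
| "nmods (For x b c) = insert x (nmods c)"

primrec rmods :: "com \<Rightarrow> rvar set" where
  "rmods Skip = {}"
| "rmods (NAssign x e) = {}"
| "rmods (RAssign x e) = {x}"
| "rmods (Put a i e) = {}"
| "rmods (c ;; d) = rmods c \<union> rmods d"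
| "rmods (Cond e f c d) = rmods c \<union> rmods d"
| "rmods (For x b c) = rmods c"

primrec amods :: "com \<Rightarrow> arr set" where
  "amods Skip = {}"
| "amods (NAssign x e) = {}"
| "amods (RAssign x e) = {}"
| "amods (Put a i e) = {a}"
| "amods (c ;; d) = amods c \<union> amods d"
| "amods (Cond e f c d) = amods c \<union> amods d"
| "amods (For x b c) = amods c"

definition frame :: "com \<Rightarrow> nenv \<Rightarrow> renv \<Rightarrow> arrays \<Rightarrow> nenv \<Rightarrow> renv \<Rightarrow> arrays \<Rightarrow> bool" where
  "frame c \<nu> \<rho> \<alpha> \<nu>' \<rho>' \<alpha>' \<longleftrightarrow> (\<forall>x. x \<notin> nmods c \<longrightarrow> \<nu>' x = \<nu> x) \<and> (\<forall>x. x \<notin> rmods c \<longrightarrow> \<rho>' x = \<rho> x) \<and>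
     (\<forall>a. a \<notin> amods c \<longrightarrow> \<alpha>' a = \<alpha> a)"

text \<open>Consequence and frame rule in one: the new postcondition may use that everything
  \<open>c\<close> never assigns is unchanged, so invariants need only mention what changes.\<close>

lemma wp_conseq:
  "wp W c Q \<nu> \<rho> \<alpha> \<Longrightarrow> (\<And>\<nu>' \<rho>' \<alpha>'. Q \<nu>' \<rho>' \<alpha>' \<Longrightarrow> frame c \<nu> \<rho> \<alpha> \<nu>' \<rho>' \<alpha>' \<Longrightarrow> Q' \<nu>' \<rho>' \<alpha>') \<Longrightarrow>
   wp W c Q' \<nu> \<rho> \<alpha>"
proof (induction c arbitrary: Q Q' \<nu> \<rho> \<alpha>)
  case (Seq c d)
  have "wp W c (wp W d Q) \<nu> \<rho> \<alpha>" using Seq.prems(1) by simp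
  then have "wp W c (wp W d Q') \<nu> \<rho> \<alpha>"
  proof (rule Seq.IH(1))
    fix \<nu>1 \<rho>1 \<alpha>1 assume 1: "wp W d Q \<nu>1 \<rho>1 \<alpha>1" "frame c \<nu> \<rho> \<alpha> \<nu>1 \<rho>1 \<alpha>1"
    show "wp W d Q' \<nu>1 \<rho>1 \<alpha>1"
    proof (rule Seq.IH(2)[OF 1(1)])
      fix \<nu>2 \<rho>2 \<alpha>2 assume 2: "Q \<nu>2 \<rho>2 \<alpha>2" "frame d \<nu>1 \<rho>1 \<alpha>1 \<nu>2 \<rho>2 \<alpha>2"
      then have "frame (c ;; d) \<nu> \<rho> \<alpha> \<nu>2 \<rho>2 \<alpha>2" using 1(2) by (simp add: frame_def)
      then show "Q' \<nu>2 \<rho>2 \<alpha>2" using Seq.prems(2) 2(1) by blast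
    qed
  qed
  then show ?case by simp
next
  case (Cond e f c d)
  have "wp W c Q \<nu> \<rho> \<alpha> \<Longrightarrow> wp W c Q' \<nu> \<rho> \<alpha>"
    by (erule Cond.IH(1)) (rule Cond.prems(2), assumption, simp add: frame_def)
  moreover have "wp W d Q \<nu> \<rho> \<alpha> \<Longrightarrow> wp W d Q' \<nu> \<rho> \<alpha>"
    by (erule Cond.IH(2)) (rule Cond.prems(2), assumption, simp add: frame_def)
  ultimately show ?case using Cond.prems(1) by auto
next
  case (For x b c)
  let ?fr = "frame (For x b c) \<nu> \<rho> \<alpha>"
  have "for_wp (wp W c) x b N k Q \<nu>1 \<rho>1 \<alpha>1 \<Longrightarrow> ?fr \<nu>1 \<rho>1 \<alpha>1 \<Longrightarrow>
      for_wp (wp W c) x b N k Q' \<nu>1 \<rho>1 \<alpha>1" for N k \<nu>1 \<rho>1 \<alpha>1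
  proof (induction k arbitrary: \<nu>1 \<rho>1 \<alpha>1)
    case 0
    then show ?case using For.prems(2) by simp
  next
    case (Suc k)
    let ?Q = "\<lambda>Q \<nu>'. for_wp (wp W c) x b N k Q (\<nu>'(x := Suc (\<nu>' x)))"
    have "wp W c (?Q Q) \<nu>1 \<rho>1 \<alpha>1" using Suc.prems(1) by simp
    then have "wp W c (?Q Q') \<nu>1 \<rho>1 \<alpha>1"
    proof (rule For.IH)
      fix \<nu>2 \<rho>2 \<alpha>2 assume 2: "?Q Q \<nu>2 \<rho>2 \<alpha>2" "frame c \<nu>1 \<rho>1 \<alpha>1 \<nu>2 \<rho>2 \<alpha>2"
      show "?Q Q' \<nu>2 \<rho>2 \<alpha>2"
        by (rule Suc.IH[OF 2(1)]) (use 2(2) Suc.prems(2) in \<open>simp add: frame_def\<close>)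
    qed
    then show ?case using Suc.prems(1) by simp
  qed
  moreover have "?fr (\<nu>(x := 0)) \<rho> \<alpha>" by (simp add: frame_def)
  ultimately show ?case using For.prems(1) by simp
qed (simp_all add: frame_def)

text \<open>Induction on the number of remaining iterations. In body and exit the frame is relative
  to the state before the loop, so values fixed throughout the loop need not be part of the
  invariant.\<close>

lemma wp_For:
  assumes N: "\<nu> b = N" "N \<le> W" "b \<noteq> x" "x \<notin> nmods c" "b \<notin> nmods c"
    and init: "I 0 (\<nu>(x := 0)) \<rho> \<alpha>"
    and body: "\<And>i \<nu>' \<rho>' \<alpha>'. i < N \<Longrightarrow> \<nu>' x = i \<Longrightarrow> frame (For x b c) \<nu> \<rho> \<alpha> \<nu>' \<rho>' \<alpha>' \<Longrightarrow>
        I i \<nu>' \<rho>' \<alpha>' \<Longrightarrow> wp W c (\<lambda>\<nu>'' \<rho>'' \<alpha>''. I (Suc i) (\<nu>''(x := Suc i)) \<rho>'' \<alpha>'') \<nu>' \<rho>' \<alpha>'"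
    and post: "\<And>\<nu>' \<rho>' \<alpha>'. \<nu>' x = N \<Longrightarrow> frame (For x b c) \<nu> \<rho> \<alpha> \<nu>' \<rho>' \<alpha>' \<Longrightarrow> I N \<nu>' \<rho>' \<alpha>' \<Longrightarrow> Q \<nu>' \<rho>' \<alpha>'"
  shows "wp W (For x b c) Q \<nu> \<rho> \<alpha>"
proof -
  let ?fr = "frame (For x b c) \<nu> \<rho> \<alpha>"
  have "k \<le> N \<Longrightarrow> \<nu>1 x = N - k \<Longrightarrow> ?fr \<nu>1 \<rho>1 \<alpha>1 \<Longrightarrow> I (N - k) \<nu>1 \<rho>1 \<alpha>1 \<Longrightarrow>
      for_wp (wp W c) x b N k Q \<nu>1 \<rho>1 \<alpha>1" for k \<nu>1 \<rho>1 \<alpha>1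
  proof (induction k arbitrary: \<nu>1 \<rho>1 \<alpha>1)
    case 0
    moreover have "\<nu>1 b = N" using 0 N by (simp add: frame_def)
    ultimately show ?case using post[of \<nu>1 \<rho>1 \<alpha>1] by simp
  next
    case (Suc k)
    let ?i = "N - Suc k"
    have i: "?i < N" "Suc ?i = N - k" using Suc.prems(1) by auto
    have b: "\<nu>1 b = N" using Suc.prems(3) N by (simp add: frame_def)
    have "wp W c (\<lambda>\<nu>'. for_wp (wp W c) x b N k Q (\<nu>'(x := Suc (\<nu>' x)))) \<nu>1 \<rho>1 \<alpha>1"
    proof (rule wp_conseq[OF body[OF i(1) Suc.prems(2-4)]])
      fix \<nu>2 \<rho>2 \<alpha>2
      assume 2: "I (Suc ?i) (\<nu>2(x := Suc ?i)) \<rho>2 \<alpha>2" "frame c \<nu>1 \<rho>1 \<alpha>1 \<nu>2 \<rho>2 \<alpha>2"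
      have x: "\<nu>2 x = ?i" using 2(2) N(4) Suc.prems(2) by (simp add: frame_def)
      show "for_wp (wp W c) x b N k Q (\<nu>2(x := Suc (\<nu>2 x))) \<rho>2 \<alpha>2"
      proof (rule Suc.IH)
        show "I (N - k) (\<nu>2(x := Suc (\<nu>2 x))) \<rho>2 \<alpha>2" using 2(1) unfolding x i(2) .
        show "?fr (\<nu>2(x := Suc (\<nu>2 x))) \<rho>2 \<alpha>2"
          using 2(2) Suc.prems(3) by (simp add: frame_def)
      qed (use Suc.prems(1) x i(2) in simp_all)
    qed
    then show ?case using b Suc.prems(1,2) by simp
  qed
  from this[of N "\<nu>(x := 0)" \<rho> \<alpha>] show ?thesis
    using N init by (simp add: frame_def)
qed

section \<open>Compilation to the real RAM\<close>

text \<open>Quantifying over \<open>pc\<close> singles out instructions that fall through to the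
  next one, so straight-line code can be treated without addresses.\<close>

definition effect :: "instr \<Rightarrow> memory \<Rightarrow> memory \<Rightarrow> bool" where
  "effect i M M' \<longleftrightarrow> (\<forall>pc. exec i (pc, M) (Suc pc, M'))"

primrec runs :: "instr list \<Rightarrow> memory \<Rightarrow> memory \<Rightarrow> bool" where
  "runs [] M M' \<longleftrightarrow> M' = M"
| "runs (i # is) M M' \<longleftrightarrow> (\<exists>M1. effect i M M1 \<and> runs is M1 M')"

lemma runs_append: "runs is M M1 \<Longrightarrow> runs js M1 M2 \<Longrightarrow> runs (is @ js) M M2"
  by (induction "is" arbitrary: M) auto

lemma runs_single: "effect i M M' \<Longrightarrow> runs [i] M M'"
  by auto

lemma runs_Cons: "effect i M M1 \<Longrightarrow> runs is M1 M2 \<Longrightarrow> runs (i # is) M M2"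
  by auto

lemma effect_intros:
  "effect (Const a k) M (M(a := real_of_int k))"
  "effect (Copy a b) M (M(a := M b))"
  "M b = real i \<Longrightarrow> effect (Load a b) M (M(a := M i))"
  "M a = real i \<Longrightarrow> effect (Store a b) M (M(i := M b))"
  "effect (Add a b c) M (M(a := M b + M c))"
  "effect (Sub a b c) M (M(a := M b - M c))"
  "effect (Mul a b c) M (M(a := M b * M c))"
  "M c \<noteq> 0 \<Longrightarrow> effect (Div a b c) M (M(a := M b / M c))"
  unfolding effect_def by (blast intro: exec.intros)+

lemma effect_op:
  "v = M b + M c \<Longrightarrow> effect (Add a b c) M (M(a := v))"
  "v = M b - M c \<Longrightarrow> effect (Sub a b c) M (M(a := v))"
  "v = M b * M c \<Longrightarrow> effect (Mul a b c) M (M(a := v))"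
  "v = M b / M c \<Longrightarrow> M c \<noteq> 0 \<Longrightarrow> effect (Div a b c) M (M(a := v))"
  by (simp_all only: effect_intros not_False_eq_True)

section \<open>Placement of code and number of steps\<close>

definition code_at :: "program \<Rightarrow> nat \<Rightarrow> program \<Rightarrow> bool" where
  "code_at P l is \<longleftrightarrow> l + length is \<le> length P \<and> (\<forall>i<length is. P ! (l + i) = is ! i)"

lemma code_at_append [simp]:
  "code_at P l (is @ js) \<longleftrightarrow> code_at P l is \<and> code_at P (l + length is) js"
proof
  assume a: "code_at P l (is @ js)"
  then have h: "P ! (l + i) = (is @ js) ! i" if "i < length (is @ js)" for i
    using that unfolding code_at_def by blast
  have "P ! (l + length is + i) = js ! i" if "i < length js" for i
    using h[of "length is + i"] that by (simp add: add.assoc)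
  moreover have "P ! (l + i) = is ! i" if "i < length is" for i
    using h[of i] that by (simp add: nth_append)
  ultimately show "code_at P l is \<and> code_at P (l + length is) js"
    using a by (simp add: code_at_def)
next
  assume a: "code_at P l is \<and> code_at P (l + length is) js"
  have "P ! (l + i) = (is @ js) ! i" if "i < length (is @ js)" for i
  proof (cases "i < length is")
    case True
    then show ?thesis using a by (simp add: code_at_def nth_append)
  next
    case False
    then have "i - length is < length js" using that by auto
    then have "P ! (l + length is + (i - length is)) = js ! (i - length is)"
      using a unfolding code_at_def by blast
    moreover have "l + length is + (i - length is) = l + i" using False by simp
    ultimately have "P ! (l + i) = js ! (i - length is)" by (simp only:)
    then show ?thesis using False by (simp add: nth_append)
  qed
  then show "code_at P l (is @ js)" using a unfolding code_at_def by simp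
qed

lemma code_at_Nil [simp]: "code_at P l [] \<longleftrightarrow> l \<le> length P"
  by (simp add: code_at_def)

lemma code_at_Cons [simp]:
  "code_at P l (i # is) \<longleftrightarrow> l < length P \<and> P ! l = i \<and> code_at P (Suc l) is"
  using code_at_append[of P l "[i]" "is"] by (auto simp: code_at_def)

definition reaches :: "program \<Rightarrow> nat \<Rightarrow> config \<Rightarrow> config \<Rightarrow> bool" where
  "reaches P T c c' \<longleftrightarrow> (\<exists>t\<le>T. (step P ^^ t) c c')"

lemma reaches_trans: "reaches P T a b \<Longrightarrow> reaches P T' b c \<Longrightarrow> reaches P (T + T') a c"
  unfolding reaches_def by (metis add_mono relpowp_trans)

lemma reaches_mono: "reaches P T a b \<Longrightarrow> T \<le> T' \<Longrightarrow> reaches P T' a b"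
  unfolding reaches_def by (meson le_trans)

lemma reaches_refl: "reaches P T a a"
  unfolding reaches_def by (rule exI[of _ 0]) simp

lemma reaches_step: "l < length P \<Longrightarrow> P ! l = i \<Longrightarrow> exec i (l, M) c \<Longrightarrow> reaches P 1 (l, M) c"
proof -
  assume "l < length P" "P ! l = i" "exec i (l, M) c"
  then have "step P (l, M) c" by (simp add: step_def)
  then have "(step P ^^ 1) (l, M) c" by (simp only: relpowp_1)
  then show ?thesis unfolding reaches_def by blast
qed

lemma reaches_runs:
  "runs is M M' \<Longrightarrow> code_at P l is \<Longrightarrow> reaches P (length is) (l, M) (l + length is, M')"
proof (induction "is" arbitrary: l M)
  case (Cons i "is")
  then obtain M1 where M1: "effect i M M1" "runs is M1 M'" by auto
  have "reaches P 1 (l, M) (Suc l, M1)"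
    using Cons.prems M1(1) by (intro reaches_step) (auto simp: effect_def)
  moreover have "reaches P (length is) (Suc l, M1) (Suc l + length is, M')"
    using Cons.IH[OF M1(2), of "Suc l"] Cons.prems by simp
  ultimately have "reaches P (1 + length is) (l, M) (Suc l + length is, M')"
    by (rule reaches_trans)
  then show ?case by simp
qed (simp add: reaches_refl)

text \<open>Cell 0 for \<open>Vn\<close>, and cells 1 and 2 for \<open>Rk\<close> and
  \<open>Rtau\<close>, are the cells in which the input supplies these values.\<close>

primrec nreg :: "nvar \<Rightarrow> nat" where
  "nreg Vn = 0" | "nreg Vi = 3" | "nreg Vj = 4" | "nreg Vj1 = 5" | "nreg Vj2 = 6" | "nreg Vc1 = 7"
| "nreg Vc2 = 8" | "nreg Vs1 = 9" | "nreg Vs2 = 10" | "nreg Vt = 11" | "nreg Vq = 12" | "nreg Vg = 13"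
| "nreg VB1 = 14" | "nreg VB = 15" | "nreg Vb = 16" | "nreg VN = 17" | "nreg Vx0 = 18" | "nreg Vm = 19"
| "nreg Vu = 20" | "nreg Vv = 21" | "nreg Vcnt = 22" | "nreg Vn1 = 23" | "nreg Vrow = 24"
| "nreg Vtot = 25" | "nreg Vp = 26" | "nreg Vc = 27" | "nreg Vr = 28" | "nreg Vs = 29" | "nreg Vd = 30"
| "nreg Vidx = 31" | "nreg Vans = 32" | "nreg VP = 33"

primrec rreg :: "rvar \<Rightarrow> nat" where
  "rreg Rk = 1" | "rreg Rtau = 2" | "rreg Rw1 = 34" | "rreg Rw2 = 35" | "rreg Rx = 36" | "rreg Rw = 37"

primrec anum :: "arr \<Rightarrow> nat" where
  "anum Inp = 0" | "anum Vis = 1" | "anum Par = 2" | "anum Chi = 3" | "anum Tab = 4" | "anum New = 5"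
| "anum Dig = 6" | "anum Pow = 7"

text \<open>Cells 38 to 49 hold intermediate results; the arrays are interleaved from cell 50 on.\<close>

definition addr :: "arr \<Rightarrow> nat \<Rightarrow> nat" where
  "addr a i = 50 + 8 * i + anum a"

lemma inj_nreg: "nreg x = nreg y \<longleftrightarrow> x = y"
  by (cases x; cases y; simp)

lemma inj_rreg: "rreg x = rreg y \<longleftrightarrow> x = y"
  by (cases x; cases y; simp)

lemma nreg_neq_rreg: "nreg x \<noteq> rreg y" "rreg y \<noteq> nreg x"
  by (cases x; cases y; simp)+

lemma nreg_less: "nreg x < 38"
  by (cases x) simp_all

lemma rreg_less: "rreg x < 38"
  by (cases x) simp_all

lemma inj_addr: "addr a i = addr b j \<longleftrightarrow> a = b \<and> i = j"
proof
  assume *: "addr a i = addr b j"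
  have 8: "anum a < 8" for a by (cases a) simp_all
  have "8 * i + anum a = 8 * j + anum b" using * by (simp add: addr_def)
  then have "anum a = anum b \<and> i = j" using 8[of a] 8[of b] by presburger
  moreover have "anum a = anum b \<longrightarrow> a = b" by (cases a; cases b; simp)
  ultimately show "a = b \<and> i = j" by blast
qed simp

lemma addr_ge: "50 \<le> addr a i"
  by (simp add: addr_def)

definition represents :: "nenv \<Rightarrow> renv \<Rightarrow> arrays \<Rightarrow> memory \<Rightarrow> bool" where
  "represents \<nu> \<rho> \<alpha> M \<longleftrightarrow> (\<forall>x. M (nreg x) = real (\<nu> x)) \<and> (\<forall>x. M (rreg x) = \<rho> x) \<and>
     (\<forall>a i. M (addr a i) = \<alpha> a i)"

lemma represents_temp:
  assumes "represents \<nu> \<rho> \<alpha> M" "\<And>a. a < 38 \<or> 50 \<le> a \<Longrightarrow> M' a = M a"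
  shows "represents \<nu> \<rho> \<alpha> M'"
  using assms nreg_less rreg_less addr_ge unfolding represents_def by simp

lemma represents_nupd:
  "represents \<nu> \<rho> \<alpha> M \<Longrightarrow> represents (\<nu>(x := c)) \<rho> \<alpha> (M(nreg x := real c))"
proof -
  have "addr a i \<noteq> nreg x" for a i using nreg_less[of x] addr_ge[of a i] by linarith
  then show "represents \<nu> \<rho> \<alpha> M \<Longrightarrow> represents (\<nu>(x := c)) \<rho> \<alpha> (M(nreg x := real c))"
    unfolding represents_def by (simp add: inj_nreg nreg_neq_rreg)
qed

lemma represents_rupd:
  "represents \<nu> \<rho> \<alpha> M \<Longrightarrow> represents \<nu> (\<rho>(x := c)) \<alpha> (M(rreg x := c))"
proof -
  have "addr a i \<noteq> rreg x" for a i using rreg_less[of x] addr_ge[of a i] by linarith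
  then show "represents \<nu> \<rho> \<alpha> M \<Longrightarrow> represents \<nu> (\<rho>(x := c)) \<alpha> (M(rreg x := c))"
    unfolding represents_def by (simp add: inj_rreg nreg_neq_rreg)
qed

lemma represents_aupd:
  assumes "represents \<nu> \<rho> \<alpha> M"
  shows "represents \<nu> \<rho> (\<alpha>(a := (\<alpha> a)(i := c))) (M(addr a i := c))"
proof -
  have "nreg x \<noteq> addr a i" "rreg y \<noteq> addr a i" for x y
    using nreg_less[of x] rreg_less[of y] addr_ge[of a i] by linarith+
  then show ?thesis using assms unfolding represents_def by (auto simp: inj_addr)
qed

definition addr_code :: "arr \<Rightarrow> nat \<Rightarrow> program" where
  "addr_code a t = [Const (Suc t) 8, Mul t t (Suc t), Const (Suc t) (50 + int (anum a)), Add t t (Suc t)]"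

text \<open>The temporaries form an evaluation stack: the value ends up in cell \<open>t\<close>,
  and only cells from \<open>t\<close> on are overwritten.\<close>

primrec ncode :: "nexp \<Rightarrow> nat \<Rightarrow> program" where
  "ncode (NNum c) t = [Const t (int c)]"
| "ncode (NVar x) t = [Copy t (nreg x)]"
| "ncode (NPlus e f) t = ncode e t @ ncode f (Suc t) @ [Add t t (Suc t)]"
| "ncode (NMinus e f) t = ncode e t @ ncode f (Suc t) @ [Sub t t (Suc t)]"
| "ncode (NTimes e f) t = ncode e t @ ncode f (Suc t) @ [Mul t t (Suc t)]"
| "ncode (NGet a e) t = ncode e t @ addr_code a t @ [Load t t]"

primrec rcode :: "rexp \<Rightarrow> nat \<Rightarrow> program" where
  "rcode (RNum c) t = [Const t c]"
| "rcode (RVar x) t = [Copy t (rreg x)]"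
| "rcode (OfNat e) t = ncode e t"
| "rcode (RPlus e f) t = rcode e t @ rcode f (Suc t) @ [Add t t (Suc t)]"
| "rcode (RTimes e f) t = rcode e t @ rcode f (Suc t) @ [Mul t t (Suc t)]"
| "rcode (RDivide e f) t = rcode e t @ rcode f (Suc t) @ [Div t t (Suc t)]"
| "rcode (RGet a e) t = ncode e t @ addr_code a t @ [Load t t]"

text \<open>The number of stack cells in use. An array access takes at least two, since the address
  computation needs a constant in cell \<open>Suc t\<close>.\<close>

primrec ndepth :: "nexp \<Rightarrow> nat" where
  "ndepth (NNum c) = 1"
| "ndepth (NVar x) = 1"
| "ndepth (NPlus e f) = max (ndepth e) (Suc (ndepth f))"
| "ndepth (NMinus e f) = max (ndepth e) (Suc (ndepth f))"
| "ndepth (NTimes e f) = max (ndepth e) (Suc (ndepth f))"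
| "ndepth (NGet a e) = max (ndepth e) 2"

primrec rdepth :: "rexp \<Rightarrow> nat" where
  "rdepth (RNum c) = 1"
| "rdepth (RVar x) = 1"
| "rdepth (OfNat e) = ndepth e"
| "rdepth (RPlus e f) = max (rdepth e) (Suc (rdepth f))"
| "rdepth (RTimes e f) = max (rdepth e) (Suc (rdepth f))"
| "rdepth (RDivide e f) = max (rdepth e) (Suc (rdepth f))"
| "rdepth (RGet a e) = max (ndepth e) 2"

definition same_outside :: "nat \<Rightarrow> memory \<Rightarrow> memory \<Rightarrow> bool" where
  "same_outside t M M' \<longleftrightarrow> (\<forall>a. a < t \<or> 50 \<le> a \<longrightarrow> M' a = M a)"

lemma same_outside_trans: "same_outside t M M1 \<Longrightarrow> same_outside t M1 M2 \<Longrightarrow> same_outside t M M2"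
  by (simp add: same_outside_def)

lemma same_outside_represents:
  "same_outside t M M' \<Longrightarrow> 38 \<le> t \<Longrightarrow> represents \<nu> \<rho> \<alpha> M \<Longrightarrow> represents \<nu> \<rho> \<alpha> M'"
  by (erule represents_temp) (auto simp: same_outside_def)

lemma runs_binary:
  assumes M1: "runs c M M1" "M1 t = v1" "same_outside t M M1"
    and M2: "runs d M1 M2" "M2 (Suc t) = v2" "same_outside (Suc t) M1 M2"
    and op: "\<And>M. M t = v1 \<Longrightarrow> M (Suc t) = v2 \<Longrightarrow> effect i M (M(t := v))" and t: "t < 50"
  shows "\<exists>M'. runs (c @ d @ [i]) M M' \<and> M' t = v \<and> same_outside t M M'"
proof (intro exI conjI)
  have "M2 t = v1" using M1(2) M2(3) by (simp add: same_outside_def)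
  then have "effect i M2 (M2(t := v))" using M2(2) op by blast
  then show "runs (c @ d @ [i]) M (M2(t := v))"
    by (intro runs_append[OF M1(1)] runs_append[OF M2(1)]) simp
  show "same_outside t M (M2(t := v))"
    using M1(3) M2(3) t by (simp add: same_outside_def)
qed simp

lemma runs_addr_code:
  assumes "M t = real i" "Suc t < 50"
  shows "\<exists>M'. runs (addr_code a t) M M' \<and> M' t = real (addr a i) \<and> same_outside t M M'"
proof (intro exI conjI)
  let ?M1 = "M(Suc t := real_of_int 8)"
  let ?M2 = "?M1(t := ?M1 t * ?M1 (Suc t))"
  let ?M3 = "?M2(Suc t := real_of_int (50 + int (anum a)))"
  let ?M4 = "?M3(t := ?M3 t + ?M3 (Suc t))"
  have "runs [] ?M4 ?M4" by simp
  then show "runs (addr_code a t) M ?M4" unfolding addr_code_def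
    by (intro runs_Cons[OF effect_intros(1)] runs_Cons[OF effect_intros(7)] runs_Cons[OF effect_intros(5)])
  show "?M4 t = real (addr a i)" "same_outside t M ?M4"
    using assms by (simp_all add: addr_def same_outside_def)
qed

lemma runs_get:
  assumes "runs c M M1" "M1 t = real i" "same_outside t M M1" "represents \<nu> \<rho> \<alpha> M" "38 \<le> t" "Suc t < 50"
  shows "\<exists>M'. runs (c @ addr_code a t @ [Load t t]) M M' \<and> M' t = \<alpha> a i \<and> same_outside t M M'"
proof -
  obtain M2 where M2: "runs (addr_code a t) M1 M2" "M2 t = real (addr a i)" "same_outside t M1 M2"
    using runs_addr_code[where M = M1 and t = t and i = i and a = a] assms(2,6) by blast
  have s: "same_outside t M M2" using assms(3) M2(3) by (rule same_outside_trans)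
  have "M2 (addr a i) = \<alpha> a i"
    using same_outside_represents[OF s assms(5,4)] by (simp add: represents_def)
  moreover have "runs [Load t t] M2 (M2(t := M2 (addr a i)))" using M2(2) by (auto intro: effect_intros)
  then have "runs (c @ addr_code a t @ [Load t t]) M (M2(t := M2 (addr a i)))"
    by (intro runs_append[OF assms(1)] runs_append[OF M2(1)])
  moreover have "same_outside t M (M2(t := v))" for v using s assms(6) by (simp add: same_outside_def)
  ultimately show ?thesis by (metis fun_upd_same)
qed

lemma runs_ncode:
  "ndef e \<nu> \<alpha> \<Longrightarrow> represents \<nu> \<rho> \<alpha> M \<Longrightarrow> 38 \<le> t \<Longrightarrow> t + ndepth e \<le> 50 \<Longrightarrow>
   \<exists>M'. runs (ncode e t) M M' \<and> M' t = real (neval e \<nu> \<alpha>) \<and> same_outside t M M'"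
proof (induction e arbitrary: t M)
  case (NNum c)
  show ?case
  proof (intro exI conjI)
    show "runs (ncode (NNum c) t) M (M(t := real c))"
      using runs_single[OF effect_intros(1)[of t "int c" M]] by (simp only: ncode.simps of_int_of_nat_eq)
  qed (use NNum in \<open>simp_all add: same_outside_def\<close>)
next
  case (NVar x)
  show ?case
  proof (intro exI conjI)
    show "runs (ncode (NVar x) t) M (M(t := M (nreg x)))"
      unfolding ncode.simps by (rule runs_single[OF effect_intros(2)])
  qed (use NVar in \<open>simp_all add: same_outside_def represents_def\<close>)
next
  case (NPlus e f)
  have d: "t + ndepth e \<le> 50" "Suc t + ndepth f \<le> 50"
    using NPlus.prems(4) unfolding ndepth.simps by linarith+
  obtain M1 where M1: "runs (ncode e t) M M1" "M1 t = real (neval e \<nu> \<alpha>)" "same_outside t M M1"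
    using NPlus.IH(1)[of M t] NPlus.prems d by auto
  obtain M2 where M2: "runs (ncode f (Suc t)) M1 M2" "M2 (Suc t) = real (neval f \<nu> \<alpha>)" "same_outside (Suc t) M1 M2"
    using NPlus.IH(2)[of M1 "Suc t"] NPlus.prems d same_outside_represents[OF M1(3)] by auto
  show ?case unfolding ncode.simps neval.simps
    by (rule runs_binary[OF M1 M2]) (use d in \<open>simp_all add: effect_op of_nat_diff\<close>)
next
  case (NMinus e f)
  have d: "t + ndepth e \<le> 50" "Suc t + ndepth f \<le> 50"
    using NMinus.prems(4) unfolding ndepth.simps by linarith+
  obtain M1 where M1: "runs (ncode e t) M M1" "M1 t = real (neval e \<nu> \<alpha>)" "same_outside t M M1"
    using NMinus.IH(1)[of M t] NMinus.prems d by auto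
  obtain M2 where M2: "runs (ncode f (Suc t)) M1 M2" "M2 (Suc t) = real (neval f \<nu> \<alpha>)" "same_outside (Suc t) M1 M2"
    using NMinus.IH(2)[of M1 "Suc t"] NMinus.prems d same_outside_represents[OF M1(3)] by auto
  show ?case unfolding ncode.simps neval.simps
    by (rule runs_binary[OF M1 M2])
       (use NMinus.prems d in \<open>simp_all add: effect_op of_nat_diff\<close>)
next
  case (NTimes e f)
  have d: "t + ndepth e \<le> 50" "Suc t + ndepth f \<le> 50"
    using NTimes.prems(4) unfolding ndepth.simps by linarith+
  obtain M1 where M1: "runs (ncode e t) M M1" "M1 t = real (neval e \<nu> \<alpha>)" "same_outside t M M1"
    using NTimes.IH(1)[of M t] NTimes.prems d by auto
  obtain M2 where M2: "runs (ncode f (Suc t)) M1 M2" "M2 (Suc t) = real (neval f \<nu> \<alpha>)" "same_outside (Suc t) M1 M2"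
    using NTimes.IH(2)[of M1 "Suc t"] NTimes.prems d same_outside_represents[OF M1(3)] by auto
  show ?case unfolding ncode.simps neval.simps
    by (rule runs_binary[OF M1 M2]) (use d in \<open>simp_all add: effect_op of_nat_diff\<close>)
next
  case (NGet a e)
  have d: "t + ndepth e \<le> 50" "Suc t < 50"
    using NGet.prems(4) unfolding ndepth.simps by linarith+
  obtain M1 where M1: "runs (ncode e t) M M1" "M1 t = real (neval e \<nu> \<alpha>)" "same_outside t M M1"
    using NGet.IH[of M t] NGet.prems d by auto
  have "\<alpha> a (neval e \<nu> \<alpha>) = real (neval (NGet a e) \<nu> \<alpha>)"
    using NGet.prems(1) by (auto elim!: Nats_cases)
  then show ?case
    using runs_get[OF M1 NGet.prems(2,3) d(2), of a] by simp
qed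

lemma runs_rcode:
  "rdef e \<nu> \<rho> \<alpha> \<Longrightarrow> represents \<nu> \<rho> \<alpha> M \<Longrightarrow> 38 \<le> t \<Longrightarrow> t + rdepth e \<le> 50 \<Longrightarrow>
   \<exists>M'. runs (rcode e t) M M' \<and> M' t = reval e \<nu> \<rho> \<alpha> \<and> same_outside t M M'"
proof (induction e arbitrary: t M)
  case (RNum c)
  show ?case
  proof (intro exI conjI)
    show "runs (rcode (RNum c) t) M (M(t := real_of_int c))"
      unfolding rcode.simps by (rule runs_single[OF effect_intros(1)])
  qed (use RNum in \<open>simp_all add: same_outside_def\<close>)
next
  case (RVar x)
  show ?case
  proof (intro exI conjI)
    show "runs (rcode (RVar x) t) M (M(t := M (rreg x)))"
      unfolding rcode.simps by (rule runs_single[OF effect_intros(2)])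
  qed (use RVar in \<open>simp_all add: same_outside_def represents_def\<close>)
next
  case (OfNat e)
  then show ?case using runs_ncode[of e \<nu> \<alpha> \<rho> M t] by simp
next
  case (RPlus e f)
  have d: "t + rdepth e \<le> 50" "Suc t + rdepth f \<le> 50"
    using RPlus.prems(4) unfolding rdepth.simps by linarith+
  obtain M1 where M1: "runs (rcode e t) M M1" "M1 t = reval e \<nu> \<rho> \<alpha>" "same_outside t M M1"
    using RPlus.IH(1)[of M t] RPlus.prems d by auto
  obtain M2 where M2: "runs (rcode f (Suc t)) M1 M2" "M2 (Suc t) = reval f \<nu> \<rho> \<alpha>" "same_outside (Suc t) M1 M2"
    using RPlus.IH(2)[of M1 "Suc t"] RPlus.prems d same_outside_represents[OF M1(3)] by auto
  show ?case unfolding rcode.simps reval.simps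
    by (rule runs_binary[OF M1 M2]) (use d in \<open>simp_all add: effect_op of_nat_diff\<close>)
next
  case (RTimes e f)
  have d: "t + rdepth e \<le> 50" "Suc t + rdepth f \<le> 50"
    using RTimes.prems(4) unfolding rdepth.simps by linarith+
  obtain M1 where M1: "runs (rcode e t) M M1" "M1 t = reval e \<nu> \<rho> \<alpha>" "same_outside t M M1"
    using RTimes.IH(1)[of M t] RTimes.prems d by auto
  obtain M2 where M2: "runs (rcode f (Suc t)) M1 M2" "M2 (Suc t) = reval f \<nu> \<rho> \<alpha>" "same_outside (Suc t) M1 M2"
    using RTimes.IH(2)[of M1 "Suc t"] RTimes.prems d same_outside_represents[OF M1(3)] by auto
  show ?case unfolding rcode.simps reval.simps
    by (rule runs_binary[OF M1 M2]) (use d in \<open>simp_all add: effect_op of_nat_diff\<close>)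
next
  case (RDivide e f)
  have d: "t + rdepth e \<le> 50" "Suc t + rdepth f \<le> 50"
    using RDivide.prems(4) unfolding rdepth.simps by linarith+
  obtain M1 where M1: "runs (rcode e t) M M1" "M1 t = reval e \<nu> \<rho> \<alpha>" "same_outside t M M1"
    using RDivide.IH(1)[of M t] RDivide.prems d by auto
  obtain M2 where M2: "runs (rcode f (Suc t)) M1 M2" "M2 (Suc t) = reval f \<nu> \<rho> \<alpha>" "same_outside (Suc t) M1 M2"
    using RDivide.IH(2)[of M1 "Suc t"] RDivide.prems d same_outside_represents[OF M1(3)] by auto
  show ?case unfolding rcode.simps reval.simps
    by (rule runs_binary[OF M1 M2]) (use RDivide.prems d in \<open>simp_all add: effect_op of_nat_diff\<close>)
next
  case (RGet a e)
  have d: "t + ndepth e \<le> 50" "Suc t < 50"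
    using RGet.prems(4) unfolding rdepth.simps by linarith+
  obtain M1 where M1: "runs (ncode e t) M M1" "M1 t = real (neval e \<nu> \<alpha>)" "same_outside t M M1"
    using runs_ncode[of e \<nu> \<alpha> \<rho> M t] RGet.prems d by auto
  then show ?case
    using runs_get[OF M1 RGet.prems(2,3) d(2), of a] by simp
qed

text \<open>The length of the code does not depend on its position, so jump targets can be computed
  before the code is laid out.\<close>

primrec size_code :: "com \<Rightarrow> nat" where
  "size_code Skip = 0"
| "size_code (NAssign x e) = Suc (length (ncode e 38))"
| "size_code (RAssign x e) = Suc (length (rcode e 38))"
| "size_code (Put a i e) = length (ncode i 38) + length (addr_code a 38) + length (rcode e 39) + 1"
| "size_code (c ;; d) = size_code c + size_code d"
| "size_code (Cond e f c d) = length (rcode e 38) + length (rcode f 39) + 2 + size_code c + size_code d"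
| "size_code (For x b c) = size_code c + 6"

primrec ccode :: "com \<Rightarrow> nat \<Rightarrow> program" where
  "ccode Skip l = []"
| "ccode (NAssign x e) l = ncode e 38 @ [Copy (nreg x) 38]"
| "ccode (RAssign x e) l = rcode e 38 @ [Copy (rreg x) 38]"
| "ccode (Put a i e) l = ncode i 38 @ addr_code a 38 @ rcode e 39 @ [Store 38 39]"
| "ccode (c ;; d) l = ccode c l @ ccode d (l + size_code c)"
| "ccode (Cond e f c d) l =
     (let k = l + length (rcode e 38) + length (rcode f 39) + 1
      in rcode e 38 @ rcode f 39 @ [JumpLess 38 39 (k + size_code d + 1)] @ ccode d k @
         [Jump (k + size_code d + 1 + size_code c)] @ ccode c (k + size_code d + 1))"
| "ccode (For x b c) l =
     [Const (nreg x) 0, JumpLess (nreg x) (nreg b) (l + 3), Jump (l + 6 + size_code c)] @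
     ccode c (l + 3) @ [Const 38 1, Add (nreg x) (nreg x) 38, Jump (l + 1)]"

lemma length_ccode [simp]: "length (ccode c l) = size_code c"
  by (induction c arbitrary: l) (simp_all add: Let_def)

text \<open>Evaluation starts in cell 38 or 39, so depth 10 stays within the temporaries 38 to
  49.\<close>

primrec fits :: "com \<Rightarrow> bool" where
  "fits Skip \<longleftrightarrow> True"
| "fits (NAssign x e) \<longleftrightarrow> ndepth e \<le> 10"
| "fits (RAssign x e) \<longleftrightarrow> rdepth e \<le> 10"
| "fits (Put a i e) \<longleftrightarrow> ndepth i \<le> 10 \<and> rdepth e \<le> 10"
| "fits (c ;; d) \<longleftrightarrow> fits c \<and> fits d"
| "fits (Cond e f c d) \<longleftrightarrow> rdepth e \<le> 10 \<and> rdepth f \<le> 10 \<and> fits c \<and> fits d"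
| "fits (For x b c) \<longleftrightarrow> fits c"

text \<open>An iteration costs 4 steps besides its body: the test, loading 1, the increment and the
  jump back. The other 3 steps are initialisation, last test and exit. Adding up both branches of a
  conditional keeps the bound independent of the state.\<close>

primrec time_bound :: "nat \<Rightarrow> com \<Rightarrow> nat" where
  "time_bound W Skip = 0"
| "time_bound W (NAssign x e) = size_code (NAssign x e)"
| "time_bound W (RAssign x e) = size_code (RAssign x e)"
| "time_bound W (Put a i e) = size_code (Put a i e)"
| "time_bound W (c ;; d) = time_bound W c + time_bound W d"
| "time_bound W (Cond e f c d) = length (rcode e 38) + length (rcode f 39) + 2 + time_bound W c + time_bound W d"
| "time_bound W (For x b c) = W * (time_bound W c + 4) + 3"

primrec nesting :: "com \<Rightarrow> nat" where
  "nesting Skip = 0"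
| "nesting (NAssign x e) = 0"
| "nesting (RAssign x e) = 0"
| "nesting (Put a i e) = 0"
| "nesting (c ;; d) = max (nesting c) (nesting d)"
| "nesting (Cond e f c d) = max (nesting c) (nesting d)"
| "nesting (For x b c) = Suc (nesting c)"

text \<open>\<open>time_bound W c\<close> is a polynomial in \<open>W\<close> with natural
  coefficients whose degree is at most the nesting depth; for \<open>W \<ge> 1\<close> it is at most
  the sum of its coefficients times \<open>W ^ m\<close>.\<close>

lemma time_bound_le:
  assumes "1 \<le> W"
  shows "nesting c \<le> m \<Longrightarrow> time_bound W c \<le> time_bound 1 c * W ^ m"
proof -
  have base: "a \<le> a * W ^ m" for a m
    using mult_le_mono2[of 1 "W ^ m" a] assms by simp
  show "nesting c \<le> m \<Longrightarrow> time_bound W c \<le> time_bound 1 c * W ^ m"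
  proof (induction c arbitrary: m)
    case (Cond e f c d)
    let ?l = "length (rcode e 38) + length (rcode f 39) + 2"
    have "?l * 1 \<le> ?l * W ^ m" using assms by (intro mult_le_mono2) simp
    then show ?case using Cond.IH[of m] Cond.prems by (simp add: algebra_simps)
  next
    case (For x b c)
    then obtain m' where m: "m = Suc m'" "nesting c \<le> m'" by (cases m) auto
    have p: "1 \<le> W ^ m'" "1 \<le> W ^ m" using assms by simp_all
    have "time_bound W c + 4 \<le> (time_bound 1 c + 4) * W ^ m'"
      using For.IH[OF m(2)] p(1) by (simp add: algebra_simps)
    then have "W * (time_bound W c + 4) \<le> W * ((time_bound 1 c + 4) * W ^ m')" by (rule mult_le_mono2)
    also have "\<dots> = (time_bound 1 c + 4) * W ^ m" by (simp add: m)
    finally show ?case using p(2) by (simp add: algebra_simps)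
  next
    case (Seq c d)
    then show ?case using add_mono[OF Seq.IH(1)[of m] Seq.IH(2)[of m]]
      by (simp add: add_mult_distrib)
  qed (simp, (simp only: time_bound.simps, rule base)+)
qed

text \<open>Induction on the command. The weakest precondition contains definedness, so the machine
  never gets stuck, and the bound on iterations, which yields the running time.\<close>

lemma ccode_correct:
  "wp W c Q \<nu> \<rho> \<alpha> \<Longrightarrow> represents \<nu> \<rho> \<alpha> M \<Longrightarrow> code_at P l (ccode c l) \<Longrightarrow> fits c \<Longrightarrow>
   \<exists>\<nu>' \<rho>' \<alpha>' M'. reaches P (time_bound W c) (l, M) (l + size_code c, M') \<and>
     represents \<nu>' \<rho>' \<alpha>' M' \<and> Q \<nu>' \<rho>' \<alpha>'"
proof (induction c arbitrary: Q \<nu> \<rho> \<alpha> M l)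
  case Skip
  then show ?case using reaches_refl by fastforce
next
  case (NAssign x e)
  obtain M1 where M1: "runs (ncode e 38) M M1" "M1 38 = real (neval e \<nu> \<alpha>)" "same_outside 38 M M1"
    using runs_ncode[of e \<nu> \<alpha> \<rho> M 38] NAssign.prems by auto
  have "runs (ccode (NAssign x e) l) M (M1(nreg x := M1 38))" unfolding ccode.simps
    by (rule runs_append[OF M1(1)]) (simp add: effect_intros)
  from reaches_runs[OF this NAssign.prems(3)]
  have "reaches P (size_code (NAssign x e)) (l, M) (l + size_code (NAssign x e), M1(nreg x := M1 38))"
    by (simp only: length_ccode)
  moreover have "represents (\<nu>(x := neval e \<nu> \<alpha>)) \<rho> \<alpha> (M1(nreg x := M1 38))"
    unfolding M1(2) using represents_nupd same_outside_represents[OF M1(3) _ NAssign.prems(2)] by simp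
  ultimately show ?case using NAssign.prems(1) unfolding time_bound.simps wp.simps by blast
next
  case (RAssign x e)
  obtain M1 where M1: "runs (rcode e 38) M M1" "M1 38 = reval e \<nu> \<rho> \<alpha>" "same_outside 38 M M1"
    using runs_rcode[of e \<nu> \<rho> \<alpha> M 38] RAssign.prems by auto
  have "runs (ccode (RAssign x e) l) M (M1(rreg x := M1 38))" unfolding ccode.simps
    by (rule runs_append[OF M1(1)]) (simp add: effect_intros)
  from reaches_runs[OF this RAssign.prems(3)]
  have "reaches P (size_code (RAssign x e)) (l, M) (l + size_code (RAssign x e), M1(rreg x := M1 38))"
    by (simp only: length_ccode)
  moreover have "represents \<nu> (\<rho>(x := reval e \<nu> \<rho> \<alpha>)) \<alpha> (M1(rreg x := M1 38))"
    unfolding M1(2) using represents_rupd same_outside_represents[OF M1(3) _ RAssign.prems(2)] by simp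
  ultimately show ?case using RAssign.prems(1) unfolding time_bound.simps wp.simps by blast
next
  case (Put a i e)
  obtain M1 where M1: "runs (ncode i 38) M M1" "M1 38 = real (neval i \<nu> \<alpha>)" "same_outside 38 M M1"
    using runs_ncode[of i \<nu> \<alpha> \<rho> M 38] Put.prems by auto
  obtain M2 where M2: "runs (addr_code a 38) M1 M2" "M2 38 = real (addr a (neval i \<nu> \<alpha>))"
    "same_outside 38 M1 M2"
    using runs_addr_code[where M = M1 and t = 38 and i = "neval i \<nu> \<alpha>" and a = a] M1(2) by auto
  have s2: "same_outside 38 M M2" using M1(3) M2(3) by (rule same_outside_trans)
  obtain M3 where M3: "runs (rcode e 39) M2 M3" "M3 39 = reval e \<nu> \<rho> \<alpha>" "same_outside 39 M2 M3"
    using runs_rcode[of e \<nu> \<rho> \<alpha> M2 39] Put.prems same_outside_represents[OF s2 _ Put.prems(2)] by auto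
  have s3: "same_outside 38 M M3" using s2 M3(3) by (simp add: same_outside_def)
  let ?A = "addr a (neval i \<nu> \<alpha>)"
  have "M3 38 = real ?A" using M3(3) M2(2) by (simp add: same_outside_def)
  then have "effect (Store 38 39) M3 (M3(?A := M3 39))" by (rule effect_intros)
  then have "runs (ccode (Put a i e) l) M (M3(?A := M3 39))" unfolding ccode.simps
    by (intro runs_append[OF M1(1)] runs_append[OF M2(1)] runs_append[OF M3(1)]) simp
  from reaches_runs[OF this Put.prems(3)]
  have "reaches P (size_code (Put a i e)) (l, M) (l + size_code (Put a i e), M3(?A := M3 39))"
    by (simp only: length_ccode)
  moreover have "represents \<nu> \<rho> (\<alpha>(a := (\<alpha> a)(neval i \<nu> \<alpha> := reval e \<nu> \<rho> \<alpha>))) (M3(?A := M3 39))"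
    unfolding M3(2) using represents_aupd same_outside_represents[OF s3 _ Put.prems(2)] by simp
  ultimately show ?case using Put.prems(1) unfolding time_bound.simps wp.simps by blast
next
  case (Seq c d)
  obtain \<nu>1 \<rho>1 \<alpha>1 M1 where 1: "reaches P (time_bound W c) (l, M) (l + size_code c, M1)"
    "represents \<nu>1 \<rho>1 \<alpha>1 M1" "wp W d Q \<nu>1 \<rho>1 \<alpha>1"
    using Seq.IH(1)[of "wp W d Q" \<nu> \<rho> \<alpha> M l] Seq.prems by auto
  obtain \<nu>2 \<rho>2 \<alpha>2 M2 where 2: "reaches P (time_bound W d) (l + size_code c, M1) (l + size_code c + size_code d, M2)"
    "represents \<nu>2 \<rho>2 \<alpha>2 M2" "Q \<nu>2 \<rho>2 \<alpha>2"
    using Seq.IH(2)[of Q \<nu>1 \<rho>1 \<alpha>1 M1 "l + size_code c"] 1 Seq.prems by auto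
  have "reaches P (time_bound W (c ;; d)) (l, M) (l + size_code (c ;; d), M2)"
    using reaches_trans[OF 1(1) 2(1)] by (simp add: add.assoc)
  then show ?case using 2(2,3) by blast
next
  case (Cond e f c d)
  obtain M1 where M1: "runs (rcode e 38) M M1" "M1 38 = reval e \<nu> \<rho> \<alpha>" "same_outside 38 M M1"
    using runs_rcode[of e \<nu> \<rho> \<alpha> M 38] Cond.prems by auto
  obtain M2 where M2: "runs (rcode f 39) M1 M2" "M2 39 = reval f \<nu> \<rho> \<alpha>" "same_outside 39 M1 M2"
    using runs_rcode[of f \<nu> \<rho> \<alpha> M1 39] Cond.prems same_outside_represents[OF M1(3) _ Cond.prems(2)] by auto
  have "same_outside 38 M M2" using M1(3) M2(3) by (simp add: same_outside_def)
  from same_outside_represents[OF this _ Cond.prems(2)] have rep: "represents \<nu> \<rho> \<alpha> M2" by simp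
  have M2_38: "M2 38 = reval e \<nu> \<rho> \<alpha>" using M1(2) M2(3) by (simp add: same_outside_def)
  let ?le = "length (rcode e 38) + length (rcode f 39)"
  define k where "k = l + ?le + 1"
  have code: "code_at P l (rcode e 38 @ rcode f 39)" "l + ?le < length P"
    "P ! (l + ?le) = JumpLess 38 39 (k + size_code d + 1)" "code_at P k (ccode d k)"
    "k + size_code d < length P" "P ! (k + size_code d) = Jump (k + size_code d + 1 + size_code c)"
    "code_at P (k + size_code d + 1) (ccode c (k + size_code d + 1))"
    using Cond.prems(3) by (simp_all add: Let_def k_def add.assoc)
  have "reaches P ?le (l, M) (l + ?le, M2)"
    using reaches_runs[OF runs_append[OF M1(1) M2(1)] code(1)] by (simp add: add.assoc)
  moreover have "reaches P 1 (l + ?le, M2)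
      (if M2 38 < M2 39 then k + size_code d + 1 else Suc (l + ?le), M2)"
    by (rule reaches_step[OF code(2,3)]) (rule exec.intros)
  ultimately have start: "reaches P (?le + 1) (l, M)
      (if M2 38 < M2 39 then k + size_code d + 1 else Suc (l + ?le), M2)"
    by (rule reaches_trans)
  have end_eq: "l + size_code (Cond e f c d) = k + size_code d + 1 + size_code c" by (simp add: k_def)
  show ?case
  proof (cases "reval e \<nu> \<rho> \<alpha> < reval f \<nu> \<rho> \<alpha>")
    case True
    then have "wp W c Q \<nu> \<rho> \<alpha>" using Cond.prems(1) by simp
    then obtain \<nu>3 \<rho>3 \<alpha>3 M3 where 3: "reaches P (time_bound W c) (k + size_code d + 1, M2) (k + size_code d + 1 + size_code c, M3)"
      "represents \<nu>3 \<rho>3 \<alpha>3 M3" "Q \<nu>3 \<rho>3 \<alpha>3"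
      using Cond.IH(1)[of Q \<nu> \<rho> \<alpha> M2 "k + size_code d + 1"] rep code(7) Cond.prems(4) by auto
    have "reaches P (?le + 1) (l, M) (k + size_code d + 1, M2)"
      using start True M2(2) M2_38 by simp
    from reaches_mono[OF reaches_trans[OF this 3(1)], of "time_bound W (Cond e f c d)"]
    have "reaches P (time_bound W (Cond e f c d)) (l, M) (l + size_code (Cond e f c d), M3)"
      unfolding end_eq by simp
    then show ?thesis using 3(2,3) by blast
  next
    case False
    then have "wp W d Q \<nu> \<rho> \<alpha>" using Cond.prems(1) by simp
    then obtain \<nu>3 \<rho>3 \<alpha>3 M3 where 3: "reaches P (time_bound W d) (k, M2) (k + size_code d, M3)"
      "represents \<nu>3 \<rho>3 \<alpha>3 M3" "Q \<nu>3 \<rho>3 \<alpha>3"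
      using Cond.IH(2)[of Q \<nu> \<rho> \<alpha> M2 k] rep code(4) Cond.prems(4) by auto
    have "reaches P (?le + 1) (l, M) (k, M2)"
      using start False M2(2) M2_38 by (simp add: k_def)
    moreover have "reaches P 1 (k + size_code d, M3) (k + size_code d + 1 + size_code c, M3)"
      by (rule reaches_step[OF code(5,6)]) (rule exec.intros)
    ultimately have "reaches P (?le + 1 + (time_bound W d + 1)) (l, M) (k + size_code d + 1 + size_code c, M3)"
      using 3(1) reaches_trans by blast
    from reaches_mono[OF this, of "time_bound W (Cond e f c d)"]
    have "reaches P (time_bound W (Cond e f c d)) (l, M) (l + size_code (Cond e f c d), M3)"
      unfolding end_eq by simp
    then show ?thesis using 3(2,3) by blast
  qed
next
  case (For x b c)
  let ?s = "size_code c" and ?t = "time_bound W c"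
  have code: "l < length P" "P ! l = Const (nreg x) 0"
    "Suc l < length P" "P ! Suc l = JumpLess (nreg x) (nreg b) (l + 3)"
    "Suc (Suc l) < length P" "P ! Suc (Suc l) = Jump (l + 6 + ?s)"
    "code_at P (l + 3) (ccode c (l + 3))"
    "code_at P (l + 3 + ?s) [Const 38 1, Add (nreg x) (nreg x) 38]"
    "l + 5 + ?s < length P" "P ! (l + 5 + ?s) = Jump (l + 1)"
  proof -
    have e: "l + 3 = Suc (Suc (Suc l))" "Suc (Suc (Suc l)) + ?s = Suc (Suc (Suc (l + ?s)))"
      "l + 5 + ?s = Suc (Suc (Suc (Suc (Suc (l + ?s)))))" by simp_all
    note c = For.prems(3)[unfolded ccode.simps code_at_append code_at_Cons length_ccode list.size append_Cons append_Nil e, simplified]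
    show "l < length P" "P ! l = Const (nreg x) 0"
      "Suc l < length P" "P ! Suc l = JumpLess (nreg x) (nreg b) (l + 3)"
      "Suc (Suc l) < length P" "P ! Suc (Suc l) = Jump (l + 6 + ?s)"
      "code_at P (l + 3) (ccode c (l + 3))"
      "code_at P (l + 3 + ?s) [Const 38 1, Add (nreg x) (nreg x) 38]"
      "l + 5 + ?s < length P" "P ! (l + 5 + ?s) = Jump (l + 1)"
      unfolding e using c by simp_all
  qed
  have fits: "fits c" using For.prems(4) by simp
  \<comment> \<open>The loop is entered at its test, behind the initialisation of the counter, so
    that the claim can be iterated. The 2 extra steps are the failing test and the exit
    jump.\<close>
  have loop: "\<exists>\<nu>' \<rho>' \<alpha>' M'. reaches P (k * (?t + 4) + 2) (Suc l, M1) (l + 6 + ?s, M') \<and>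
      represents \<nu>' \<rho>' \<alpha>' M' \<and> Q \<nu>' \<rho>' \<alpha>'"
    if "for_wp (wp W c) x b N k Q \<nu>1 \<rho>1 \<alpha>1" "represents \<nu>1 \<rho>1 \<alpha>1 M1" for N k \<nu>1 \<rho>1 \<alpha>1 M1
    using that
  proof (induction k arbitrary: \<nu>1 \<rho>1 \<alpha>1 M1)
    case 0
    have M1: "M1 (nreg x) = real N" "M1 (nreg b) = real N" using 0 by (simp_all add: represents_def)
    have "exec (JumpLess (nreg x) (nreg b) (l + 3)) (Suc l, M1)
        (if M1 (nreg x) < M1 (nreg b) then l + 3 else Suc (Suc l), M1)" by (rule exec.intros)
    then have "reaches P 1 (Suc l, M1) (Suc (Suc l), M1)"
      using reaches_step[OF code(3,4)] M1 by simp
    moreover have "reaches P 1 (Suc (Suc l), M1) (l + 6 + ?s, M1)"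
      by (rule reaches_step[OF code(5,6)]) (rule exec.intros)
    ultimately have "reaches P (1 + 1) (Suc l, M1) (l + 6 + ?s, M1)" by (rule reaches_trans)
    then have "reaches P (0 * (?t + 4) + 2) (Suc l, M1) (l + 6 + ?s, M1)" by (simp add: numeral_2_eq_2)
    then show ?case using 0 unfolding for_wp.simps by blast
  next
    case (Suc k)
    let ?Q = "\<lambda>\<nu>'. for_wp (wp W c) x b N k Q (\<nu>'(x := Suc (\<nu>' x)))"
    have M1: "M1 (nreg x) = real (\<nu>1 x)" "M1 (nreg b) = real N" and x: "\<nu>1 x < N"
      and w: "wp W c ?Q \<nu>1 \<rho>1 \<alpha>1"
      using Suc.prems by (auto simp: represents_def)
    have "exec (JumpLess (nreg x) (nreg b) (l + 3)) (Suc l, M1)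
        (if M1 (nreg x) < M1 (nreg b) then l + 3 else Suc (Suc l), M1)" by (rule exec.intros)
    then have r1: "reaches P 1 (Suc l, M1) (l + 3, M1)"
      using reaches_step[OF code(3,4)] M1 x by simp
    obtain \<nu>2 \<rho>2 \<alpha>2 M2 where 2: "reaches P ?t (l + 3, M1) (l + 3 + ?s, M2)"
      "represents \<nu>2 \<rho>2 \<alpha>2 M2" "?Q \<nu>2 \<rho>2 \<alpha>2"
      using For.IH[OF w Suc.prems(2) code(7) fits] by blast
    let ?M3 = "M2(38 := 1)"
    let ?M4 = "?M3(nreg x := ?M3 (nreg x) + ?M3 38)"
    have "effect (Const 38 1) M2 ?M3" using effect_intros(1)[of 38 1 M2] by simp
    then have "runs [Const 38 1, Add (nreg x) (nreg x) 38] M2 ?M4"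
      using effect_intros(5)[of "nreg x" "nreg x" 38 ?M3] by auto
    from reaches_runs[OF this code(8)]
    have r3: "reaches P 2 (l + 3 + ?s, M2) (l + 5 + ?s, ?M4)" by (simp add: eval_nat_numeral)
    have r4: "reaches P 1 (l + 5 + ?s, ?M4) (Suc l, ?M4)"
      using reaches_step[OF code(9,10), of ?M4 "(l + 1, ?M4)"] exec.intros(9) by simp
    have rep3: "represents \<nu>2 \<rho>2 \<alpha>2 ?M3" by (rule represents_temp[OF 2(2)]) auto
    then have "?M3 (nreg x) = real (\<nu>2 x)" unfolding represents_def by blast
    then have "?M4 = ?M3(nreg x := real (Suc (\<nu>2 x)))" by (simp add: fun_eq_iff)
    then have rep4: "represents (\<nu>2(x := Suc (\<nu>2 x))) \<rho>2 \<alpha>2 ?M4"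
      by (simp only: represents_nupd[OF rep3])
    obtain \<nu>5 \<rho>5 \<alpha>5 M5 where 5: "reaches P (k * (?t + 4) + 2) (Suc l, ?M4) (l + 6 + ?s, M5)"
      "represents \<nu>5 \<rho>5 \<alpha>5 M5" "Q \<nu>5 \<rho>5 \<alpha>5"
      using Suc.IH[OF 2(3) rep4] by blast
    have "reaches P (1 + (?t + (2 + (1 + (k * (?t + 4) + 2))))) (Suc l, M1) (l + 6 + ?s, M5)"
      by (rule reaches_trans[OF r1 reaches_trans[OF 2(1) reaches_trans[OF r3 reaches_trans[OF r4 5(1)]]]])
    then have "reaches P (Suc k * (?t + 4) + 2) (Suc l, M1) (l + 6 + ?s, M5)"
      by (rule reaches_mono) simp
    then show ?case using 5(2,3) by blast
  qed
  have w: "\<nu> b \<le> W" "for_wp (wp W c) x b (\<nu> b) (\<nu> b) Q (\<nu>(x := 0)) \<rho> \<alpha>" using For.prems(1) by auto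
  have "represents (\<nu>(x := 0)) \<rho> \<alpha> (M(nreg x := 0))"
    using represents_nupd[OF For.prems(2), of x 0] by simp
  from loop[OF w(2) this] obtain \<nu>' \<rho>' \<alpha>' M' where
    r: "reaches P (\<nu> b * (?t + 4) + 2) (Suc l, M(nreg x := 0)) (l + 6 + ?s, M')"
    "represents \<nu>' \<rho>' \<alpha>' M'" "Q \<nu>' \<rho>' \<alpha>'" by blast
  have "exec (Const (nreg x) 0) (l, M) (Suc l, M(nreg x := real_of_int 0))" by (rule exec.intros)
  then have "reaches P 1 (l, M) (Suc l, M(nreg x := 0))"
    using reaches_step[OF code(1,2)] by simp
  from reaches_trans[OF this r(1)]
  have "reaches P (time_bound W (For x b c)) (l, M) (l + 6 + ?s, M')"
    by (rule reaches_mono) (use w(1) in \<open>simp add: mult_le_mono1\<close>)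
  moreover have "l + size_code (For x b c) = l + 6 + ?s" by simp
  ultimately show ?case using r(2,3) by metis
qed

section \<open>The program\<close>

abbreviation nplus (infixl "\<oplus>" 65) where "e \<oplus> f \<equiv> NPlus e f"
abbreviation nminus (infixl "\<ominus>" 65) where "e \<ominus> f \<equiv> NMinus e f"
abbreviation ntimes (infixl "\<otimes>" 70) where "e \<otimes> f \<equiv> NTimes e f"
abbreviation nassign (infix "\<leftarrow>" 61) where "x \<leftarrow> e \<equiv> NAssign x e"
abbreviation rassign (infix "\<Leftarrow>" 61) where "x \<Leftarrow> e \<equiv> RAssign x e"

text \<open>The input cells from 50 on coincide with the interleaved arrays: cell
  \<open>addr a i\<close> is read as entry \<open>i\<close> of array \<open>a\<close>. Its copy goes
  to index \<open>2 * n + 2 + addr a i\<close> of \<open>Inp\<close>; as the input has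
  \<open>2 * n + 2\<close> cells, no unread cell is overwritten.\<close>

definition copy_cell :: "arr \<Rightarrow> com" where
  "copy_cell a = Put Inp (NVar Vx0 \<oplus> (NNum (50 + anum a) \<oplus> NNum 8 \<otimes> NVar Vi)) (RGet a (NVar Vi))"

definition copy_input :: com where
  "copy_input = Vx0 \<leftarrow> NNum 2 \<otimes> NVar Vn \<oplus> NNum 2 ;;
     For Vi Vx0 (copy_cell Inp ;; copy_cell Vis ;; copy_cell Par ;; copy_cell Chi ;;
       copy_cell Tab ;; copy_cell New ;; copy_cell Dig ;; copy_cell Pow)"

text \<open>The ceiling of \<open>n / k\<close> by search, as the machine cannot round:
  \<open>q\<close> is raised while \<open>q * k < n\<close>. For \<open>k \<le> 0\<close> this never
  stops early and ends with \<open>n + 1\<close>.\<close>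

definition calc_q :: com where
  "calc_q = Vq \<leftarrow> NNum 1 ;;
     For Vi Vn (Cond (RTimes (OfNat (NVar Vq)) (RVar Rk)) (OfNat (NVar Vn)) (Vq \<leftarrow> NVar Vq \<oplus> NNum 1) Skip)"

definition calc_B :: com where
  "calc_B = Vg \<leftarrow> NVar Vq \<otimes> NVar Vq ;; VB1 \<leftarrow> NNum 1 ;;
     For Vi Vg (VB1 \<leftarrow> NNum 4 \<otimes> NVar VB1) ;;
     Vg \<leftarrow> (NVar Vq \<oplus> NVar VB1) \<otimes> (NVar Vq \<oplus> NVar VB1) ;; VB \<leftarrow> NNum 1 ;;
     For Vi Vg (VB \<leftarrow> NNum 4 \<otimes> NVar VB) ;;
     Vb \<leftarrow> NVar VB \<oplus> NNum 1 ;; VN \<leftarrow> NNum 1 ;;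
     For Vi VB (Put Pow (NVar Vi) (OfNat (NVar VN)) ;; VN \<leftarrow> NVar VN \<otimes> NVar Vb)"

text \<open>An odometer replaces division with remainder. For position \<open>Vi\<close> all codes
  are passed in order; \<open>Vr\<close> counts modulo \<open>Suc B ^ i\<close>, and each time it
  wraps around, the digit \<open>Vd\<close> advances modulo \<open>Suc B\<close>.\<close>

definition calc_digits :: com where
  "calc_digits = For Vi VB (VP \<leftarrow> NGet Pow (NVar Vi) ;; Vr \<leftarrow> NNum 0 ;; Vd \<leftarrow> NNum 0 ;;
     For Vc1 VN (Put Dig (NVar Vc1 \<otimes> NVar VB \<oplus> NVar Vi) (OfNat (NVar Vd)) ;;
       Vr \<leftarrow> NVar Vr \<oplus> NNum 1 ;;
       Cond (OfNat (NVar Vr)) (OfNat (NVar VP)) Skip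
         (Vr \<leftarrow> NNum 0 ;; Vd \<leftarrow> NVar Vd \<oplus> NNum 1 ;;
          Cond (OfNat (NVar Vd)) (OfNat (NVar Vb)) Skip (Vd \<leftarrow> NNum 0))))"

definition attach :: "nvar \<Rightarrow> nvar \<Rightarrow> com" where
  "attach p c = Put Par (NVar Vcnt) (OfNat (NVar p)) ;; Put Chi (NVar Vcnt) (OfNat (NVar c)) ;;
     Put Vis (NVar c) (RNum 1) ;; Vcnt \<leftarrow> NVar Vcnt \<oplus> NNum 1"

definition scan_edge :: com where
  "scan_edge = Vu \<leftarrow> NGet Inp (NVar Vx0 \<oplus> NNum 4 \<oplus> NNum 2 \<otimes> NVar Vj) ;;
     Vv \<leftarrow> NGet Inp (NVar Vx0 \<oplus> NNum 5 \<oplus> NNum 2 \<otimes> NVar Vj) ;;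
     Cond (RGet Vis (NVar Vu)) (RGet Vis (NVar Vv)) (attach Vv Vu)
       (Cond (RGet Vis (NVar Vv)) (RGet Vis (NVar Vu)) (attach Vu Vv) Skip)"

text \<open>The edge list has no useful order, so it is scanned \<open>n\<close> times; an edge with
  exactly one visited end is attached.\<close>

definition calc_order :: com where
  "calc_order = Vm \<leftarrow> NVar Vn \<ominus> NNum 1 ;; For Vi Vn (Put Vis (NVar Vi) (RNum 0)) ;;
     Put Vis (NNum 0) (RNum 1) ;; Vcnt \<leftarrow> NNum 0 ;; For Vi Vn (For Vj Vm scan_edge)"

text \<open>Entry \<open>(j, d)\<close> of vertex \<open>v\<close> is stored at
  \<open>v * row + j * N + d\<close>. A single vertex has two outcomes: kept, \<open>(0, 1)\<close>
  at offset 1, and deleted, \<open>(1, 0)\<close> at offset \<open>N\<close>, both of length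
  0.\<close>

definition init_tables :: com where
  "init_tables = Vn1 \<leftarrow> NVar Vn \<oplus> NNum 1 ;; Vrow \<leftarrow> NVar Vn1 \<otimes> NVar VN ;;
     Vtot \<leftarrow> NVar Vn \<otimes> NVar Vrow ;; For Vi Vtot (Put Tab (NVar Vi) (RNum (- 1))) ;;
     For Vi Vn (Put Tab (NVar Vi \<otimes> NVar Vrow \<oplus> NNum 1) (RNum 0) ;;
       Put Tab (NVar Vi \<otimes> NVar Vrow \<oplus> NVar VN) (RNum 0))"

text \<open>Besides the cross sum, \<open>Vs\<close> accumulates the digit sums of both codes, that
  is the number of vertices of the two components, for the size test that follows.\<close>

definition cross_loop :: com where
  "cross_loop = Rx \<Leftarrow> RNum 0 ;; Vs \<leftarrow> NNum 0 ;;
     For Vs1 VB (Vs \<leftarrow> NVar Vs \<oplus> (NGet Dig (NVar Vc1 \<otimes> NVar VB \<oplus> NVar Vs1)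
         \<oplus> NGet Dig (NVar Vc2 \<otimes> NVar VB \<oplus> NVar Vs1)) ;;
       For Vs2 VB (Rx \<Leftarrow> RPlus (RVar Rx) (RDivide
         (OfNat (NGet Dig (NVar Vc1 \<otimes> NVar VB \<oplus> NVar Vs1) \<otimes> NGet Dig (NVar Vc2 \<otimes> NVar VB \<oplus> NVar Vs2)))
         (OfNat (NVar Vs1 \<oplus> NVar Vs2 \<oplus> NNum 1)))))"

text \<open>If \<open>Vc1\<close> is 0, the parent is deleted and nothing gets connected;
  \<open>Vs\<close> is reset so that the size test passes. An entry is overwritten only if it is
  unknown or larger than the new value.\<close>

definition store_entry :: com where
  "store_entry = Cond (RNum 0) (OfNat (NVar Vc1)) (Vd \<leftarrow> NVar Vc1 \<oplus> NVar Vb \<otimes> NVar Vc2)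
       (Vd \<leftarrow> NNum 0 ;; Vs \<leftarrow> NNum 0) ;;
     Cond (OfNat (NVar VB)) (OfNat (NVar Vs)) Skip (
       Vidx \<leftarrow> (NVar Vj1 \<oplus> NVar Vj2) \<otimes> NVar VN \<oplus> NVar Vd ;;
       Rw \<Leftarrow> RPlus (RPlus (RVar Rw1) (RVar Rw2)) (RVar Rx) ;;
       Cond (RGet New (NVar Vidx)) (RNum 0) (Put New (NVar Vidx) (RVar Rw))
         (Cond (RVar Rw) (RGet New (NVar Vidx)) (Put New (NVar Vidx) (RVar Rw)) Skip))"

definition merge_entry :: com where
  "merge_entry = Rw1 \<Leftarrow> RGet Tab (NVar Vp \<otimes> NVar Vrow \<oplus> (NVar Vj1 \<otimes> NVar VN \<oplus> NVar Vc1)) ;;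
     Rw2 \<Leftarrow> RGet Tab (NVar Vc \<otimes> NVar Vrow \<oplus> (NVar Vj2 \<otimes> NVar VN \<oplus> NVar Vc2)) ;;
     Cond (RVar Rw1) (RNum 0) Skip (Cond (RVar Rw2) (RNum 0) Skip (
       cross_loop ;; store_entry))"

text \<open>The result is collected in \<open>New\<close>, because the row of \<open>Vp\<close> in
  \<open>Tab\<close> is still being read, and copied back at the end.\<close>

definition merge_tables :: com where
  "merge_tables = For Vt Vrow (Put New (NVar Vt) (RNum (- 1))) ;;
     For Vj1 Vn1 (For Vj2 Vn1 (For Vc1 VN (For Vc2 VN merge_entry))) ;;
     For Vt Vrow (Put Tab (NVar Vp \<otimes> NVar Vrow \<oplus> NVar Vt) (RGet New (NVar Vt)))"

definition contract_all :: com where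
  "contract_all = For Vi Vm (Vp \<leftarrow> NGet Par (NVar Vm \<ominus> (NVar Vi \<oplus> NNum 1)) ;;
     Vc \<leftarrow> NGet Chi (NVar Vm \<ominus> (NVar Vi \<oplus> NNum 1)) ;; merge_tables)"

text \<open>Only strict comparison is available: \<open>j = k\<close> is tested by excluding both
  strict inequalities, and the other two conditions are tested by their negations.\<close>

definition answer :: com where
  "answer = Vans \<leftarrow> NNum 0 ;; For Vj1 Vn1 (For Vc1 VN (
     Cond (OfNat (NVar Vj1)) (RVar Rk) Skip (Cond (RVar Rk) (OfNat (NVar Vj1)) Skip (
       Rw \<Leftarrow> RGet Tab (NVar Vj1 \<otimes> NVar VN \<oplus> NVar Vc1) ;;
       Cond (RVar Rw) (RNum 0) Skip (Cond (RVar Rtau) (RVar Rw) Skip (Vans \<leftarrow> NNum 1))))))"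

definition solve :: com where
  "solve = copy_input ;; calc_q ;; calc_B ;; calc_digits ;; calc_order ;; init_tables ;; contract_all ;; answer"

lemma fits_solve: "fits solve"
  by (simp add: solve_def copy_input_def copy_cell_def calc_q_def calc_B_def calc_digits_def calc_order_def
      scan_edge_def attach_def init_tables_def contract_all_def merge_tables_def merge_entry_def
      cross_loop_def store_entry_def answer_def)

section \<open>Correctness of the phases\<close>

declare wp.simps(7) [simp del]

definition bound1 :: "nat \<Rightarrow> nat" where
  "bound1 q = 4 ^ (q * q)"

definition bound :: "nat \<Rightarrow> nat" where
  "bound q = 4 ^ ((q + bound1 q) * (q + bound1 q))"

definition num_codes :: "nat \<Rightarrow> nat" where
  "num_codes q = Suc (bound q) ^ bound q"

lemma wp_calc_B:
  assumes q: "\<nu> Vq = q" and W: "num_codes q \<le> W"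
    and post: "\<And>\<nu>' \<rho>' \<alpha>'. frame calc_B \<nu> \<rho> \<alpha> \<nu>' \<rho>' \<alpha>' \<Longrightarrow> \<nu>' VB = bound q \<Longrightarrow> \<nu>' Vb = Suc (bound q) \<Longrightarrow>
      \<nu>' VN = num_codes q \<Longrightarrow> (\<And>i. i < bound q \<Longrightarrow> \<alpha>' Pow i = real (Suc (bound q) ^ i)) \<Longrightarrow> Q \<nu>' \<rho>' \<alpha>'"
  shows "wp W calc_B Q \<nu> \<rho> \<alpha>"
proof -
  let ?B1 = "bound1 q" and ?B = "bound q"
  \<comment> \<open>The exponents are loop bounds and so must not exceed \<open>W\<close>; each is
    smaller than the power it produces.\<close>
  have g1: "q * q < ?B1" unfolding bound1_def by (rule less_power_4)
  have g2: "(q + ?B1) * (q + ?B1) < ?B" unfolding bound_def by (rule less_power_4)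
  have "?B1 \<le> (q + ?B1) * (q + ?B1)" by (metis add_leD2 le_square order_refl order_trans)
  then have g3: "?B1 < ?B" using g2 by simp
  have "Suc ?B ^ 1 \<le> Suc ?B ^ ?B" by (rule power_increasing) (use g2 in simp_all)
  then have BW: "?B \<le> W" using W by (simp add: num_codes_def)
  let ?F = "frame calc_B \<nu> \<rho> \<alpha>"
  show ?thesis
    unfolding calc_B_def
  proof (simp add: q, rule wp_For[where N = "q * q" and I = "\<lambda>i \<nu>' \<rho>' \<alpha>'. \<nu>' VB1 = 4 ^ i \<and> ?F \<nu>' \<rho>' \<alpha>'"],
      goal_cases)
    \<comment> \<open>In applications of \<open>wp_For\<close>, goal 6 is the invariant at the
      start, goal 7 its preservation and goal 8 the exit from the loop.\<close>
    case (8 \<nu>1 \<rho>1 \<alpha>1)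
    then have 1: "\<nu>1 Vq = q" "\<nu>1 VB1 = ?B1" "?F \<nu>1 \<rho>1 \<alpha>1"
      using q by (simp_all add: frame_def bound1_def)
    show ?case
    proof (simp add: 1(1,2), rule wp_For[where N = "(q + ?B1) * (q + ?B1)"
          and I = "\<lambda>i \<nu>' \<rho>' \<alpha>'. \<nu>' VB = 4 ^ i \<and> ?F \<nu>' \<rho>' \<alpha>'"], goal_cases)
      case (8 \<nu>2 \<rho>2 \<alpha>2)
      then have 2: "\<nu>2 VB = ?B" "?F \<nu>2 \<rho>2 \<alpha>2" by (simp_all add: bound_def)
      show ?case
      proof (simp add: 2(1), rule wp_For[where N = ?B and I = "\<lambda>i \<nu>' \<rho>' \<alpha>'. \<nu>' VN = Suc ?B ^ i \<and>
            (\<forall>j<i. \<alpha>' Pow j = real (Suc ?B ^ j)) \<and> \<nu>' VB = ?B \<and> \<nu>' Vb = Suc ?B \<and> ?F \<nu>' \<rho>' \<alpha>'"], goal_cases)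
        case (8 \<nu>3 \<rho>3 \<alpha>3)
        then show ?case by (intro post) (simp_all add: num_codes_def)
      qed (use 2 BW in \<open>auto simp: frame_def calc_B_def less_Suc_eq\<close>)
    qed (use 1 g2 BW in \<open>auto simp: frame_def calc_B_def\<close>)
  qed (use q g1 g3 BW in \<open>auto simp: frame_def calc_B_def\<close>)
qed

text \<open>For \<open>k \<le> 0\<close> the value is the one with which the search ends. Being
  larger than \<open>n\<close>, it makes every component small.\<close>

definition block :: "nat \<Rightarrow> int \<Rightarrow> nat" where
  "block n k = (if 0 < k then nat \<lceil>real n / real_of_int k\<rceil> else n + 1)"

text \<open>For positive \<open>k\<close> the search ends with
  \<open>(q - 1) * k < n \<le> q * k\<close>, which characterises the ceiling. The invariant says
  that \<open>q\<close> either has grown in every iteration or is already large enough.\<close>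

lemma wp_calc_q:
  assumes n: "\<nu> Vn = n" "1 \<le> n" "n \<le> W" and k: "\<rho> Rk = real_of_int k"
    and post: "\<And>\<nu>' \<rho>' \<alpha>'. frame calc_q \<nu> \<rho> \<alpha> \<nu>' \<rho>' \<alpha>' \<Longrightarrow> \<nu>' Vq = block n k \<Longrightarrow> Q \<nu>' \<rho>' \<alpha>'"
  shows "wp W calc_q Q \<nu> \<rho> \<alpha>"
  unfolding calc_q_def
proof (simp, rule wp_For[where N = n and I = "\<lambda>i \<nu>' \<rho>' \<alpha>'. \<nu>' Vq \<le> i + 1 \<and> 1 \<le> \<nu>' Vq \<and>
    (\<nu>' Vq = 1 \<or> (real (\<nu>' Vq) - 1) * real_of_int k < real n) \<and>
    (\<nu>' Vq = i + 1 \<or> real n \<le> real (\<nu>' Vq) * real_of_int k) \<and> frame calc_q \<nu> \<rho> \<alpha> \<nu>' \<rho>' \<alpha>'"], goal_cases)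
  case (7 i \<nu>1 \<rho>1 \<alpha>1)
  then show ?case using n k by (auto simp: frame_def calc_q_def)
next
  case (8 \<nu>1 \<rho>1 \<alpha>1)
  let ?q = "\<nu>1 Vq"
  have "?q = block n k"
  proof (cases "0 < k")
    case True
    then have k1: "1 \<le> real_of_int k" by simp
    have "real n * 1 \<le> real n * real_of_int k" using k1 by (intro mult_left_mono) auto
    then have "real n \<le> real ?q * real_of_int k" using 8 n(2) by auto
    then have 1: "real n / real_of_int k \<le> real ?q" using True by (simp add: divide_le_eq)
    have 2: "real ?q - 1 < real n / real_of_int k"
      using 8 True n(2) by (auto simp: less_divide_eq)
    have "\<lceil>real n / real_of_int k\<rceil> = int ?q"
      using 1 2 by (intro ceiling_unique) simp_all
    then show ?thesis using True by (simp add: block_def)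
  next
    case False
    then have "real ?q * real_of_int k \<le> 0" by (simp add: mult_nonneg_nonpos)
    then have "?q = n + 1" using 8 n(2) by auto
    then show ?thesis using False by (simp add: block_def)
  qed
  then show ?case using 8 post by blast
qed (use n in \<open>auto simp: frame_def calc_q_def\<close>)

lemma index_eq_iff:
  assumes "i < B" "i' < (B::nat)"
  shows "c * B + i = c' * B + i' \<longleftrightarrow> c = c' \<and> i = i'"
proof
  assume eq: "c * B + i = c' * B + i'"
  have "(c * B + i) div B = c" "(c' * B + i') div B = c'" "(c * B + i) mod B = i" "(c' * B + i') mod B = i'"
    using assms by simp_all
  then show "c = c' \<and> i = i'" using eq by metis
qed simp

lemma wp_calc_digits:
  assumes B: "\<nu> VB = B" "\<nu> Vb = Suc B" "\<nu> VN = N" "B \<le> W" "N \<le> W"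
    and Pow: "\<And>i. i < B \<Longrightarrow> \<alpha> Pow i = real (Suc B ^ i)"
    and post: "\<And>\<nu>' \<rho>' \<alpha>'. frame calc_digits \<nu> \<rho> \<alpha> \<nu>' \<rho>' \<alpha>' \<Longrightarrow>
      (\<And>c i. c < N \<Longrightarrow> i < B \<Longrightarrow> \<alpha>' Dig (c * B + i) = real (digit B c i)) \<Longrightarrow> Q \<nu>' \<rho>' \<alpha>'"
  shows "wp W calc_digits Q \<nu> \<rho> \<alpha>"
  unfolding calc_digits_def
proof (rule wp_For[where N = B and I = "\<lambda>i \<nu>' \<rho>' \<alpha>'. frame calc_digits \<nu> \<rho> \<alpha> \<nu>' \<rho>' \<alpha>' \<and>
    (\<forall>c<N. \<forall>i'<i. \<alpha>' Dig (c * B + i') = real (digit B c i'))"], goal_cases)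
  case (7 i \<nu>1 \<rho>1 \<alpha>1)
  then have F: "\<nu>1 VB = B" "\<nu>1 Vb = Suc B" "\<nu>1 VN = N" "\<alpha>1 Pow i = real (Suc B ^ i)" "\<nu>1 Vi = i"
    using B Pow by (simp_all add: frame_def calc_digits_def)
  let ?P = "Suc B ^ i"
  have P: "0 < ?P" by simp
  show ?case
  proof (simp add: F(4,5) del: of_nat_power of_nat_Suc power_Suc, rule wp_For[where N = N and I = "\<lambda>c \<nu>' \<rho>' \<alpha>'. frame calc_digits \<nu> \<rho> \<alpha> \<nu>' \<rho>' \<alpha>' \<and>
      \<nu>' Vi = i \<and> \<nu>' VP = ?P \<and> \<nu>' Vr = c mod ?P \<and> \<nu>' Vd = c div ?P mod Suc B \<and>
      (\<forall>c'<N. \<forall>i'<i. \<alpha>' Dig (c' * B + i') = real (digit B c' i')) \<and>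
      (\<forall>c'<c. \<alpha>' Dig (c' * B + i) = real (digit B c' i))"], goal_cases)
    case (7 c \<nu>2 \<rho>2 \<alpha>2)
    then have 2: "\<nu>2 VB = B" "\<nu>2 Vb = Suc B" "\<nu>2 Vi = i" "\<nu>2 Vc1 = c" "\<nu>2 VP = ?P" "\<nu>2 Vr = c mod ?P"
      "\<nu>2 Vd = c div ?P mod Suc B"
      using B by (simp_all add: frame_def calc_digits_def)
    let ?\<alpha> = "\<alpha>2(Dig := (\<alpha>2 Dig)(c * B + i := real (digit B c i)))"
    have iB: "i < B" by fact
    have A1: "\<forall>c'<N. \<forall>i'<i. ?\<alpha> Dig (c' * B + i') = real (digit B c' i')"
      using 7 iB index_eq_iff[of _ B i] by auto
    have A2: "\<forall>c'<Suc c. ?\<alpha> Dig (c' * B + i) = real (digit B c' i)"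
      using 7 iB index_eq_iff[of i B i] by (auto simp: less_Suc_eq)
    have fr: "frame calc_digits \<nu> \<rho> \<alpha> \<nu>' \<rho>2 (\<alpha>2(Dig := (\<alpha>2 Dig)(c * B + i := v)))"
      if "\<And>x. x \<notin> {Vi, VP, Vr, Vd, Vc1} \<Longrightarrow> \<nu>' x = \<nu>2 x" for \<nu>' v
      using 7 that by (simp add: frame_def calc_digits_def)
    have dig: "digit B c i = \<nu>2 Vd" by (simp add: digit_def 2)
    \<comment> \<open>The quotient advances exactly when the remainder wraps around; this is the
      step of the odometer.\<close>
    have S: "Suc c mod ?P = (if Suc (c mod ?P) = ?P then 0 else Suc (c mod ?P))"
      "Suc c div ?P = (if Suc (c mod ?P) = ?P then Suc (c div ?P) else c div ?P)"
      by (simp_all only: mod_Suc div_Suc) (auto simp: mod_Suc)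
    show ?case
    proof (cases "Suc (c mod ?P) = ?P")
      case False
      then have "Suc (c mod ?P) < ?P" using mod_less_divisor[OF P, of c] by linarith
      then show ?thesis using False A1 A2 fr S
        by (simp add: 2(1-6) dig[symmetric] del: of_nat_power of_nat_Suc power_Suc fun_upd_apply)
           (simp add: 2 dig digit_def)
    next
      case True
      have "Suc (c div ?P) mod Suc B = (if Suc (c div ?P mod Suc B) = Suc B then 0 else Suc (c div ?P mod Suc B))"
        by (rule mod_Suc)
      note M = this
      show ?thesis
      proof (cases "c div ?P mod Suc B = B")
        case True': True
        show ?thesis using True True' M A1 A2 fr S
          by (simp add: 2(1-6) dig[symmetric] del: of_nat_power of_nat_Suc power_Suc fun_upd_apply)
             (simp add: 2 dig digit_def)
      next
        case False
        then have "c div ?P mod Suc B < B" using mod_less_divisor[of "Suc B" "c div ?P"] by linarith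
        then show ?thesis using True False M A1 A2 fr S
          by (simp add: 2(1-6) dig[symmetric] del: of_nat_power of_nat_Suc power_Suc fun_upd_apply)
             (simp add: 2 dig digit_def)
      qed
    qed
  next
    case (8 \<nu>2 \<rho>2 \<alpha>2)
    then show ?case using F by (auto simp: frame_def calc_digits_def less_Suc_eq)
  qed (use 7 B F in \<open>auto simp: frame_def calc_digits_def\<close>)
next
  case (8 \<nu>1 \<rho>1 \<alpha>1)
  then show ?case using post by blast
qed (use B in \<open>auto simp: frame_def calc_digits_def\<close>)

text \<open>\<open>p\<close> is the next cell to be copied. The second conjunct protects the source:
  reads are at indices below \<open>X\<close>, writes at \<open>X\<close> and above.\<close>

definition copied :: "nat \<Rightarrow> (nat \<Rightarrow> real) \<Rightarrow> arrays \<Rightarrow> nat \<Rightarrow> arrays \<Rightarrow> bool" where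
  "copied X x \<alpha> p \<alpha>' \<longleftrightarrow> (\<forall>i. 4 \<le> i \<and> i < p \<and> i < X \<longrightarrow> \<alpha>' Inp (X + i) = x i) \<and> (\<forall>a j. j < X \<longrightarrow> \<alpha>' a j = \<alpha> a j)"

lemma wp_copy_cell:
  assumes "\<nu> Vi = i" "\<nu> Vx0 = X" "i < X" "copied X x \<alpha> (addr a i) \<alpha>1"
    and x: "\<And>a i. addr a i < X \<Longrightarrow> \<alpha> a i = x (addr a i)"
    and post: "\<And>\<alpha>2. copied X x \<alpha> (Suc (addr a i)) \<alpha>2 \<Longrightarrow> Q \<nu> \<rho> \<alpha>2"
  shows "wp W (copy_cell a) Q \<nu> \<rho> \<alpha>1"
proof -
  have "copied X x \<alpha> (Suc (addr a i)) (\<alpha>1(Inp := (\<alpha>1 Inp)(X + addr a i := \<alpha>1 a i)))"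
    using assms(3,4) x[of a i] by (auto simp: copied_def less_Suc_eq)
  moreover have "X + (50 + anum a + 8 * i) = X + addr a i" by (simp add: addr_def)
  ultimately show ?thesis using assms(1,2) post by (simp add: copy_cell_def)
qed

lemma wp_copy_input:
  assumes n: "\<nu> Vn = n" "2 * n + 2 \<le> W"
    and pre: "\<And>p. 4 \<le> p \<Longrightarrow> p < 50 \<Longrightarrow> p < 2 * n + 2 \<Longrightarrow> \<alpha> Inp (2 * n + 2 + p) = x p"
      "\<And>a i. addr a i < 2 * n + 2 \<Longrightarrow> \<alpha> a i = x (addr a i)"
    and post: "\<And>\<nu>' \<rho>' \<alpha>'. frame copy_input \<nu> \<rho> \<alpha> \<nu>' \<rho>' \<alpha>' \<Longrightarrow> \<nu>' Vx0 = 2 * n + 2 \<Longrightarrow>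
      (\<And>p. 4 \<le> p \<Longrightarrow> p < 2 * n + 2 \<Longrightarrow> \<alpha>' Inp (2 * n + 2 + p) = x p) \<Longrightarrow> Q \<nu>' \<rho>' \<alpha>'"
  shows "wp W copy_input Q \<nu> \<rho> \<alpha>"
  unfolding copy_input_def
proof (simp add: n(1), rule wp_For[where N = "2 * n + 2" and I = "\<lambda>i \<nu>' \<rho>' \<alpha>'. copied (2 * n + 2) x \<alpha> (50 + 8 * i) \<alpha>'"],
    goal_cases)
  case (7 i \<nu>1 \<rho>1 \<alpha>1)
  note i = 7(1) and Vi = 7(2)
  have Vx0: "\<nu>1 Vx0 = 2 * n + 2" using 7(3) by (simp add: frame_def copy_cell_def)
  note step = wp_copy_cell[where \<nu> = \<nu>1 and X = "2 * n + 2" and i = i and x = x and \<alpha> = \<alpha>, OF Vi Vx0 i _ pre(2)]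
  \<comment> \<open>The eight arrays are interleaved in this order, so one iteration moves eight
    consecutive cells.\<close>
  have a: "addr Inp i = 50 + 8 * i" "addr Vis i = Suc (addr Inp i)" "addr Par i = Suc (addr Vis i)"
    "addr Chi i = Suc (addr Par i)" "addr Tab i = Suc (addr Chi i)" "addr New i = Suc (addr Tab i)"
    "addr Dig i = Suc (addr New i)" "addr Pow i = Suc (addr Dig i)" "50 + 8 * Suc i = Suc (addr Pow i)"
    by (simp_all add: addr_def)
  show ?case
    apply (simp only: wp.simps(5))
    apply (rule step, simp only: a(1) 7(4), assumption)
    apply (rule step, simp only: a(2), assumption)
    apply (rule step, simp only: a(3), assumption)
    apply (rule step, simp only: a(4), assumption)
    apply (rule step, simp only: a(5), assumption)
    apply (rule step, simp only: a(6), assumption)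
    apply (rule step, simp only: a(7), assumption)
    apply (rule step, simp only: a(8), assumption)
    apply (simp only: a(9))
    done
next
  case (8 \<nu>1 \<rho>1 \<alpha>1)
  show ?case
  proof (rule post)
    show "frame copy_input \<nu> \<rho> \<alpha> \<nu>1 \<rho>1 \<alpha>1"
      using 8(2) by (simp add: frame_def copy_input_def)
    show "\<nu>1 Vx0 = 2 * n + 2" using 8(2) by (simp add: frame_def copy_cell_def)
    show "\<alpha>1 Inp (2 * n + 2 + p) = x p" if "4 \<le> p" "p < 2 * n + 2" for p
      using 8(3) that by (simp add: copied_def)
  qed
next
  case 6
  show ?case using pre(1) by (simp add: copied_def)
qed (use n in \<open>simp_all add: copy_cell_def\<close>)

section \<open>Growing a tree from its root\<close>

lemma enat_finite_mono: "(a::enat) \<le> b \<Longrightarrow> b \<noteq> \<infinity> \<Longrightarrow> a \<noteq> \<infinity>"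
  by (cases a; cases b) auto

definition reached :: "(nat \<Rightarrow> nat) \<Rightarrow> nat \<Rightarrow> nat set" where
  "reached C k = insert 0 (C ` {..<k})"

definition grows :: "nat graph \<Rightarrow> (nat \<Rightarrow> nat) \<Rightarrow> (nat \<Rightarrow> nat) \<Rightarrow> nat \<Rightarrow> bool" where
  "grows T P C k \<longleftrightarrow> (\<forall>i<k. {P i, C i} \<in> edges T \<and> P i \<in> reached C i \<and> C i \<notin> reached C i)"

lemma reached_Suc: "reached C (Suc k) = insert (C k) (reached C k)"
  by (auto simp: reached_def lessThan_Suc)

lemma reached_mono: "i \<le> k \<Longrightarrow> reached C i \<subseteq> reached C k"
  by (auto simp: reached_def)

lemma reached_upd: "i \<le> k \<Longrightarrow> reached (C(k := c)) i = reached C i"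
  by (auto simp: reached_def)

lemma grows_upd:
  assumes "grows T P C k" "{p, c} \<in> edges T" "p \<in> reached C k" "c \<notin> reached C k"
  shows "grows T (P(k := p)) (C(k := c)) (Suc k)" "reached (C(k := c)) (Suc k) = insert c (reached C k)"
  using assms by (auto simp: grows_def reached_Suc reached_upd less_Suc_eq)

lemma card_reached: "grows T P C k \<Longrightarrow> card (reached C k) = Suc k"
proof (induction k)
  case (Suc k)
  then have "C k \<notin> reached C k" "grows T P C k" by (auto simp: grows_def)
  moreover have "finite (reached C k)" by (simp add: reached_def)
  ultimately show ?case using Suc.IH by (simp add: reached_Suc)
qed (simp add: reached_def)

lemma reached_subset:
  assumes "simple_graph T" "grows T P C k" "0 \<in> verts T"
  shows "reached C k \<subseteq> verts T"
proof -
  have "C i \<in> verts T" if "i < k" for i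
    using assms(1,2) that simple_graph_edge[of T "P i" "C i"] by (simp add: grows_def)
  then show ?thesis using assms(3) by (auto simp: reached_def)
qed

text \<open>A path from \<open>u\<close> to a vertex outside \<open>D\<close> has an edge on which
  it leaves \<open>D\<close>.\<close>

lemma connected_crossing:
  assumes "connected_graph T" "u \<in> D" "D \<subseteq> verts T" "D \<noteq> verts T"
  obtains x y where "x \<in> D" "y \<in> verts T - D" "{x, y} \<in> edges T"
proof -
  obtain v where v: "v \<in> verts T - D" using assms(3,4) by auto
  then obtain p where p: "path_between T u p v" using assms unfolding connected_graph_def by blast
  have "p \<noteq> [] \<Longrightarrow> hd p \<in> D \<Longrightarrow> last p \<notin> D \<Longrightarrow> set p \<subseteq> verts T \<Longrightarrow> successively (adjacent T) p \<Longrightarrow>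
      \<exists>x\<in>D. \<exists>y\<in>verts T - D. {x, y} \<in> edges T"
  proof (induction p)
    case (Cons a p)
    then obtain b p' where p: "p = b # p'" by (cases p) auto
    show ?case
    proof (cases "b \<in> D")
      case True
      then show ?thesis using Cons p by simp
    next
      case False
      then show ?thesis using Cons.prems p by auto
    qed
  qed simp
  then show ?thesis using p v assms(2) that unfolding path_between_def by blast
qed

context
  fixes T :: "nat graph" and n :: nat
  assumes tree: "tree T" and verts: "verts T = {0..<n}"
begin

lemma simple_T: "simple_graph T" and connected_T: "connected_graph T"
  using tree by (auto simp: tree_def)

lemma n_pos: "1 \<le> n"
  using connected_T verts by (cases n) (auto simp: connected_graph_def)

lemma zero_in_verts: "0 \<in> verts T"
  using n_pos verts by simp

lemma grows_le: "grows T P C k \<Longrightarrow> k \<le> n - 1"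
  using card_mono[OF _ reached_subset[OF simple_T _ zero_in_verts], of P C k] card_reached[of T P C k] verts
  by simp

text \<open>A set that contains the root and is closed under adjacency is everything, by
  connectedness. This is the termination criterion of the search.\<close>

lemma reached_all:
  assumes "grows T P C k" "\<And>x y. {x, y} \<in> edges T \<Longrightarrow> x \<in> reached C k \<Longrightarrow> y \<in> reached C k"
  shows "reached C k = verts T" "k = n - 1"
proof -
  have "0 \<in> reached C k" by (simp add: reached_def)
  then show *: "reached C k = verts T"
    using connected_crossing[OF connected_T] reached_subset[OF simple_T assms(1) zero_in_verts] assms(2)
    by (metis DiffE)
  then show "k = n - 1" using card_reached[OF assms(1)] verts by simp
qed

lemma grows_exists: "k \<le> n - 1 \<Longrightarrow> \<exists>P C. grows T P C k"
proof (induction k)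
  case 0
  then show ?case by (auto simp: grows_def)
next
  case (Suc k)
  then obtain P C where g: "grows T P C k" by auto
  have "\<not> (\<forall>x y. {x, y} \<in> edges T \<longrightarrow> x \<in> reached C k \<longrightarrow> y \<in> reached C k)"
    using reached_all(2)[OF g] Suc.prems by auto
  then show ?case using grows_upd(1)[OF g] by blast
qed

text \<open>\<open>path_between\<close> demands that all vertices lie in \<open>verts\<close>, so
  paths in this graph stay within the reached part although it has all edges of
  \<open>T\<close>.\<close>

lemma reached_connected:
  assumes "grows T P C k" "x \<in> reached C k"
  shows "gdist \<lparr>verts = reached C k, edges = edges T\<rparr> 0 x \<noteq> \<infinity>"
  using assms
proof (induction k arbitrary: x)
  case 0
  then show ?case using gdist_self[of 0 "\<lparr>verts = reached C 0, edges = edges T\<rparr>"]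
    by (simp add: reached_def zero_enat_def)
next
  case (Suc k)
  let ?G = "\<lambda>k. \<lparr>verts = reached C k, edges = edges T\<rparr>"
  have g: "grows T P C k" using Suc.prems(1) by (simp add: grows_def)
  have mono: "gdist (?G (Suc k)) 0 y \<noteq> \<infinity>" if "y \<in> reached C k" for y
  proof -
    have "gdist (?G (Suc k)) 0 y \<le> gdist (?G k) 0 y"
      by (rule gdist_antimono) (simp_all add: reached_mono)
    then show ?thesis using Suc.IH[OF g that] by (cases "gdist (?G (Suc k)) 0 y") simp_all
  qed
  show ?case
  proof (cases "x \<in> reached C k")
    case False
    then have x: "x = C k" using Suc.prems(2) by (simp add: reached_Suc)
    have k: "{P k, C k} \<in> edges T" "P k \<in> reached C k" using Suc.prems(1) by (auto simp: grows_def)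
    have "gdist (?G (Suc k)) 0 (C k) \<le> gdist (?G (Suc k)) 0 (P k) + 1"
      by (rule gdist_step) (use k in \<open>simp_all add: reached_Suc\<close>)
    moreover have "gdist (?G (Suc k)) 0 (P k) + 1 \<noteq> \<infinity>"
      using mono[OF k(2)] by (simp add: plus_eq_infty_iff_enat)
    ultimately show ?thesis unfolding x by (rule enat_finite_mono)
  qed (rule mono)
qed

text \<open>This is where acyclicity enters: the reached part is connected, so a second edge from a
  new vertex into it would close a cycle. Hence all edges between reached vertices are those of the
  growth order.\<close>

lemma grows_edge:
  assumes "grows T P C k" "{x, y} \<in> edges T" "x \<in> reached C k" "y \<in> reached C k"
  shows "\<exists>i<k. {x, y} = {P i, C i}"
  using assms
proof (induction k arbitrary: x y)
  case 0
  then show ?case using simple_graph_edge[OF simple_T, of x y] by (auto simp: reached_def)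
next
  case (Suc k)
  have g: "grows T P C k" using Suc.prems(1) by (simp add: grows_def)
  have new: "z = P k" if e: "{C k, z} \<in> edges T" and z: "z \<in> reached C k" for z
  proof (rule ccontr)
    assume "z \<noteq> P k"
    let ?G = "\<lparr>verts = reached C k, edges = edges T\<rparr>"
    have k: "{P k, C k} \<in> edges T" "P k \<in> reached C k" "C k \<notin> reached C k"
      using Suc.prems(1) by (auto simp: grows_def)
    \<comment> \<open>A path from \<open>z\<close> to \<open>P k\<close> inside the reached part
      avoids \<open>C k\<close>; together with \<open>C k\<close> it forms a cycle.\<close>
    have "gdist ?G z (P k) \<le> gdist ?G z 0 + gdist ?G 0 (P k)" by (rule gdist_triangle)
    moreover have "gdist ?G z 0 + gdist ?G 0 (P k) \<noteq> \<infinity>"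
      using reached_connected[OF g z] reached_connected[OF g k(2)]
      unfolding gdist_sym[of ?G z 0] plus_eq_infty_iff_enat by blast
    ultimately have "gdist ?G z (P k) \<noteq> \<infinity>" by (rule enat_finite_mono)
    then obtain p where p: "path_between ?G z p (P k)" by (rule gdist_path)
    then have "p \<noteq> []" "hd p = z" "last p = P k" "set p \<subseteq> reached C k" "distinct p"
      "successively (adjacent T) p" by (auto simp: path_between_def)
    moreover from this have "2 \<le> length p" using \<open>z \<noteq> P k\<close>
      by (cases p; cases "tl p") auto
    ultimately have "cycle T (C k # p)"
      unfolding cycle_def using e k reached_subset[OF simple_T g zero_in_verts]
        simple_graph_edge[OF simple_T k(1)]
      by (auto simp: successively_Cons)
    then show False using tree by (auto simp: tree_def)
  qed
  have neq: "x \<noteq> y" using simple_graph_edge[OF simple_T Suc.prems(2)] by simp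
  consider "x \<in> reached C k" "y \<in> reached C k" | "x = C k" "y \<in> reached C k" | "y = C k" "x \<in> reached C k"
    using Suc.prems(3,4) neq by (auto simp: reached_Suc)
  then show ?case
  proof cases
    case 1
    then show ?thesis using Suc.IH[OF g Suc.prems(2)] less_SucI by blast
  next
    case 2
    then have "y = P k" using new[of y] Suc.prems(2) by simp
    then have "{x, y} = {P k, C k}" using 2 by auto
    then show ?thesis by blast
  next
    case 3
    then have "x = P k" using new[of x] Suc.prems(2) by (simp add: insert_commute)
    then have "{x, y} = {P k, C k}" using 3 by auto
    then show ?thesis by blast
  qed
qed

lemma grows_imp_grown_tree:
  assumes g: "grows T P C (n - 1)"
  shows "grown_tree T P C (n - 1)"
proof
  have r: "reached C (n - 1) = verts T"
  proof (rule card_subset_eq)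
    show "reached C (n - 1) \<subseteq> verts T" by (rule reached_subset[OF simple_T g zero_in_verts])
    show "card (reached C (n - 1)) = card (verts T)" using card_reached[OF g] verts n_pos by simp
  qed (simp add: verts)
  show "verts T = insert 0 (C ` {..<n - 1})" using r by (simp add: reached_def)
  show "edges T = (\<lambda>i. {P i, C i}) ` {..<n - 1}"
  proof (intro equalityI subsetI)
    fix e assume e: "e \<in> edges T"
    then have "card e = 2" using simple_T unfolding simple_graph_def by blast
    then obtain x y where xy: "e = {x, y}" by (meson card_2_iff)
    then show "e \<in> (\<lambda>i. {P i, C i}) ` {..<n - 1}"
      using grows_edge[OF g, of x y] e simple_graph_edge[OF simple_T, of x y] r by auto
  qed (use g in \<open>auto simp: grows_def\<close>)
  show "simple_graph T" by (rule simple_T)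
  show "P i \<in> insert 0 (C ` {..<i})" "C i \<notin> insert 0 (C ` {..<i})" if "i < n - 1" for i
    using g that unfolding grows_def reached_def by blast+
qed

text \<open>Any growth order shows that a tree has \<open>n - 1\<close> edges. The program relies on
  this count for the number of pairs to read, as cell 3 becomes a register.\<close>

lemma length_edge_list:
  assumes "edge_list T es"
  shows "length es = n - 1"
proof -
  obtain P C where "grows T P C (n - 1)" using grows_exists by blast
  then interpret grown_tree T P C "n - 1" by (rule grows_imp_grown_tree)
  have ne: "{P i, C i} \<noteq> {P j, C j}" if "i < j" "j < n - 1" for i j
  proof -
    have sub: "insert 0 (C ` {..<i}) \<subseteq> insert 0 (C ` {..<j})" using that by auto
    have "P i \<in> insert 0 (C ` {..<j})" using subsetD[OF sub parent[of i]] that by simp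
    moreover have "C i \<in> insert 0 (C ` {..<j})" using that by simp
    ultimately have "C j \<noteq> P i" "C j \<noteq> C i" using child[OF that(2)] by metis+
    then show ?thesis by (simp add: doubleton_eq_iff)
  qed
  have "inj_on (\<lambda>i. {P i, C i}) {..<n - 1}"
  proof (rule inj_onI)
    fix i j assume "i \<in> {..<n - 1}" "j \<in> {..<n - 1}" "{P i, C i} = {P j, C j}"
    then show "i = j" using ne[of i j] ne[of j i] by (cases i j rule: linorder_cases) simp_all
  qed
  then have "card (edges T) = n - 1" unfolding edges_T by (simp add: card_image)
  moreover have "card (edges T) = length es"
  proof -
    have "set (map (\<lambda>(u, v). {u, v}) es) = edges T" "distinct (map (\<lambda>(u, v). {u, v}) es)"
      using assms by (simp_all add: edge_list_def)
    then show ?thesis using distinct_card length_map by metis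
  qed
  ultimately show ?thesis by simp
qed

lemma edge_list_nth:
  assumes "edge_list T es" "j < length es"
  shows "{fst (es ! j), snd (es ! j)} \<in> edges T" "fst (es ! j) < n" "snd (es ! j) < n"
proof -
  have "(\<lambda>(u, v). {u, v}) (es ! j) \<in> edges T"
    using assms nth_mem[OF assms(2)] unfolding edge_list_def by blast
  then show *: "{fst (es ! j), snd (es ! j)} \<in> edges T" by (simp add: case_prod_beta)
  show "fst (es ! j) < n" "snd (es ! j) < n" using simple_graph_edge[OF simple_T *] verts by auto
qed

section \<open>Finding a growth order from the edge list\<close>

definition order_inv :: "arrays \<Rightarrow> nat \<Rightarrow> (nat \<Rightarrow> nat) \<Rightarrow> (nat \<Rightarrow> nat) \<Rightarrow> bool" where
  "order_inv \<alpha> k P C \<longleftrightarrow> grows T P C k \<and> (\<forall>r<k. \<alpha> Par r = real (P r) \<and> \<alpha> Chi r = real (C r)) \<and>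
     (\<forall>v<n. \<alpha> Vis v = (if v \<in> reached C k then 1 else 0))"

lemma order_inv_attach:
  assumes "order_inv \<alpha> k P C" "{p, c} \<in> edges T" "p \<in> reached C k" "c \<notin> reached C k"
  shows "order_inv (\<alpha>(Par := (\<alpha> Par)(k := real p), Chi := (\<alpha> Chi)(k := real c), Vis := (\<alpha> Vis)(c := 1)))
    (Suc k) (P(k := p)) (C(k := c))"
  using assms grows_upd[of T P C k p c] by (auto simp: order_inv_def less_Suc_eq)

text \<open>If the edge is not attached, the arrays are unchanged and its ends are equally marked. A
  whole pass of this kind shows that the reached part is closed under adjacency.\<close>

lemma wp_scan_edge:
  assumes inv: "order_inv \<alpha> k P C" and k: "\<nu> Vcnt = k" and e: "{u, v} \<in> edges T" "u < n" "v < n"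
    and inp: "\<alpha> Inp (\<nu> Vx0 + 4 + 2 * \<nu> Vj) = real u" "\<alpha> Inp (\<nu> Vx0 + 5 + 2 * \<nu> Vj) = real v"
    and post1: "\<And>\<nu>' \<rho>' \<alpha>' P' C'. order_inv \<alpha>' (Suc k) P' C' \<Longrightarrow> \<nu>' Vcnt = Suc k \<Longrightarrow> Q \<nu>' \<rho>' \<alpha>'"
    and post2: "\<And>\<nu>' \<rho>'. \<nu>' Vcnt = k \<Longrightarrow> \<alpha> Vis u = \<alpha> Vis v \<Longrightarrow> Q \<nu>' \<rho>' \<alpha>"
  shows "wp W scan_edge Q \<nu> \<rho> \<alpha>"
proof -
  have V: "\<alpha> Vis u = (if u \<in> reached C k then 1 else 0)" "\<alpha> Vis v = (if v \<in> reached C k then 1 else 0)"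
    using inv e(2,3) by (simp_all add: order_inv_def)
  have e': "{v, u} \<in> edges T" using e(1) by (simp add: insert_commute)
  note * = order_inv_attach[OF inv e(1)] order_inv_attach[OF inv e']
  have simps: "nat \<lfloor>real u\<rfloor> = u" "nat \<lfloor>real v\<rfloor> = v" by simp_all
  consider "u \<in> reached C k \<longleftrightarrow> v \<in> reached C k" | "u \<in> reached C k" "v \<notin> reached C k"
    | "u \<notin> reached C k" "v \<in> reached C k" by blast
  then show ?thesis
  proof cases
    case 1
    then have "\<alpha> Vis u = \<alpha> Vis v" using V by simp
    then show ?thesis using inp k by (simp add: scan_edge_def post2)
  next
    case 2
    then show ?thesis using inp k V
      by (simp add: scan_edge_def attach_def) (rule post1[OF *(1)], simp_all)
  next
    case 3
    then show ?thesis using inp k V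
      by (simp add: scan_edge_def attach_def) (rule post1[OF *(2)], simp_all)
  qed
qed

text \<open>A pass that attaches nothing has seen equally marked ends on every edge, so the search
  is complete. Hence \<open>i\<close> passes attach at least \<open>min i (n - 1)\<close> edges, and
  \<open>n\<close> passes suffice.\<close>

lemma wp_calc_order:
  assumes n: "\<nu> Vn = n" "n \<le> W" and es: "edge_list T es"
    and inp: "\<And>j. j < n - 1 \<Longrightarrow> \<alpha> Inp (\<nu> Vx0 + 4 + 2 * j) = real (fst (es ! j))"
      "\<And>j. j < n - 1 \<Longrightarrow> \<alpha> Inp (\<nu> Vx0 + 5 + 2 * j) = real (snd (es ! j))"
    and post: "\<And>\<nu>' \<rho>' \<alpha>' P C. frame calc_order \<nu> \<rho> \<alpha> \<nu>' \<rho>' \<alpha>' \<Longrightarrow> \<nu>' Vm = n - 1 \<Longrightarrow>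
      grown_tree T P C (n - 1) \<Longrightarrow> (\<And>r. r < n - 1 \<Longrightarrow> \<alpha>' Par r = real (P r)) \<Longrightarrow>
      (\<And>r. r < n - 1 \<Longrightarrow> \<alpha>' Chi r = real (C r)) \<Longrightarrow> Q \<nu>' \<rho>' \<alpha>'"
  shows "wp W calc_order Q \<nu> \<rho> \<alpha>"
  unfolding calc_order_def
proof (simp add: n(1) n_pos del: One_nat_def, rule wp_For[where N = n and I = "\<lambda>i \<nu>' \<rho>' \<alpha>'. \<forall>v<i. \<alpha>' Vis v = 0"], goal_cases)
  case 2
  then show ?case using n by simp
next
  case (8 \<nu>1 \<rho>1 \<alpha>1)
  note F1 = 8(2) and V1 = 8(3)
  let ?\<alpha> = "\<alpha>1(Vis := (\<alpha>1 Vis)(0 := 1))"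
  have init: "order_inv ?\<alpha> 0 P C" for P C using V1 by (auto simp: order_inv_def grows_def reached_def)
  show ?case
  proof (rule wp_For[where N = n and I = "\<lambda>i \<nu>' \<rho>' \<alpha>'. \<exists>P C. order_inv \<alpha>' (\<nu>' Vcnt) P C \<and> min i (n - 1) \<le> \<nu>' Vcnt"], goal_cases)
    case 1
    then show ?case using F1 n by (simp add: frame_def)
  next
    case 2
    then show ?case using n by simp
  next
    case 6
    then show ?case using init by simp
  next
    case (7 i \<nu>2 \<rho>2 \<alpha>2)
    then obtain P2 C2 where inv2: "order_inv \<alpha>2 (\<nu>2 Vcnt) P2 C2" and ge2: "min i (n - 1) \<le> \<nu>2 Vcnt" by blast
    have g2: "grows T P2 C2 (\<nu>2 Vcnt)" using inv2 by (simp add: order_inv_def)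
    have F2: "\<nu>2 Vm = n - 1" "\<nu>2 Vx0 = \<nu> Vx0" "\<alpha>2 Inp = \<alpha> Inp"
      using 7(3) F1 by (simp_all add: frame_def scan_edge_def attach_def)
    show ?case
    \<comment> \<open>As long as the counter is unchanged, so are the arrays; the comparisons made
      so far in the pass then all refer to the same marking.\<close>
    proof (rule wp_For[where N = "n - 1" and I = "\<lambda>j \<nu>' \<rho>' \<alpha>'. \<exists>P C. order_inv \<alpha>' (\<nu>' Vcnt) P C \<and> \<nu>2 Vcnt \<le> \<nu>' Vcnt \<and>
        (\<nu>' Vcnt = \<nu>2 Vcnt \<longrightarrow> \<alpha>' = \<alpha>2 \<and> (\<forall>j'<j. \<alpha>2 Vis (fst (es ! j')) = \<alpha>2 Vis (snd (es ! j'))))"], goal_cases)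
      case 6
      then show ?case using inv2 by auto
    next
      case (7 j \<nu>3 \<rho>3 \<alpha>3)
      then obtain P3 C3 where inv3: "order_inv \<alpha>3 (\<nu>3 Vcnt) P3 C3" and ge3: "\<nu>2 Vcnt \<le> \<nu>3 Vcnt"
        and eq3: "\<nu>3 Vcnt = \<nu>2 Vcnt \<Longrightarrow> \<alpha>3 = \<alpha>2 \<and> (\<forall>j'<j. \<alpha>2 Vis (fst (es ! j')) = \<alpha>2 Vis (snd (es ! j')))"
        by blast
      have F3: "\<nu>3 Vx0 = \<nu> Vx0" "\<alpha>3 Inp = \<alpha> Inp"
        using 7(3) F2 by (simp_all add: frame_def scan_edge_def attach_def)
      have j: "j < length es" using 7(1) length_edge_list[OF es] by simp
      show ?case
      proof (rule wp_scan_edge[where k = "\<nu>3 Vcnt" and \<alpha> = \<alpha>3 and \<nu> = \<nu>3, OF inv3 refl edge_list_nth[OF es j]], goal_cases)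
        case (3 \<nu>4 \<rho>4 \<alpha>4 P4 C4)
        then show ?case using ge3 by auto
      next
        case (4 \<nu>4 \<rho>4)
        then show ?case using inv3 ge3 eq3 by (auto simp: less_Suc_eq)
      qed (use inp[OF 7(1)] F3 7(2) in simp_all)
    next
      case (8 \<nu>3 \<rho>3 \<alpha>3)
      from 8(3) obtain P3 C3 where inv3: "order_inv \<alpha>3 (\<nu>3 Vcnt) P3 C3" and ge3: "\<nu>2 Vcnt \<le> \<nu>3 Vcnt"
        and i3: "\<nu>3 Vcnt = \<nu>2 Vcnt \<longrightarrow>
          \<alpha>3 = \<alpha>2 \<and> (\<forall>j'<n - 1. \<alpha>2 Vis (fst (es ! j')) = \<alpha>2 Vis (snd (es ! j')))"
        by (elim exE conjE)
      have eq3: "\<forall>j'<n - 1. \<alpha>2 Vis (fst (es ! j')) = \<alpha>2 Vis (snd (es ! j'))" if "\<nu>3 Vcnt = \<nu>2 Vcnt"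
        by (rule conjunct2[OF mp[OF i3 that]])
      \<comment> \<open>Either the counter has grown during the pass, or the reached part is closed
        and all \<open>n - 1\<close> edges are attached.\<close>
      have "min (Suc i) (n - 1) \<le> \<nu>3 Vcnt"
      proof (cases "\<nu>3 Vcnt = \<nu>2 Vcnt")
        case True
        have "y \<in> reached C2 (\<nu>2 Vcnt)" if xy: "{x, y} \<in> edges T" "x \<in> reached C2 (\<nu>2 Vcnt)" for x y
        proof -
          obtain j where j: "j < length es" "{x, y} = (\<lambda>(u, v). {u, v}) (es ! j)"
          proof -
            have "{x, y} \<in> (\<lambda>(u, v). {u, v}) ` set es" using xy(1) es by (simp add: edge_list_def)
            then obtain e where "e \<in> set es" "{x, y} = (\<lambda>(u, v). {u, v}) e" by (rule imageE)
            then show ?thesis using that unfolding in_set_conv_nth by blast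
          qed
          have "\<alpha>2 Vis (fst (es ! j)) = \<alpha>2 Vis (snd (es ! j))"
            using eq3[OF True] j(1) length_edge_list[OF es] by simp
          then have "fst (es ! j) \<in> reached C2 (\<nu>2 Vcnt) \<longleftrightarrow> snd (es ! j) \<in> reached C2 (\<nu>2 Vcnt)"
            using inv2 edge_list_nth(2,3)[OF es j(1)] by (simp add: order_inv_def split: if_splits)
          moreover have "{x, y} = {fst (es ! j), snd (es ! j)}" using j(2) by (simp add: case_prod_beta)
          then have "x = fst (es ! j) \<and> y = snd (es ! j) \<or> x = snd (es ! j) \<and> y = fst (es ! j)"
            by (simp add: doubleton_eq_iff)
          ultimately show ?thesis using xy(2) by metis
        qed
        then have "\<nu>2 Vcnt = n - 1" by (rule reached_all(2)[OF g2])
        then show ?thesis using ge3 by simp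
      next
        case False
        then show ?thesis using ge2 ge3 by simp
      qed
      then show ?case using inv3 by auto
    qed (use F2 n in \<open>simp_all add: scan_edge_def attach_def\<close>)
  next
    case (8 \<nu>2 \<rho>2 \<alpha>2)
    then obtain P2 C2 where inv2: "order_inv \<alpha>2 (\<nu>2 Vcnt) P2 C2" and ge2: "n - 1 \<le> \<nu>2 Vcnt" by auto
    then have g2: "grows T P2 C2 (\<nu>2 Vcnt)" by (simp add: order_inv_def)
    then have cnt: "\<nu>2 Vcnt = n - 1" using grows_le ge2 by fastforce
    show ?case
    proof (rule post)
      show "frame calc_order \<nu> \<rho> \<alpha> \<nu>2 \<rho>2 \<alpha>2"
        using 8(2) F1 by (simp add: frame_def calc_order_def)
      show "\<nu>2 Vm = n - 1" using 8(2) F1 by (simp add: frame_def scan_edge_def attach_def)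
      show "grown_tree T P2 C2 (n - 1)" using grows_imp_grown_tree g2 cnt by simp
    qed (use inv2 cnt in \<open>simp_all add: order_inv_def\<close>)
  qed (simp_all add: scan_edge_def attach_def)
qed (auto simp: less_Suc_eq n(1))

end

section \<open>Dynamic programming tables\<close>

text \<open>A negative entry of a table means that no value is known.\<close>

definition holds :: "nat \<Rightarrow> nat \<Rightarrow> (nat \<times> nat \<times> real) set \<Rightarrow> (nat \<times> nat \<times> real) set \<Rightarrow>
    (nat \<Rightarrow> nat \<Rightarrow> real) \<Rightarrow> bool" where
  "holds n N Z Y D \<longleftrightarrow> (\<forall>j\<le>n. \<forall>d<N. 0 \<le> D j d \<longrightarrow> (j, d, D j d) \<in> Z) \<and>
     (\<forall>(j, d, w)\<in>Y. 0 \<le> D j d \<and> D j d \<le> w)"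

definition in_range :: "nat \<Rightarrow> nat \<Rightarrow> (nat \<times> nat \<times> real) set \<Rightarrow> bool" where
  "in_range n N Z \<longleftrightarrow> (\<forall>(j, d, w)\<in>Z. j \<le> n \<and> d < N \<and> 0 \<le> w)"

lemma in_rangeD: "in_range n N Z \<Longrightarrow> (j, d, w) \<in> Z \<Longrightarrow> j \<le> n \<and> d < N \<and> 0 \<le> w"
  unfolding in_range_def by auto

lemma holds_sound: "holds n N Z Y D \<Longrightarrow> j \<le> n \<Longrightarrow> d < N \<Longrightarrow> 0 \<le> D j d \<Longrightarrow> (j, d, D j d) \<in> Z"
  by (simp add: holds_def)

lemma holds_complete: "holds n N Z Y D \<Longrightarrow> (j, d, w) \<in> Y \<Longrightarrow> 0 \<le> D j d \<and> D j d \<le> w"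
  unfolding holds_def by auto

lemma holds_cong:
  assumes "holds n N Z Y D" "in_range n N Y" "\<And>j d. j \<le> n \<Longrightarrow> d < N \<Longrightarrow> D' j d = D j d"
  shows "holds n N Z Y D'"
  unfolding holds_def
proof (intro conjI allI impI)
  show "(j, d, D' j d) \<in> Z" if "j \<le> n" "d < N" "0 \<le> D' j d" for j d
    using holds_sound[OF assms(1) that(1,2)] assms(3)[OF that(1,2)] that(3) by simp
  show "\<forall>(j, d, w)\<in>Y. 0 \<le> D' j d \<and> D' j d \<le> w"
  proof clarify
    fix j d w assume y: "(j, d, w) \<in> Y"
    then show "0 \<le> D' j d \<and> D' j d \<le> w"
      using in_rangeD[OF assms(2) y] assms(3)[of j d] holds_complete[OF assms(1) y] by simp
  qed
qed

text \<open>\<open>Z\<close> controls soundness, as every known entry must be a triple of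
  \<open>Z\<close>; \<open>Y\<close> collects the triples treated so far, each of which the table
  must match or undercut. Lowering an entry to the value of a triple in \<open>Z\<close> respects
  both.\<close>

lemma holds_update:
  assumes "holds n N Z Y D" "(j, d, w) \<in> Z" "0 \<le> w" "D j d < 0 \<or> w < D j d"
    and D': "D' j d = w" "\<And>j' d'. j' \<le> n \<Longrightarrow> d' < N \<Longrightarrow> (j', d') \<noteq> (j, d) \<Longrightarrow> D' j' d' = D j' d'"
    and Y: "in_range n N Y"
  shows "holds n N Z (insert (j, d, w) Y) D'"
  unfolding holds_def
proof (intro conjI allI impI)
  show "(j', d', D' j' d') \<in> Z" if "j' \<le> n" "d' < N" "0 \<le> D' j' d'" for j' d'
  proof (cases "(j', d') = (j, d)")
    case True
    then show ?thesis using assms(2) D'(1) by simp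
  next
    case False
    then show ?thesis using holds_sound[OF assms(1) that(1,2)] D'(2)[OF that(1,2)] that(3) by simp
  qed
  show "\<forall>(j', d', w')\<in>insert (j, d, w) Y. 0 \<le> D' j' d' \<and> D' j' d' \<le> w'"
  proof clarify
    fix j' d' w' assume y: "(j', d', w') \<in> insert (j, d, w) Y"
    show "0 \<le> D' j' d' \<and> D' j' d' \<le> w'"
    proof (cases "(j', d', w') = (j, d, w)")
      case True
      then show ?thesis using D'(1) assms(3) by simp
    next
      case False
      then have y: "(j', d', w') \<in> Y" using y by blast
      note * = holds_complete[OF assms(1) y] in_rangeD[OF Y y]
      show ?thesis
      proof (cases "(j', d') = (j, d)")
        case True
        then have "D j d \<le> w'" "0 \<le> D j d" using * by simp_all
        then show ?thesis using True assms(3,4) D'(1) by simp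
      next
        case False
        then show ?thesis using * D'(2) by simp
      qed
    qed
  qed
qed

lemma holds_insert:
  "holds n N Z Y D \<Longrightarrow> 0 \<le> D j d \<Longrightarrow> D j d \<le> w \<Longrightarrow> holds n N Z (insert (j, d, w) Y) D"
  by (simp add: holds_def)

text \<open>At most one triple per pair of table entries: the program combines the stored minima,
  not all outcomes.\<close>

definition merged :: "nat \<Rightarrow> (nat \<Rightarrow> nat \<Rightarrow> real) \<Rightarrow> (nat \<Rightarrow> nat \<Rightarrow> real) \<Rightarrow>
    nat \<Rightarrow> nat \<Rightarrow> nat \<Rightarrow> nat \<Rightarrow> (nat \<times> nat \<times> real) set" where
  "merged B D1 D2 j1 j2 d1 d2 =
     (if 0 \<le> D1 j1 d1 \<and> 0 \<le> D2 j2 d2 \<and> (d1 \<noteq> 0 \<longrightarrow> digit_sum B d1 + digit_sum B d2 \<le> B)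
      then {(j1 + j2, if d1 = 0 then 0 else d1 + Suc B * d2, D1 j1 d1 + D2 j2 d2 + cross B d1 d2)} else {})"

lemma merged_subset:
  assumes "holds n N X X D1" "holds n N Y Y D2" "j1 \<le> n" "j2 \<le> n" "d1 < N" "d2 < N"
  shows "merged B D1 D2 j1 j2 d1 d2 \<subseteq> merge B X Y"
proof (cases "0 \<le> D1 j1 d1 \<and> 0 \<le> D2 j2 d2 \<and> (d1 \<noteq> 0 \<longrightarrow> digit_sum B d1 + digit_sum B d2 \<le> B)")
  case True
  then have 1: "(j1, d1, D1 j1 d1) \<in> X" "(j2, d2, D2 j2 d2) \<in> Y"
    using holds_sound[OF assms(1)] holds_sound[OF assms(2)] assms(3-6) by simp_all
  have "(j1 + j2, if d1 = 0 then 0 else d1 + Suc B * d2, D1 j1 d1 + D2 j2 d2 + cross B d1 d2) \<in> merge B X Y"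
    by (rule mergeI[OF 1]) (use True in simp)
  then show ?thesis unfolding merged_def by (simp only: if_P[OF True] insert_subset empty_subsetI simp_thms)
qed (simp only: merged_def if_False empty_subsetI)

text \<open>The principle of optimality: for fixed codes the value of a merge is increasing in the
  values of both sides, so combining minima undercuts every combination.\<close>

lemma holds_merge:
  assumes X: "holds n N X X D1" "in_range n N X" and Y: "holds n N Y Y D2" "in_range n N Y"
    and D: "holds n N (merge B X Y) (\<Union>j1\<le>n. \<Union>j2\<le>n. \<Union>d1<N. \<Union>d2<N. merged B D1 D2 j1 j2 d1 d2) D"
  shows "holds n N (merge B X Y) (merge B X Y) D"
  unfolding holds_def
proof (intro conjI allI impI)
  show "(j, d, D j d) \<in> merge B X Y" if "j \<le> n" "d < N" "0 \<le> D j d" for j d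
    by (rule holds_sound[OF D that])
  show "\<forall>(j, d, w)\<in>merge B X Y. 0 \<le> D j d \<and> D j d \<le> w"
  proof clarify
    fix j d w assume "(j, d, w) \<in> merge B X Y"
    then obtain j1 d1 w1 j2 d2 w2 where t: "j = j1 + j2" "d = (if d1 = 0 then 0 else d1 + Suc B * d2)"
      "w = w1 + w2 + cross B d1 d2" and m: "(j1, d1, w1) \<in> X" "(j2, d2, w2) \<in> Y"
      "d1 \<noteq> 0 \<longrightarrow> digit_sum B d1 + digit_sum B d2 \<le> B"
      unfolding merge_def by blast
    have le: "0 \<le> D1 j1 d1" "D1 j1 d1 \<le> w1" "0 \<le> D2 j2 d2" "D2 j2 d2 \<le> w2"
      using holds_complete[OF X(1) m(1)] holds_complete[OF Y(1) m(2)] by auto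
    have r: "j1 \<in> {..n}" "d1 \<in> {..<N}" "j2 \<in> {..n}" "d2 \<in> {..<N}"
      using in_rangeD[OF X(2) m(1)] in_rangeD[OF Y(2) m(2)] by auto
    have "(j, d, D1 j1 d1 + D2 j2 d2 + cross B d1 d2) \<in> merged B D1 D2 j1 j2 d1 d2"
      using le m(3) by (simp add: merged_def t(1,2))
    then have "(j, d, D1 j1 d1 + D2 j2 d2 + cross B d1 d2)
        \<in> (\<Union>j1\<le>n. \<Union>j2\<le>n. \<Union>d1<N. \<Union>d2<N. merged B D1 D2 j1 j2 d1 d2)"
      by (intro UN_I[OF r(1)] UN_I[OF r(3)] UN_I[OF r(2)] UN_I[OF r(4)])
    from holds_complete[OF D this] show "0 \<le> D j d \<and> D j d \<le> w" using le t(3) by simp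
  qed
qed

section \<open>Merging two tables\<close>

definition merge_env :: "nat \<Rightarrow> nat \<Rightarrow> nat \<Rightarrow> nat \<Rightarrow> nat \<Rightarrow> arrays \<Rightarrow> nenv \<Rightarrow> arrays \<Rightarrow> bool" where
  "merge_env n B N p c \<alpha> \<nu> \<alpha>' \<longleftrightarrow> \<nu> VB = B \<and> \<nu> Vb = Suc B \<and> \<nu> VN = N \<and> \<nu> Vn1 = Suc n \<and>
     \<nu> Vrow = Suc n * N \<and> \<nu> Vp = p \<and> \<nu> Vc = c \<and> \<alpha>' Tab = \<alpha> Tab \<and>
     (\<forall>d<N. \<forall>i<B. \<alpha>' Dig (d * B + i) = real (digit B d i))"

lemma wp_cross_loop:
  assumes env: "merge_env n B N p c \<alpha>0 \<nu> \<alpha>" "B \<le> W" and d: "\<nu> Vc1 = d1" "\<nu> Vc2 = d2" "d1 < N" "d2 < N"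
    and post: "\<And>\<nu>' \<rho>' \<alpha>'. frame cross_loop \<nu> \<rho> \<alpha> \<nu>' \<rho>' \<alpha>' \<Longrightarrow> \<rho>' Rx = cross B d1 d2 \<Longrightarrow>
      \<nu>' Vs = digit_sum B d1 + digit_sum B d2 \<Longrightarrow> Q \<nu>' \<rho>' \<alpha>'"
  shows "wp W cross_loop Q \<nu> \<rho> \<alpha>"
proof -
  let ?a = "digit B d1" and ?b = "digit B d2"
  have VB: "\<nu> VB = B" and Dig: "\<And>i. i < B \<Longrightarrow> \<alpha> Dig (d1 * B + i) = real (?a i)"
    "\<And>i. i < B \<Longrightarrow> \<alpha> Dig (d2 * B + i) = real (?b i)"
    using env d by (simp_all add: merge_env_def)
  let ?F = "frame cross_loop \<nu> \<rho> \<alpha>"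
  show ?thesis
    unfolding cross_loop_def
  proof (simp, rule wp_For[where N = B and I = "\<lambda>i \<nu>' \<rho>' \<alpha>'. ?F \<nu>' \<rho>' \<alpha>' \<and> \<nu>' Vs = (\<Sum>k<i. ?a k) + (\<Sum>k<i. ?b k) \<and>
      \<rho>' Rx = (\<Sum>i'<i. \<Sum>j<B. real (?a i') * real (?b j) / real (i' + j + 1))"], goal_cases)
    case (7 i \<nu>1 \<rho>1 \<alpha>1)
    then have 1: "\<nu>1 Vc1 = d1" "\<nu>1 Vc2 = d2" "\<nu>1 VB = B" "\<alpha>1 = \<alpha>"
      using d VB by (auto simp: frame_def cross_loop_def)
    show ?case
    proof (simp add: 1 7(2) Dig 7(1), rule wp_For[where N = B and I = "\<lambda>j \<nu>' \<rho>' \<alpha>'. ?F \<nu>' \<rho>' \<alpha>' \<and> \<nu>' Vs1 = i \<and>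
        \<nu>' Vs = (\<Sum>k<Suc i. ?a k) + (\<Sum>k<Suc i. ?b k) \<and>
        \<rho>' Rx = (\<Sum>i'<i. \<Sum>j<B. real (?a i') * real (?b j) / real (i' + j + 1)) +
          (\<Sum>j'<j. real (?a i) * real (?b j') / real (i + j' + 1))"], goal_cases)
      case 6
      then show ?case using 7 by (simp add: frame_def cross_loop_def)
    next
      case (7 j \<nu>2 \<rho>2 \<alpha>2)
      then have 2: "\<nu>2 Vc1 = d1" "\<nu>2 Vc2 = d2" "\<nu>2 VB = B" "\<alpha>2 = \<alpha>" "\<nu>2 Vs1 = i"
        using d VB by (auto simp: frame_def cross_loop_def)
      show ?case using 7(4)
        by (simp add: 2 7(1,2) Dig \<open>i < B\<close>) (simp add: frame_def cross_loop_def add.assoc)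
    next
      case (8 \<nu>2 \<rho>2 \<alpha>2)
      then show ?case by (simp add: frame_def cross_loop_def)
    qed (use 1 env(2) in simp_all)
  next
    case (8 \<nu>1 \<rho>1 \<alpha>1)
    then show ?case by (intro post) (simp_all add: cross_def digit_sum_def)
  qed (use VB env(2) in \<open>simp_all add: frame_def cross_loop_def\<close>)
qed

lemma merge_env_frame:
  assumes "merge_env n B N p c \<alpha>0 \<nu> \<alpha>" "\<And>x. x \<in> {VB, Vb, VN, Vn1, Vrow, Vp, Vc} \<Longrightarrow> \<nu>' x = \<nu> x"
    "\<alpha>' Dig = \<alpha> Dig" "\<alpha>' Tab = \<alpha> Tab"
  shows "merge_env n B N p c \<alpha>0 \<nu>' \<alpha>'"
  using assms by (simp add: merge_env_def)

lemma merge_entry_frame: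
  assumes "merge_env n B N p c \<alpha>0 \<nu> \<alpha>" "frame merge_entry \<nu> \<rho> \<alpha> \<nu>' \<rho>' \<alpha>'"
  shows "merge_env n B N p c \<alpha>0 \<nu>' \<alpha>'"
  by (rule merge_env_frame[OF assms(1)]) (use assms(2) in \<open>auto simp: frame_def merge_entry_def cross_loop_def store_entry_def\<close>)

definition new_table :: "nat \<Rightarrow> arrays \<Rightarrow> nat \<Rightarrow> nat \<Rightarrow> real" where
  "new_table N \<alpha> j d = \<alpha> New (j * N + d)"

definition merge_inv :: "nat \<Rightarrow> nat \<Rightarrow> nat \<Rightarrow> nat \<Rightarrow> nat \<Rightarrow> arrays \<Rightarrow> (nat \<times> nat \<times> real) set \<Rightarrow>
    (nat \<times> nat \<times> real) set \<Rightarrow> nenv \<Rightarrow> arrays \<Rightarrow> bool" where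
  "merge_inv n B N p c \<alpha>0 Z Y \<nu> \<alpha> \<longleftrightarrow>
     merge_env n B N p c \<alpha>0 \<nu> \<alpha> \<and> Y \<subseteq> Z \<and> holds n N Z Y (new_table N \<alpha>)"

context
  fixes n B N p c W :: nat and \<alpha>0 :: arrays and D1 D2 :: "nat \<Rightarrow> nat \<Rightarrow> real" and Z
  assumes D1: "D1 = (\<lambda>j d. \<alpha>0 Tab (p * (Suc n * N) + (j * N + d)))"
    and D2: "D2 = (\<lambda>j d. \<alpha>0 Tab (c * (Suc n * N) + (j * N + d)))"
    and Z: "in_range n N Z" "\<And>j1 j2 d1 d2. j1 \<le> n \<Longrightarrow> j2 \<le> n \<Longrightarrow> d1 < N \<Longrightarrow> d2 < N \<Longrightarrow>
      merged B D1 D2 j1 j2 d1 d2 \<subseteq> Z"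
    and W: "B \<le> W" "N \<le> W" "Suc n \<le> W"
begin

abbreviation minv where "minv \<equiv> merge_inv n B N p c \<alpha>0 Z"

lemma merge_inv_upd: "x \<notin> {VB, Vb, VN, Vn1, Vrow, Vp, Vc} \<Longrightarrow> minv Y (\<nu>(x := v)) \<alpha> \<longleftrightarrow> minv Y \<nu> \<alpha>"
  by (auto simp: merge_inv_def merge_env_def)

lemma wp_merge_entry:
  assumes inv: "minv Y \<nu> \<alpha>" and j: "\<nu> Vj1 = j1" "\<nu> Vj2 = j2" "j1 \<le> n" "j2 \<le> n"
    and d: "\<nu> Vc1 = d1" "\<nu> Vc2 = d2" "d1 < N" "d2 < N"
  shows "wp W merge_entry (\<lambda>\<nu>' \<rho>' \<alpha>'. minv (Y \<union> merged B D1 D2 j1 j2 d1 d2) \<nu>' \<alpha>') \<nu> \<rho> \<alpha>"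
proof -
  let ?Q = "\<lambda>\<nu>' (\<rho>'::renv) \<alpha>'. Y \<union> merged B D1 D2 j1 j2 d1 d2 \<subseteq> Z \<and>
    holds n N Z (Y \<union> merged B D1 D2 j1 j2 d1 d2) (new_table N \<alpha>')"
  have env: "merge_env n B N p c \<alpha>0 \<nu> \<alpha>" and YZ: "Y \<subseteq> Z" and H: "holds n N Z Y (new_table N \<alpha>)"
    using inv by (simp_all add: merge_inv_def)
  have V: "\<nu> VB = B" "\<nu> Vb = Suc B" "\<nu> VN = N" "\<nu> Vrow = Suc n * N" "\<nu> Vp = p" "\<nu> Vc = c"
    and T: "\<alpha> Tab (p * (Suc n * N) + (j1 * N + d1)) = D1 j1 d1" "\<alpha> Tab (c * (Suc n * N) + (j2 * N + d2)) = D2 j2 d2"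
    using env by (simp_all add: merge_env_def D1 D2)
  have sub: "merged B D1 D2 j1 j2 d1 d2 \<subseteq> Z" by (rule Z(2)) fact+
  let ?d = "if d1 = 0 then 0 else d1 + Suc B * d2" and ?w = "D1 j1 d1 + D2 j2 d2 + cross B d1 d2"
  let ?t = "(j1 + j2, ?d, ?w)" and ?idx = "(j1 + j2) * N + ?d"
  \<comment> \<open>Membership in \<open>Z\<close> puts the column of the triple below
    \<open>N\<close>, so no other entry of the table shares its cell.\<close>
  have store: "holds n N Z (insert ?t Y) (new_table N (\<alpha>(New := (\<alpha> New)(?idx := ?w))))"
    if t: "?t \<in> Z" and less: "\<alpha> New ?idx < 0 \<or> ?w < \<alpha> New ?idx"
  proof (rule holds_update[OF H t])
    have r: "?d < N" "0 \<le> ?w" using in_rangeD[OF Z(1) t] by auto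
    show "0 \<le> ?w" by fact
    show "new_table N \<alpha> (j1 + j2) ?d < 0 \<or> ?w < new_table N \<alpha> (j1 + j2) ?d"
      using less unfolding new_table_def .
    show "new_table N (\<alpha>(New := (\<alpha> New)(?idx := ?w))) (j1 + j2) ?d = ?w"
      unfolding new_table_def by (simp only: fun_upd_same)
    show "new_table N (\<alpha>(New := (\<alpha> New)(?idx := ?w))) j' d' = new_table N \<alpha> j' d'"
      if "j' \<le> n" "d' < N" "(j', d') \<noteq> (j1 + j2, ?d)" for j' d'
    proof -
      have "j' * N + d' \<noteq> ?idx" using index_eq_iff[OF that(2) r(1), of j' "j1 + j2"] that(3) by blast
      then show ?thesis unfolding new_table_def by (simp only: fun_upd_same fun_upd_other not_False_eq_True)
    qed
    show "in_range n N Y" using Z(1) YZ unfolding in_range_def by blast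
  qed
  have "wp W merge_entry ?Q \<nu> \<rho> \<alpha>"
  proof (cases "0 \<le> D1 j1 d1 \<and> 0 \<le> D2 j2 d2")
    case False
    then have "merged B D1 D2 j1 j2 d1 d2 = {}" by (auto simp: merged_def)
    then show ?thesis using False YZ H by (auto simp: merge_entry_def V d j T simp del: mult_Suc)
  next
    case True
    have "wp W cross_loop (\<lambda>\<nu>' \<rho>' \<alpha>'. frame cross_loop \<nu> (\<rho>(Rw1 := D1 j1 d1, Rw2 := D2 j2 d2)) \<alpha> \<nu>' \<rho>' \<alpha>' \<and>
        \<rho>' Rx = cross B d1 d2 \<and> \<nu>' Vs = digit_sum B d1 + digit_sum B d2) \<nu> (\<rho>(Rw1 := D1 j1 d1, Rw2 := D2 j2 d2)) \<alpha>"
      by (rule wp_cross_loop[where n = n and B = B and N = N and p = p and c = c and ?\<alpha>0.0 = \<alpha>0 and ?d1.0 = d1 and ?d2.0 = d2])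
         (use env d W in simp_all)
    then have "wp W cross_loop (wp W store_entry ?Q) \<nu> (\<rho>(Rw1 := D1 j1 d1, Rw2 := D2 j2 d2)) \<alpha>"
    proof (rule wp_conseq, goal_cases)
      case (1 \<nu>1 \<rho>1 \<alpha>1)
      then have 1: "\<alpha>1 = \<alpha>" "\<rho>1 Rw1 = D1 j1 d1" "\<rho>1 Rw2 = D2 j2 d2" "\<rho>1 Rx = cross B d1 d2"
        "\<nu>1 Vs = digit_sum B d1 + digit_sum B d2" "\<nu>1 Vc1 = d1" "\<nu>1 Vc2 = d2" "\<nu>1 Vj1 = j1" "\<nu>1 Vj2 = j2"
        "\<nu>1 VB = B" "\<nu>1 Vb = Suc B" "\<nu>1 VN = N"
        using V d j by (auto simp: frame_def cross_loop_def)
      show ?case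
      proof (cases "d1 \<noteq> 0 \<longrightarrow> digit_sum B d1 + digit_sum B d2 \<le> B")
        case False
        then have "merged B D1 D2 j1 j2 d1 d2 = {}" by (auto simp: merged_def)
        then show ?thesis using False YZ H by (simp add: 1 store_entry_def)
      next
        case t: True
        then have m: "merged B D1 D2 j1 j2 d1 d2 = {?t}" using True t by (simp add: merged_def)
        then have tZ: "?t \<in> Z" using sub by simp
        have Y': "Y \<union> merged B D1 D2 j1 j2 d1 d2 = insert ?t Y" unfolding m by simp
        have keep: "holds n N Z (insert ?t Y) (new_table N \<alpha>)" if "\<not> \<alpha> New ?idx < 0" "\<not> ?w < \<alpha> New ?idx"
          by (rule holds_insert[OF H]) (use that in \<open>simp_all only: new_table_def not_less\<close>)
        have tY: "insert ?t Y \<subseteq> Z" using tZ YZ by simp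
        show ?thesis
        proof (cases "d1 = 0")
          case True
          then show ?thesis unfolding Y' using tY keep store[OF tZ] by (simp add: 1 store_entry_def)
        next
          case False
          then show ?thesis unfolding Y' using t tY keep store[OF tZ] by (simp add: 1 store_entry_def)
        qed
      qed
    qed
    then show ?thesis using True unfolding merge_entry_def by (simp add: V d j T del: mult_Suc)
  qed
  then show ?thesis
    by (rule wp_conseq) (auto simp: merge_inv_def intro: merge_entry_frame[OF env])
qed

text \<open>This and the next three lemmas deal with one loop each, from the inside out; the set of
  treated triples grows by a union over the loop variable.\<close>

lemma wp_merge_c2:
  assumes inv: "minv Y \<nu> \<alpha>" and j: "\<nu> Vj1 = j1" "\<nu> Vj2 = j2" "j1 \<le> n" "j2 \<le> n"
    and d: "\<nu> Vc1 = d1" "d1 < N"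
  shows "wp W (For Vc2 VN merge_entry)
    (\<lambda>\<nu>' \<rho>' \<alpha>'. minv (Y \<union> (\<Union>d2<N. merged B D1 D2 j1 j2 d1 d2)) \<nu>' \<alpha>') \<nu> \<rho> \<alpha>"
proof (rule wp_For[where N = N and I = "\<lambda>i \<nu>' \<rho>' \<alpha>'. minv (Y \<union> (\<Union>d2<i. merged B D1 D2 j1 j2 d1 d2)) \<nu>' \<alpha>'"], goal_cases)
  case (7 i \<nu>1 \<rho>1 \<alpha>1)
  have 1: "\<nu>1 Vj1 = j1" "\<nu>1 Vj2 = j2" "\<nu>1 Vc1 = d1"
    using 7(3) j d by (simp_all add: frame_def merge_entry_def cross_loop_def store_entry_def)
  show ?case
    by (rule wp_conseq[OF wp_merge_entry[OF 7(4) 1(1,2) j(3,4) 1(3) 7(2) d(2) 7(1)]])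
       (simp add: merge_inv_upd lessThan_Suc Un_ac)
qed (use inv W in \<open>simp_all add: merge_inv_upd merge_entry_def cross_loop_def store_entry_def merge_inv_def merge_env_def\<close>)

lemma wp_merge_c1:
  assumes inv: "minv Y \<nu> \<alpha>" and j: "\<nu> Vj1 = j1" "\<nu> Vj2 = j2" "j1 \<le> n" "j2 \<le> n"
  shows "wp W (For Vc1 VN (For Vc2 VN merge_entry))
    (\<lambda>\<nu>' \<rho>' \<alpha>'. minv (Y \<union> (\<Union>d1<N. \<Union>d2<N. merged B D1 D2 j1 j2 d1 d2)) \<nu>' \<alpha>') \<nu> \<rho> \<alpha>"
proof (rule wp_For[where N = N and I = "\<lambda>i \<nu>' \<rho>' \<alpha>'. minv (Y \<union> (\<Union>d1<i. \<Union>d2<N. merged B D1 D2 j1 j2 d1 d2)) \<nu>' \<alpha>'"], goal_cases)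
  case (7 i \<nu>1 \<rho>1 \<alpha>1)
  have 1: "\<nu>1 Vj1 = j1" "\<nu>1 Vj2 = j2"
    using 7(3) j by (simp_all add: frame_def merge_entry_def cross_loop_def store_entry_def)
  show ?case
    by (rule wp_conseq[OF wp_merge_c2[OF 7(4) 1 j(3,4) 7(2,1)]])
       (simp add: merge_inv_upd lessThan_Suc Un_ac)
qed (use inv W in \<open>simp_all add: merge_inv_upd merge_entry_def cross_loop_def store_entry_def merge_inv_def merge_env_def\<close>)

lemma wp_merge_j2:
  assumes inv: "minv Y \<nu> \<alpha>" and j: "\<nu> Vj1 = j1" "j1 \<le> n"
  shows "wp W (For Vj2 Vn1 (For Vc1 VN (For Vc2 VN merge_entry)))
    (\<lambda>\<nu>' \<rho>' \<alpha>'. minv (Y \<union> (\<Union>j2<Suc n. \<Union>d1<N. \<Union>d2<N. merged B D1 D2 j1 j2 d1 d2)) \<nu>' \<alpha>') \<nu> \<rho> \<alpha>"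
proof (rule wp_For[where N = "Suc n" and I = "\<lambda>i \<nu>' \<rho>' \<alpha>'. minv (Y \<union> (\<Union>j2<i. \<Union>d1<N. \<Union>d2<N. merged B D1 D2 j1 j2 d1 d2)) \<nu>' \<alpha>'"], goal_cases)
  case (7 i \<nu>1 \<rho>1 \<alpha>1)
  have 1: "\<nu>1 Vj1 = j1" "i \<le> n"
    using 7(1,3) j by (simp_all add: frame_def merge_entry_def cross_loop_def store_entry_def)
  show ?case
    by (rule wp_conseq[OF wp_merge_c1[OF 7(4) 1(1) 7(2) j(2) 1(2)]])
       (simp add: merge_inv_upd lessThan_Suc Un_ac)
qed (use inv W in \<open>simp_all add: merge_inv_upd merge_entry_def cross_loop_def store_entry_def merge_inv_def merge_env_def\<close>)

lemma wp_merge_j1: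
  assumes inv: "minv Y \<nu> \<alpha>"
  shows "wp W (For Vj1 Vn1 (For Vj2 Vn1 (For Vc1 VN (For Vc2 VN merge_entry))))
    (\<lambda>\<nu>' \<rho>' \<alpha>'. minv (Y \<union> (\<Union>j1<Suc n. \<Union>j2<Suc n. \<Union>d1<N. \<Union>d2<N. merged B D1 D2 j1 j2 d1 d2)) \<nu>' \<alpha>') \<nu> \<rho> \<alpha>"
proof (rule wp_For[where N = "Suc n" and I = "\<lambda>i \<nu>' \<rho>' \<alpha>'. minv (Y \<union> (\<Union>j1<i. \<Union>j2<Suc n. \<Union>d1<N. \<Union>d2<N. merged B D1 D2 j1 j2 d1 d2)) \<nu>' \<alpha>'"], goal_cases)
  case (7 i \<nu>1 \<rho>1 \<alpha>1)
  have 1: "i \<le> n" using 7(1) by simp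
  show ?case
    by (rule wp_conseq[OF wp_merge_j2[OF 7(4,2) 1]])
       (simp add: merge_inv_upd lessThan_Suc Un_ac)
qed (use inv W in \<open>simp_all add: merge_inv_upd merge_entry_def cross_loop_def store_entry_def merge_inv_def merge_env_def\<close>)

end

definition table :: "nat \<Rightarrow> nat \<Rightarrow> arrays \<Rightarrow> nat \<Rightarrow> nat \<Rightarrow> nat \<Rightarrow> real" where
  "table n N \<alpha> v j d = \<alpha> Tab (v * (Suc n * N) + (j * N + d))"

lemma row_index: "j \<le> n \<Longrightarrow> d < N \<Longrightarrow> j * N + d < Suc n * N"
proof -
  assume "j \<le> n" "d < N"
  then have "j * N + d < j * N + N" by simp
  also have "\<dots> = Suc j * N" by simp
  also have "\<dots> \<le> Suc n * N" using \<open>j \<le> n\<close> by (intro mult_le_mono1) simp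
  finally show ?thesis .
qed

lemma wp_merge_tables:
  assumes V: "\<nu> VB = B" "\<nu> Vb = Suc B" "\<nu> VN = N" "\<nu> Vn1 = Suc n" "\<nu> Vrow = Suc n * N" "\<nu> Vp = p" "\<nu> Vc = c"
    and Dig: "\<And>d i. d < N \<Longrightarrow> i < B \<Longrightarrow> \<alpha> Dig (d * B + i) = real (digit B d i)"
    and W: "B \<le> W" "Suc n * N \<le> W" "0 < N"
    and X: "holds n N X X (table n N \<alpha> p)" "in_range n N X" and Y: "holds n N Y Y (table n N \<alpha> c)" "in_range n N Y"
    and Z: "in_range n N (merge B X Y)"
    and post: "\<And>\<nu>' \<rho>' \<alpha>'. frame merge_tables \<nu> \<rho> \<alpha> \<nu>' \<rho>' \<alpha>' \<Longrightarrow>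
      holds n N (merge B X Y) (merge B X Y) (table n N \<alpha>' p) \<Longrightarrow>
      (\<And>v j d. v \<noteq> p \<Longrightarrow> j \<le> n \<Longrightarrow> d < N \<Longrightarrow> table n N \<alpha>' v j d = table n N \<alpha> v j d) \<Longrightarrow> Q \<nu>' \<rho>' \<alpha>'"
  shows "wp W merge_tables Q \<nu> \<rho> \<alpha>"
proof -
  let ?row = "Suc n * N" and ?Z = "merge B X Y"
  have W': "N \<le> W" "Suc n \<le> W"
    using W(2,3) mult_le_mono2[of 1 N "Suc n"] by auto
  have sub: "merged B (table n N \<alpha> p) (table n N \<alpha> c) j1 j2 d1 d2 \<subseteq> ?Z" if "j1 \<le> n" "j2 \<le> n" "d1 < N" "d2 < N" for j1 j2 d1 d2
    by (rule merged_subset[OF X(1) Y(1) that])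
  note loops = wp_merge_j1[where n = n and B = B and N = N and p = p and c = c and W = W and ?\<alpha>0.0 = \<alpha>
      and ?D1.0 = "table n N \<alpha> p" and ?D2.0 = "table n N \<alpha> c" and Z = ?Z]
  note mi = merge_inv_def[where n = n and B = B and N = N and p = p and c = c and ?\<alpha>0.0 = \<alpha>
      and Z = ?Z]
  show ?thesis
    unfolding merge_tables_def
  proof (simp only: wp.simps(5), rule wp_For[where N = ?row and I = "\<lambda>i \<nu>' \<rho>' \<alpha>'. \<forall>t<i. \<alpha>' New t = -1"], goal_cases)
    case (7 i \<nu>1 \<rho>1 \<alpha>1)
    then show ?case by (simp add: less_Suc_eq)
  next
    case (8 \<nu>1 \<rho>1 \<alpha>1)
    note F = 8(2)
    \<comment> \<open>With all entries negative nothing is known and no triple has been treated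
      yet.\<close>
    have "holds n N ?Z {} (\<lambda>j d. \<alpha>1 New (j * N + d))"
      using 8(3) row_index by (simp add: holds_def)
    then have env: "holds n N ?Z {} (new_table N \<alpha>1) \<and> merge_env n B N p c \<alpha> \<nu>1 \<alpha>1"
      using 8(2) V Dig by (simp add: frame_def merge_env_def new_table_def[abs_def])
    show ?case
    proof (rule wp_conseq[OF loops[where Y = "{}"]], goal_cases)
      case 8
      then show ?case using env by (simp add: mi)
    next
      case (9 \<nu>2 \<rho>2 \<alpha>2)
      have F2: "\<alpha>2 Tab = \<alpha> Tab" "\<nu>2 Vp = p" "\<nu>2 Vrow = ?row" and
        H2: "holds n N ?Z (\<Union>j1\<le>n. \<Union>j2\<le>n. \<Union>d1<N. \<Union>d2<N. merged B (table n N \<alpha> p) (table n N \<alpha> c) j1 j2 d1 d2) (new_table N \<alpha>2)"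
        using 9(1) by (simp_all only: mi merge_env_def lessThan_Suc_atMost Un_empty_left)
      have H: "holds n N ?Z ?Z (new_table N \<alpha>2)" by (rule holds_merge[OF X Y H2])
      show ?case
      proof (rule wp_For[where N = ?row and I = "\<lambda>i \<nu>' \<rho>' \<alpha>'. \<forall>t. \<alpha>' Tab t =
          (if \<exists>s<i. t = p * ?row + s then \<alpha>2 New (t - p * ?row) else \<alpha> Tab t)"], goal_cases)
        case (7 i \<nu>3 \<rho>3 \<alpha>3)
        then have F3: "\<nu>3 Vp = p" "\<nu>3 Vrow = ?row" "\<alpha>3 New = \<alpha>2 New" using F2 by (simp_all add: frame_def)
        show ?case using 7(2,4) by (auto simp: F3 less_Suc_eq)
      next
        case (8 \<nu>3 \<rho>3 \<alpha>3)
        have T: "\<alpha>3 Tab t = (if \<exists>s<?row. t = p * ?row + s then \<alpha>2 New (t - p * ?row) else \<alpha> Tab t)" for t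
          using 8(3) by blast
        show ?case
        proof (rule post)
          show "frame merge_tables \<nu> \<rho> \<alpha> \<nu>3 \<rho>3 \<alpha>3"
            using 8(2) 9(2) F
            unfolding frame_def merge_tables_def by simp
          show "holds n N ?Z ?Z (table n N \<alpha>3 p)"
          proof (rule holds_cong[OF H Z])
            fix j d assume jd: "j \<le> n" "d < N"
            then have "\<exists>s<?row. p * ?row + (j * N + d) = p * ?row + s" using row_index[OF jd] by blast
            then show "table n N \<alpha>3 p j d = new_table N \<alpha>2 j d"
              unfolding table_def new_table_def T by (simp only: if_True add_diff_cancel_left')
          qed
          fix v j d assume v: "v \<noteq> p" and jd: "j \<le> n" "d < N"
          have "\<not> (\<exists>s<?row. v * ?row + (j * N + d) = p * ?row + s)"
            using index_eq_iff[OF row_index[OF jd]] v by blast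
          then show "table n N \<alpha>3 v j d = table n N \<alpha> v j d"
            unfolding table_def T by (simp only: if_False)
        qed
      qed (use F2 W in simp_all)
    qed (use Z sub W W' in \<open>simp_all add: table_def[abs_def] del: mult_Suc\<close>)
  qed (use V W in simp_all)
qed

lemma wp_init_tables:
  assumes V: "\<nu> Vn = n" "\<nu> VN = N" and W: "n * (Suc n * N) \<le> W" "n \<le> W" and n: "1 \<le> n" "2 \<le> N"
    and post: "\<And>\<nu>' \<rho>' \<alpha>'. frame init_tables \<nu> \<rho> \<alpha> \<nu>' \<rho>' \<alpha>' \<Longrightarrow> \<nu>' Vn1 = Suc n \<Longrightarrow> \<nu>' Vrow = Suc n * N \<Longrightarrow>
      (\<And>v. v < n \<Longrightarrow> holds n N {(0, 1, 0), (1, 0, 0)} {(0, 1, 0), (1, 0, 0)} (table n N \<alpha>' v)) \<Longrightarrow> Q \<nu>' \<rho>' \<alpha>'"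
  shows "wp W init_tables Q \<nu> \<rho> \<alpha>"
proof -
  let ?row = "Suc n * N"
  have e: "(n + 1) * N = ?row" by simp
  show ?thesis
    unfolding init_tables_def
  proof (simp add: V del: mult_Suc, rule wp_For[where N = "n * ?row" and I = "\<lambda>i \<nu>' \<rho>' \<alpha>'. \<forall>t<i. \<alpha>' Tab t = -1"], goal_cases)
    case (7 i \<nu>1 \<rho>1 \<alpha>1)
    then show ?case by (simp add: less_Suc_eq)
  next
    case (8 \<nu>1 \<rho>1 \<alpha>1)
    note F = 8(2)
    have F1: "\<nu>1 Vrow = ?row" "\<nu>1 VN = N" "\<nu>1 Vn = n" "\<nu>1 Vn1 = Suc n"
      using 8(2) V by (simp_all add: frame_def del: mult_Suc)
    \<comment> \<open>Offset 1 is entry \<open>(0, 1)\<close> and offset \<open>N\<close> is entry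
      \<open>(1, 0)\<close>; they differ because \<open>N \<ge> 2\<close>.\<close>
    let ?init = "\<lambda>s. if s = 1 \<or> s = N then 0 else -1 :: real"
    show ?case
    proof (rule wp_For[where N = n and I = "\<lambda>i \<nu>' \<rho>' \<alpha>'. \<forall>v<n. \<forall>s<?row. \<alpha>' Tab (v * ?row + s) = (if v < i then ?init s else -1)"], goal_cases)
      case 6
      have "v * ?row + s < n * ?row" if "v < n" "s < ?row" for v s
      proof -
        have "v * ?row + s < Suc v * ?row" using that by simp
        also have "\<dots> \<le> n * ?row" using that by (intro mult_le_mono1) simp
        finally show ?thesis .
      qed
      then show ?case using 8(3) by (simp del: mult_Suc)
    next
      case (7 i \<nu>2 \<rho>2 \<alpha>2)
      then have F2: "\<nu>2 Vrow = ?row" "\<nu>2 VN = N" using F1 by (simp_all add: frame_def del: mult_Suc)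
      have r: "1 < ?row" "N < ?row" using n by (simp_all add: less_Suc_eq_le)
      have "((\<alpha>2 Tab)(i * ?row + 1 := 0, i * ?row + N := 0)) (v * ?row + s) = (if v < Suc i then ?init s else -1)"
        if "v < n" "s < ?row" for v s
      proof -
        have "v * ?row + s = i * ?row + 1 \<longleftrightarrow> v = i \<and> s = 1" "v * ?row + s = i * ?row + N \<longleftrightarrow> v = i \<and> s = N"
          by (rule index_eq_iff[OF that(2) r(1)], rule index_eq_iff[OF that(2) r(2)])
        moreover have "\<alpha>2 Tab (v * ?row + s) = (if v < i then ?init s else -1)" using 7(4) that by blast
        ultimately show ?thesis by (auto simp del: mult_Suc)
      qed
      then have "\<forall>v<n. \<forall>s<?row. ((\<alpha>2 Tab)(i * ?row + 1 := 0, i * ?row + N := 0)) (v * ?row + s) =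
          (if v < Suc i then ?init s else -1)" by blast
      then show ?case
        by (simp add: F2 7(2) del: mult_Suc fun_upd_apply add: fun_upd_same split del: if_split)
    next
      case (8 \<nu>2 \<rho>2 \<alpha>2)
      show ?case
      proof (rule post)
        show "frame init_tables \<nu> \<rho> \<alpha> \<nu>2 \<rho>2 \<alpha>2"
          using 8(2) F unfolding frame_def init_tables_def by simp
        show "\<nu>2 Vn1 = Suc n" "\<nu>2 Vrow = ?row" using 8(2) F1 by (simp_all add: frame_def)
        fix v assume v: "v < n"
        have T: "table n N \<alpha>2 v j d = ?init (j * N + d)" if "j \<le> n" "d < N" for j d
          using 8(3) v row_index[OF that] by (simp add: table_def del: mult_Suc)
        have i1: "j * N + d = 1 \<longleftrightarrow> j = 0 \<and> d = 1" if "d < N" for j d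
          using index_eq_iff[OF that, of 1 j 0] n by simp
        have iN: "j * N + d = N \<longleftrightarrow> j = 1 \<and> d = 0" if "d < N" for j d
          using index_eq_iff[OF that, of 0 j 1] n by simp
        have T01: "table n N \<alpha>2 v 0 1 = 0" "table n N \<alpha>2 v 1 0 = 0" using T[of 0 1] T[of 1 0] n by simp_all
        show "holds n N {(0, 1, 0), (1, 0, 0)} {(0, 1, 0), (1, 0, 0)} (table n N \<alpha>2 v)"
          unfolding holds_def
        proof (intro conjI allI impI)
          fix j d assume a: "j \<le> n" "d < N" "0 \<le> table n N \<alpha>2 v j d"
          then have "j * N + d = 1 \<or> j * N + d = N" using T[OF a(1,2)] by (auto split: if_splits)
          then have "j = 0 \<and> d = 1 \<or> j = 1 \<and> d = 0" using i1[OF a(2)] iN[OF a(2)] by blast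
          then show "(j, d, table n N \<alpha>2 v j d) \<in> {(0, 1, 0), (1, 0, 0)}" using T01 by auto
        qed (use T01 in simp)
      qed
    qed (use F1 W in simp_all)
  qed (use W V in \<open>simp_all del: mult_Suc\<close>)
qed

lemma wp_contract_all:
  assumes T: "grown_tree T P C m" and m: "\<nu> Vm = m" "m < n" "n \<le> W"
    and order: "\<And>r. r < m \<Longrightarrow> \<alpha> Par r = real (P r)" "\<And>r. r < m \<Longrightarrow> \<alpha> Chi r = real (C r)"
    and V: "\<nu> VB = B" "\<nu> Vb = Suc B" "\<nu> VN = N" "\<nu> Vn1 = Suc n" "\<nu> Vrow = Suc n * N"
    and Dig: "\<And>d i. d < N \<Longrightarrow> i < B \<Longrightarrow> \<alpha> Dig (d * B + i) = real (digit B d i)"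
    and W: "B \<le> W" "Suc n * N \<le> W" and N: "N = Suc B ^ B" and B: "1 \<le> B"
    and init: "\<And>v. v \<in> verts T \<Longrightarrow> holds n N {(0, 1, 0), (1, 0, 0)} {(0, 1, 0), (1, 0, 0)} (table n N \<alpha> v)"
    and post: "\<And>\<nu>' \<rho>' \<alpha>'. frame contract_all \<nu> \<rho> \<alpha> \<nu>' \<rho>' \<alpha>' \<Longrightarrow>
      holds n N (outcomes B T 0) (outcomes B T 0) (table n N \<alpha>' 0) \<Longrightarrow> Q \<nu>' \<rho>' \<alpha>'"
  shows "wp W contract_all Q \<nu> \<rho> \<alpha>"
proof -
  interpret grown_tree T P C m by (rule T)
  let ?O = "\<lambda>r v. outcomes B (cluster r v) v"
  have range: "in_range n N (?O r v)" if "r \<le> m" "v \<in> roots r" for r v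
    unfolding in_range_def
  proof clarify
    fix j d w assume o: "(j, d, w) \<in> ?O r v"
    have "finite (verts (cluster r v))" using cluster_simple[OF that] by (simp add: simple_graph_def)
    from outcomes_range[OF this o] show "j \<le> n \<and> d < N \<and> 0 \<le> w"
      using card_cluster_le[OF that] m(2) unfolding N by linarith
  qed
  show ?thesis
    unfolding contract_all_def
  proof (rule wp_For[where N = m and I = "\<lambda>r \<nu>' \<rho>' \<alpha>'. \<forall>v\<in>roots r. holds n N (?O r v) (?O r v) (table n N \<alpha>' v)"], goal_cases)
    case 6
    have "roots 0 = verts T" by (simp add: roots_def verts_T)
    then show ?case using init by (simp add: outcomes_single[OF B] del: One_nat_def)
  next
    case (7 r \<nu>1 \<rho>1 \<alpha>1)
    note r = 7(1) and H = 7(4)[rule_format]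
    let ?p = "P (m - Suc r)" and ?c = "C (m - Suc r)"
    have F1: "\<nu>1 VB = B" "\<nu>1 Vb = Suc B" "\<nu>1 VN = N" "\<nu>1 Vn1 = Suc n" "\<nu>1 Vrow = Suc n * N" "\<nu>1 Vm = m"
      "\<alpha>1 Dig = \<alpha> Dig" "\<alpha>1 Par (m - Suc r) = real ?p" "\<alpha>1 Chi (m - Suc r) = real ?c"
      using 7(3) V m order[of "m - Suc r"] r
      by (simp_all add: frame_def merge_tables_def merge_entry_def cross_loop_def store_entry_def del: mult_Suc)
    have pc: "?p \<in> roots r" "?c \<in> roots r" "?p \<in> roots (Suc r)" using roots_Suc[OF r] by auto
    have rm: "r \<le> m" "Suc r \<le> m" using r by auto
    have O': "?O (Suc r) v = (if v = ?p then merge B (?O r v) (?O r ?c) else ?O r v)" if "v \<in> roots (Suc r)" for v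
      by (rule outcomes_cluster[OF r that])
    \<comment> \<open>The merged triples stay in range because they are the outcomes of an actual
      cluster.\<close>
    have Z: "in_range n N (merge B (?O r ?p) (?O r ?c))"
      using range[OF rm(2) pc(3)] unfolding O'[OF pc(3)] by (simp only: if_True simp_thms)
    have main: "wp W merge_tables (\<lambda>\<nu>'' \<rho>'' \<alpha>''. \<forall>v\<in>roots (Suc r). holds n N (?O (Suc r) v) (?O (Suc r) v) (table n N \<alpha>'' v))
        (\<nu>1(Vp := ?p, Vc := ?c)) \<rho>1 \<alpha>1"
    proof (rule wp_merge_tables[where B = B and N = N and n = n and p = ?p and c = ?c and X = "?O r ?p" and Y = "?O r ?c"], goal_cases)
      case (17 \<nu>2 \<rho>2 \<alpha>2)
      show ?case
      proof
        fix v assume v: "v \<in> roots (Suc r)"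
        show "holds n N (?O (Suc r) v) (?O (Suc r) v) (table n N \<alpha>2 v)"
        proof (cases "v = ?p")
          case True
          then show ?thesis using 17(2) unfolding O'[OF v] by (simp only: if_True simp_thms)
        next
          case False
          have vr: "v \<in> roots r" using v roots_Suc(1)[OF r] by simp
          have "holds n N (?O r v) (?O r v) (table n N \<alpha>2 v)"
            by (rule holds_cong[OF H[OF vr] range[OF rm(1) vr] 17(3)[OF False]])
          then show ?thesis unfolding O'[OF v] using False by (simp only: if_False)
        qed
      qed
    qed (use F1 Dig W H pc range[OF rm(1)] Z N in \<open>simp_all del: mult_Suc cluster.simps\<close>)
    have "m - (r + 1) = m - Suc r" by simp
    then show ?case using main r by (simp add: F1 7(2) del: mult_Suc cluster.simps)
  next
    case (8 \<nu>1 \<rho>1 \<alpha>1)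
    have "0 \<in> roots m" by (simp add: roots_def)
    then have "holds n N (?O m 0) (?O m 0) (table n N \<alpha>1 0)" using 8(3) by blast
    then show ?case using 8(2) post unfolding cluster_final contract_all_def by blast
  qed (use m in \<open>simp_all add: merge_tables_def merge_entry_def cross_loop_def store_entry_def\<close>)
qed

lemma wp_answer:
  assumes V: "\<nu> VN = N" "\<nu> Vn1 = Suc n" "\<rho> Rk = real_of_int k" "\<rho> Rtau = \<tau>" and W: "N \<le> W" "Suc n \<le> W"
    and post: "\<And>\<nu>' \<rho>' \<alpha>'. (0 < \<nu>' Vans \<longleftrightarrow> (\<exists>j\<le>n. \<exists>d<N. int j = k \<and> 0 \<le> table n N \<alpha> 0 j d \<and> table n N \<alpha> 0 j d \<le> \<tau>)) \<Longrightarrow> Q \<nu>' \<rho>' \<alpha>'"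
  shows "wp W answer Q \<nu> \<rho> \<alpha>"
proof -
  let ?P = "\<lambda>j d. int j = k \<and> 0 \<le> table n N \<alpha> 0 j d \<and> table n N \<alpha> 0 j d \<le> \<tau>"
  have ints: "real j < real_of_int k \<longleftrightarrow> int j < k" "real_of_int k < real j \<longleftrightarrow> k < int j" for j
    by linarith+
  show ?thesis
    unfolding answer_def
  proof (simp, rule wp_For[where N = "Suc n" and I = "\<lambda>i \<nu>' \<rho>' \<alpha>'. 0 < \<nu>' Vans \<longleftrightarrow> (\<exists>j<i. \<exists>d<N. ?P j d)"], goal_cases)
    case (7 i \<nu>1 \<rho>1 \<alpha>1)
    have F1: "\<nu>1 VN = N" "\<rho>1 Rk = real_of_int k" "\<rho>1 Rtau = \<tau>" "\<alpha>1 = \<alpha>"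
      using 7(3) V by (auto simp: frame_def)
    show ?case
    proof (rule wp_For[where N = N and I = "\<lambda>d \<nu>' \<rho>' \<alpha>'. 0 < \<nu>' Vans \<longleftrightarrow> (\<exists>j<i. \<exists>d<N. ?P j d) \<or> (\<exists>d'<d. ?P i d')"], goal_cases)
      case (7 d \<nu>2 \<rho>2 \<alpha>2)
      have F2: "\<nu>2 VN = N" "\<rho>2 Rk = real_of_int k" "\<rho>2 Rtau = \<tau>" "\<alpha>2 = \<alpha>" "\<nu>2 Vj1 = i"
        using 7(3) F1 \<open>\<nu>1 Vj1 = i\<close> by (auto simp: frame_def)
      have t: "\<alpha> Tab (i * N + d) = table n N \<alpha> 0 i d" by (simp add: table_def)
      have s: "(\<exists>d'<Suc d. R d') \<longleftrightarrow> (\<exists>d'<d. R d') \<or> R d" for R :: "nat \<Rightarrow> bool"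
        by (auto simp: less_Suc_eq)
      consider "?P i d" | "int i < k" | "k < int i" | "int i = k" "table n N \<alpha> 0 i d < 0"
        | "int i = k" "0 \<le> table n N \<alpha> 0 i d" "\<tau> < table n N \<alpha> 0 i d" by linarith
      then show ?case
        by cases (use 7(4) in \<open>simp_all add: F2 7(2) ints t s\<close>)
    qed (use F1 W 7(4) in \<open>auto simp: less_Suc_eq\<close>)
  next
    case (8 \<nu>1 \<rho>1 \<alpha>1)
    then show ?case using post by (simp add: less_Suc_eq_le)
  qed (use V W in auto)
qed

section \<open>Computable bounds\<close>

lemma computable_binary:
  assumes "\<And>x y. rec_eval r [x, y] (g x y)" "computable f" "computable h"
  shows "computable (\<lambda>x. g (f x) (h x))"
proof -
  obtain rf rh where "\<And>x. rec_eval rf [x] (f x)" "\<And>x. rec_eval rh [x] (h x)"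
    using assms(2,3) unfolding computable_def by auto
  then have "rec_eval (Comp r [rf, rh]) [x] (g (f x) (h x))" for x
    by (intro rec_eval.intros(4)[where ys = "[f x, h x]"] assms(1)) simp
  then show ?thesis unfolding computable_def by blast
qed

lemma computable_id: "computable (\<lambda>x. x)"
  unfolding computable_def using rec_eval.intros(3)[of 0 "[x]" for x] by force

lemma computable_const: "computable (\<lambda>_. c)"
proof (induction c)
  case 0
  then show ?case unfolding computable_def by (blast intro: rec_eval.intros)
next
  case (Suc c)
  then obtain r where "\<And>x. rec_eval r [x] c" unfolding computable_def by auto
  then have "rec_eval (Comp Succ [r]) [x] (Suc c)" for x
    by (intro rec_eval.intros(4)[where ys = "[c]"] rec_eval.intros(2)) simp
  then show ?case unfolding computable_def by blast
qed

lemma rec_eval_Proj: "i < length xs \<Longrightarrow> xs ! i = y \<Longrightarrow> rec_eval (Proj i) xs y"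
  using rec_eval.intros(3) by blast

definition rec_add :: recf where
  "rec_add = PrimRec (Proj 0) (Comp Succ [Proj 1])"

lemma rec_add: "rec_eval rec_add [x, y] (x + y)"
  unfolding rec_add_def
proof (induction x)
  case 0
  show ?case by (intro rec_eval.intros(5) rec_eval_Proj) simp_all
next
  case (Suc x)
  have "rec_eval (Comp Succ [Proj 1]) [x, x + y, y] (Suc (x + y))"
    by (rule rec_eval.intros(4)[where ys = "[x + y]"]) (simp_all add: rec_eval_Proj rec_eval.intros)
  from rec_eval.intros(6)[OF Suc this] show ?case by simp
qed

definition rec_mult :: recf where
  "rec_mult = PrimRec Zero (Comp rec_add [Proj 1, Proj 2])"

lemma rec_mult: "rec_eval rec_mult [x, y] (x * y)"
  unfolding rec_mult_def
proof (induction x)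
  case 0
  show ?case by (simp add: rec_eval.intros)
next
  case (Suc x)
  have "rec_eval (Comp rec_add [Proj 1, Proj 2]) [x, x * y, y] (x * y + y)"
    by (rule rec_eval.intros(4)[where ys = "[x * y, y]"]) (simp_all add: rec_eval_Proj rec_add)
  from rec_eval.intros(6)[OF Suc this] show ?case by (simp add: add.commute)
qed

text \<open>Primitive recursion runs over the first argument, so the exponent comes first.\<close>

definition rec_power :: recf where
  "rec_power = PrimRec (Comp Succ [Zero]) (Comp rec_mult [Proj 1, Proj 2])"

lemma rec_power: "rec_eval rec_power [x, y] (y ^ x)"
  unfolding rec_power_def
proof (induction x)
  case 0
  have "rec_eval (Comp Succ [Zero]) [y] (Suc 0)"
    by (rule rec_eval.intros(4)[where ys = "[0]"]) (simp_all add: rec_eval.intros)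
  from rec_eval.intros(5)[OF this] show ?case by simp
next
  case (Suc x)
  have "rec_eval (Comp rec_mult [Proj 1, Proj 2]) [x, y ^ x, y] (y ^ x * y)"
    by (rule rec_eval.intros(4)[where ys = "[y ^ x, y]"]) (simp_all add: rec_eval_Proj rec_mult)
  from rec_eval.intros(6)[OF Suc this] show ?case by (simp add: mult.commute)
qed

lemma computable_add: "computable f \<Longrightarrow> computable h \<Longrightarrow> computable (\<lambda>x. f x + h x)"
  by (rule computable_binary[OF rec_add])

lemma computable_mult: "computable f \<Longrightarrow> computable h \<Longrightarrow> computable (\<lambda>x. f x * h x)"
  by (rule computable_binary[OF rec_mult])

lemma computable_power: "computable f \<Longrightarrow> computable h \<Longrightarrow> computable (\<lambda>x. f x ^ h x)"
  by (rule computable_binary[OF rec_power, of h f])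

section \<open>Loading the input\<close>

text \<open>The input occupies the cells that later serve as registers. Its first cells are moved
  out of the way with cell 3 as the only scratch register: cell 0 holds \<open>n\<close>, so adding it 16 times
  yields the address of \<open>Inp[2n + 2 + p]\<close>.\<close>

definition stash :: "nat \<Rightarrow> program" where
  "stash p = Const 3 (66 + 8 * int p) # replicate 16 (Add 3 3 0) @ [Store 3 p]"

text \<open>Clearing the cells from 3 to 49 lets the memory represent an environment in which all
  variables but the three inputs are 0.\<close>

definition preamble :: program where
  "preamble = concat (map stash [4..<50]) @ map (\<lambda>r. Const r 0) [3..<50]"

lemma runs_replicate_Add: "runs (replicate m (Add 3 3 0)) M (M(3 := M 3 + real m * M 0))"
proof (induction m arbitrary: M)
  case (Suc m)
  let ?M = "M(3 := M 3 + M 0)"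
  have "?M(3 := ?M 3 + real m * ?M 0) = M(3 := M 3 + real (Suc m) * M 0)"
    by (simp add: algebra_simps)
  then have "runs (replicate m (Add 3 3 0)) ?M (M(3 := M 3 + real (Suc m) * M 0))"
    using Suc.IH[of ?M] by (simp only:)
  then show ?case unfolding replicate_Suc by (rule runs_Cons[OF effect_intros(5)])
qed simp

lemma runs_stash:
  assumes "M 0 = real n" "p \<noteq> 3"
  shows "runs (stash p) M (M(3 := real (16 * n + 66 + 8 * p), 16 * n + 66 + 8 * p := M p))"
proof -
  let ?d = "16 * n + 66 + 8 * p"
  let ?M1 = "M(3 := real_of_int (66 + 8 * int p))"
  have eq: "?M1(3 := ?M1 3 + real 16 * ?M1 0) = M(3 := real ?d)"
    by (simp add: assms(1) algebra_simps)
  have 2: "runs (replicate 16 (Add 3 3 0)) ?M1 (M(3 := real ?d))"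
    using runs_replicate_Add[of 16 ?M1] unfolding eq .
  have "effect (Store 3 p) (M(3 := real ?d)) ((M(3 := real ?d))(?d := (M(3 := real ?d)) p))"
    by (rule effect_intros(4)) simp
  moreover have "(M(3 := real ?d)) p = M p" using assms(2) by simp
  ultimately have "runs [Store 3 p] (M(3 := real ?d)) (M(3 := real ?d, ?d := M p))"
    by (simp only: runs_single)
  then show ?thesis unfolding stash_def
    by (intro runs_Cons[OF effect_intros(1)] runs_append[OF 2])
qed

lemma runs_stash_all:
  assumes "M 0 = real n" "4 \<le> k" "k \<le> 50"
  shows "\<exists>M'. runs (concat (map stash [4..<k])) M M' \<and>
    (\<forall>a. a \<noteq> 3 \<and> (\<forall>p. 4 \<le> p \<longrightarrow> p < k \<longrightarrow> a \<noteq> 16 * n + 66 + 8 * p) \<longrightarrow> M' a = M a) \<and>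
    (\<forall>p. 4 \<le> p \<longrightarrow> p < k \<longrightarrow> M' (16 * n + 66 + 8 * p) = M p)"
  using assms(2,3)
proof (induction k rule: dec_induct)
  case (step k)
  then obtain M1 where M1: "runs (concat (map stash [4..<k])) M M1"
    "\<And>a. a \<noteq> 3 \<Longrightarrow> (\<forall>p. 4 \<le> p \<longrightarrow> p < k \<longrightarrow> a \<noteq> 16 * n + 66 + 8 * p) \<Longrightarrow> M1 a = M a"
    "\<And>p. 4 \<le> p \<Longrightarrow> p < k \<Longrightarrow> M1 (16 * n + 66 + 8 * p) = M p" by auto
  let ?d = "16 * n + 66 + 8 * k"
  let ?M2 = "M1(3 := real ?d, ?d := M1 k)"
  have "M1 0 = real n" using M1(2)[of 0] assms(1) by simp
  then have "runs (stash k) M1 ?M2" using step.hyps by (intro runs_stash) simp_all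
  from runs_append[OF M1(1) this] have 1: "runs (concat (map stash [4..<Suc k])) M ?M2"
    using step.hyps by simp
  \<comment> \<open>All targets so far lie above cell 50, so cell \<open>k\<close> still holds its
    original content.\<close>
  have k: "M1 k = M k" using step.hyps step.prems by (intro M1(2)) auto
  have 2: "?M2 a = M a" if "a \<noteq> 3" "\<forall>p. 4 \<le> p \<longrightarrow> p < Suc k \<longrightarrow> a \<noteq> 16 * n + 66 + 8 * p" for a
  proof -
    have "a \<noteq> ?d" using that(2) step.hyps by auto
    moreover have "M1 a = M a" using that by (intro M1(2)) auto
    ultimately show ?thesis using that(1) by simp
  qed
  have 3: "?M2 (16 * n + 66 + 8 * p) = M p" if "4 \<le> p" "p < Suc k" for p
    using M1(3)[of p] that k by (cases "p = k") auto
  show ?case using 1 2 3 by blast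
qed simp

lemma runs_zero: "runs (map (\<lambda>r. Const r 0) rs) M (\<lambda>a. if a \<in> set rs then 0 else M a)"
proof (induction rs arbitrary: M)
  case (Cons r rs)
  have eq: "(\<lambda>a. if a \<in> set rs then 0 else (M(r := real_of_int 0)) a) =
      (\<lambda>a. if a \<in> set (r # rs) then 0 else M a)" by auto
  have "runs (map (\<lambda>r. Const r 0) rs) (M(r := real_of_int 0)) (\<lambda>a. if a \<in> set (r # rs) then 0 else M a)"
    using Cons.IH[of "M(r := real_of_int 0)"] unfolding eq .
  then show ?case unfolding list.map by (rule runs_Cons[OF effect_intros(1)])
qed simp

lemma runs_preamble:
  assumes "M 0 = real n"
  obtains M' where "runs preamble M M'" "\<And>a. a < 3 \<Longrightarrow> M' a = M a" "\<And>a. 3 \<le> a \<Longrightarrow> a < 50 \<Longrightarrow> M' a = 0"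
    "\<And>a. 50 \<le> a \<Longrightarrow> a < 2 * n + 2 \<Longrightarrow> M' a = M a"
    "\<And>p. 4 \<le> p \<Longrightarrow> p < 50 \<Longrightarrow> M' (addr Inp (2 * n + 2 + p)) = M p"
proof -
  obtain M1 where M1: "runs (concat (map stash [4..<50])) M M1"
    "\<And>a. a \<noteq> 3 \<Longrightarrow> (\<forall>p. 4 \<le> p \<longrightarrow> p < 50 \<longrightarrow> a \<noteq> 16 * n + 66 + 8 * p) \<Longrightarrow> M1 a = M a"
    "\<And>p. 4 \<le> p \<Longrightarrow> p < 50 \<Longrightarrow> M1 (16 * n + 66 + 8 * p) = M p"
    using runs_stash_all[of M n 50] assms by auto
  let ?M' = "\<lambda>a. if 3 \<le> a \<and> a < 50 then 0 else M1 a"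
  have "runs (map (\<lambda>r. Const r 0) [3..<50]) M1 ?M'"
    using runs_zero[of "[3..<50]" M1] by (simp only: set_upt atLeastLessThan_iff)
  then have "runs preamble M ?M'" unfolding preamble_def by (rule runs_append[OF M1(1)])
  then show ?thesis
  proof (rule that[of ?M'])
    show "?M' a = M a" if "a < 3" for a using M1(2)[of a] that by simp
    show "?M' a = M a" if "50 \<le> a" "a < 2 * n + 2" for a using M1(2)[of a] that by simp
    show "?M' (addr Inp (2 * n + 2 + p)) = M p" if "4 \<le> p" "p < 50" for p
    proof -
      have "addr Inp (2 * n + 2 + p) = 16 * n + 66 + 8 * p" by (simp add: addr_def)
      then show ?thesis using M1(3)[OF that] by simp
    qed
  qed simp
qed

lemma nth_concat_pairs:
  assumes "j < length es"
  shows "concat (map (\<lambda>(u, v). [real u, real v]) es) ! (2 * j) = real (fst (es ! j))"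
    "concat (map (\<lambda>(u, v). [real u, real v]) es) ! (2 * j + 1) = real (snd (es ! j))"
    "2 * j + 1 < length (concat (map (\<lambda>(u, v). [real u, real v]) es))"
  using assms
proof (induction es arbitrary: j)
  case (Cons e es)
  { case 1 then show ?case using Cons.IH(1) by (cases j; cases e) auto }
  { case 2 then show ?case using Cons.IH(2) by (cases j; cases e) auto }
  { case 3 then show ?case using Cons.IH(3) by (cases j; cases e) auto }
qed simp_all

lemma initial_memory_input:
  "initial_memory (input_cells n es k \<tau>) 0 = real n"
  "initial_memory (input_cells n es k \<tau>) 1 = real_of_int k"
  "initial_memory (input_cells n es k \<tau>) 2 = \<tau>"
  "j < length es \<Longrightarrow> initial_memory (input_cells n es k \<tau>) (4 + 2 * j) = real (fst (es ! j))"
  "j < length es \<Longrightarrow> initial_memory (input_cells n es k \<tau>) (5 + 2 * j) = real (snd (es ! j))"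
proof -
  let ?xs = "concat (map (\<lambda>(u, v). [real u, real v]) es)"
  have c: "input_cells n es k \<tau> = [real n, real_of_int k, \<tau>, real (length es)] @ ?xs"
    by (simp add: input_cells_def)
  show "initial_memory (input_cells n es k \<tau>) 0 = real n"
    "initial_memory (input_cells n es k \<tau>) 1 = real_of_int k"
    "initial_memory (input_cells n es k \<tau>) 2 = \<tau>"
    unfolding c by (simp_all add: initial_memory_def)
  have m: "initial_memory (input_cells n es k \<tau>) (4 + i) = ?xs ! i" if "i < length ?xs" for i
    using that unfolding c initial_memory_def nth_append by simp
  assume j: "j < length es"
  have e: "5 + 2 * j = 4 + (2 * j + 1)" by simp
  show "initial_memory (input_cells n es k \<tau>) (4 + 2 * j) = real (fst (es ! j))"
    using m[of "2 * j"] nth_concat_pairs(1,3)[OF j] by simp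
  show "initial_memory (input_cells n es k \<tau>) (5 + 2 * j) = real (snd (es ! j))"
    unfolding e using m[OF nth_concat_pairs(3)[OF j]] nth_concat_pairs(2)[OF j] by (simp only:)
qed

section \<open>Correctness and running time\<close>

lemma bounds:
  "q \<le> bound q" "1 \<le> bound q" "2 \<le> num_codes q" "bound q \<le> num_codes q"
proof -
  have "q + bound1 q < bound q"
    using less_power_4[of "(q + bound1 q) * (q + bound1 q)"] le_square[of "q + bound1 q"]
    unfolding bound_def by linarith
  then show "q \<le> bound q" "1 \<le> bound q" by simp_all
  have "Suc (bound q) ^ 1 \<le> num_codes q"
    unfolding num_codes_def by (rule power_increasing) (use \<open>1 \<le> bound q\<close> in simp_all)
  then show "2 \<le> num_codes q" "bound q \<le> num_codes q" using \<open>1 \<le> bound q\<close> by simp_all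
qed

lemma finite_min_exists:
  fixes f :: "'a \<Rightarrow> real"
  assumes "finite A" "A \<noteq> {}"
  obtains x where "x \<in> A" "\<And>y. y \<in> A \<Longrightarrow> f x \<le> f y"
proof -
  have "Min (f ` A) \<in> f ` A" using assms by (intro Min_in) auto
  then obtain x where "x \<in> A" "f x = Min (f ` A)" by auto
  then show ?thesis using that[of x] assms(1) by simp
qed

text \<open>A table entry always comes from a deletion set. Conversely, a solution is first replaced
  by an optimal set of the same size, whose components are small by the exchange argument.\<close>

lemma MinIGL_iff_table:
  assumes T: "grown_tree T P C m" and n: "card (verts T) = n" "1 \<le> n"
    and D: "holds n (num_codes (block n k)) (outcomes (bound (block n k)) T 0) (outcomes (bound (block n k)) T 0) D"
  shows "(\<exists>j\<le>n. \<exists>d<num_codes (block n k). int j = k \<and> 0 \<le> D j d \<and> D j d \<le> \<tau>) \<longleftrightarrow> MinIGL T k \<tau>"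
proof
  assume "\<exists>j\<le>n. \<exists>d<num_codes (block n k). int j = k \<and> 0 \<le> D j d \<and> D j d \<le> \<tau>"
  then obtain j d where "j \<le> n" "d < num_codes (block n k)" "int j = k" "0 \<le> D j d" "D j d \<le> \<tau>" by blast
  moreover from this have "(j, d, D j d) \<in> outcomes (bound (block n k)) T 0"
    using holds_sound[OF D] by blast
  ultimately show "MinIGL T k \<tau>" unfolding MinIGL_def outcomes_def by auto
next
  interpret grown_tree T P C m by (rule T)
  let ?q = "block n k"
  let ?B = "bound ?q"
  assume "MinIGL T k \<tau>"
  then obtain S0 where S0: "S0 \<subseteq> verts T" "int (card S0) = k" "IGL (delete_verts T S0) \<le> \<tau>"
    unfolding MinIGL_def by blast
  \<comment> \<open>\<open>S0\<close> itself may leave large components; only a set of minimal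
    inverse geodesic length is known to appear among the outcomes.\<close>
  let ?A = "{S. S \<subseteq> verts T \<and> card S = card S0}"
  have "finite ?A" using finite_verts by simp
  moreover have "?A \<noteq> {}" using S0(1) by blast
  ultimately obtain S where "S \<in> ?A" and min: "\<And>S'. S' \<in> ?A \<Longrightarrow> IGL (delete_verts T S) \<le> IGL (delete_verts T S')"
    using finite_min_exists[of ?A "\<lambda>S. IGL (delete_verts T S)"] by blast
  then have S: "S \<subseteq> verts T" "card S = card S0" by simp_all
  have "card (comp_of (delete_verts T S) u) \<le> ?B" if u: "u \<in> verts T - S" for u
  proof (cases "0 < k")
    case True
    then have pos: "0 < card S" using S0(2) S(2) by simp
    have k: "real_of_int k = real (card S)" using S0(2) S(2) by simp
    have "real n / real_of_int k \<le> real ?q"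
      using True le_of_int_ceiling[of "real n / real_of_int k"] n(2) by (simp add: block_def)
    then have "real n \<le> real (?q * card S)" using pos by (simp add: k divide_le_eq)
    then have "card (verts T) \<le> ?q * card S" unfolding n(1) of_nat_le_iff .
    then show ?thesis
      by (rule optimal_imp_small_components[OF S(1) pos, where ?B1.0 = "bound1 ?q"])
         (use min S(2) u in \<open>simp_all add: bound1_def bound_def power2_eq_square\<close>)
  next
    case False
    \<comment> \<open>Without a positive \<open>k\<close> there is no exchange, but then
      \<open>q = n + 1\<close> already exceeds the number of vertices.\<close>
    have "card (comp_of (delete_verts T S) u) \<le> card (verts T)"
      by (rule card_mono[OF finite_verts]) (use comp_of_subset[of "delete_verts T S" u] in auto)
    also have "\<dots> \<le> ?q" using False n(1) by (simp add: block_def)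
    also have "\<dots> \<le> ?B" by (rule bounds)
    finally show ?thesis .
  qed
  then have "small_comps ?B (delete_verts T S)" by (simp add: small_comps_def)
  from outcomesI[OF S(1) this, of 0]
  have o: "(card S, code ?B (delete_verts T S) 0, IGL (delete_verts T S)) \<in> outcomes ?B T 0" .
  let ?d = "code ?B (delete_verts T S) 0"
  have "card S \<le> n" "?d < num_codes ?q"
    using outcomes_range[OF finite_verts o] n(1) by (simp_all add: num_codes_def)
  moreover have "0 \<le> D (card S) ?d \<and> D (card S) ?d \<le> IGL (delete_verts T S)"
    by (rule holds_complete[OF D o])
  moreover have "IGL (delete_verts T S) \<le> \<tau>" using min[of S0] S0(1,3) by simp
  ultimately show "\<exists>j\<le>n. \<exists>d<num_codes ?q. int j = k \<and> 0 \<le> D j d \<and> D j d \<le> \<tau>"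
    using S(2) S0(2) by (intro exI[of _ "card S"] conjI exI[of _ ?d]) simp_all
qed

text \<open>The longest loop initialises \<open>n * (Suc n * N)\<close> table cells; the factor 4
  absorbs the lower-order terms and the \<open>2 * n + 2\<close> iterations of the copying
  loop.\<close>

definition max_iterations :: "nat \<Rightarrow> nat \<Rightarrow> nat" where
  "max_iterations n q = 4 * num_codes q * (n * n)"

lemma max_iterations_ge:
  assumes "1 \<le> n"
  shows "2 * n + 2 \<le> max_iterations n q" "num_codes q \<le> max_iterations n q"
    "n * (Suc n * num_codes q) \<le> max_iterations n q" "Suc n * num_codes q \<le> max_iterations n q"
proof -
  let ?N = "num_codes q"
  have N: "2 \<le> ?N" by (rule bounds)
  have nn: "n \<le> n * n" "1 \<le> n * n" using assms by auto
  have "2 * n + 2 \<le> 4 * (n * n)" using nn by linarith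
  also have "\<dots> \<le> ?N * (4 * (n * n))" using N mult_le_mono1[of 1 ?N "4 * (n * n)"] by linarith
  finally show "2 * n + 2 \<le> max_iterations n q" by (simp add: max_iterations_def mult_ac)
  have "?N * 1 \<le> ?N * (4 * (n * n))" using nn(2) by (intro mult_le_mono2) linarith
  then show "?N \<le> max_iterations n q" by (simp add: max_iterations_def mult_ac)
  have "n * Suc n \<le> 4 * (n * n)" using nn unfolding mult_Suc_right by linarith
  then have "n * Suc n * ?N \<le> 4 * (n * n) * ?N" by (rule mult_le_mono1)
  then show 3: "n * (Suc n * ?N) \<le> max_iterations n q" by (simp add: max_iterations_def mult_ac del: mult_Suc mult_Suc_right)
  have "1 * (Suc n * ?N) \<le> n * (Suc n * ?N)" using assms by (intro mult_le_mono1)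
  then show "Suc n * ?N \<le> max_iterations n q" using 3 by linarith
qed

lemma wp_solve:
  assumes T: "tree T" "verts T = {0..<n}" "edge_list T es"
    and \<nu>: "\<nu> Vn = n" and \<rho>: "\<rho> Rk = real_of_int k" "\<rho> Rtau = \<tau>" and W: "W = max_iterations n (block n k)"
    and x: "x = initial_memory (input_cells n es k \<tau>)"
    and inp: "\<And>p. 4 \<le> p \<Longrightarrow> p < 50 \<Longrightarrow> p < 2 * n + 2 \<Longrightarrow> \<alpha> Inp (2 * n + 2 + p) = x p"
      "\<And>a i. addr a i < 2 * n + 2 \<Longrightarrow> \<alpha> a i = x (addr a i)"
  shows "wp W solve (\<lambda>\<nu>' \<rho>' \<alpha>'. 0 < \<nu>' Vans \<longleftrightarrow> MinIGL T k \<tau>) \<nu> \<rho> \<alpha>"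
proof -
  have n: "1 \<le> n" by (rule n_pos[OF T(1,2)])
  let ?q = "block n k"
  let ?B = "bound ?q" and ?N = "num_codes ?q"
  note Ws = max_iterations_ge[OF n, of ?q, folded W]
  have BW: "?B \<le> W" and nW: "n \<le> W" and SnW: "Suc n \<le> W" using bounds(4)[of ?q] Ws n by linarith+
  have len: "length es = n - 1" by (rule length_edge_list[OF T])
  show ?thesis
    unfolding solve_def wp.simps(5)
  proof (rule wp_copy_input[where n = n and x = x], goal_cases)
    case (5 \<nu>1 \<rho>1 \<alpha>1)
    have F1: "\<nu>1 Vn = n" "\<rho>1 Rk = real_of_int k" "\<rho>1 Rtau = \<tau>"
      using 5(1) \<nu> \<rho> by (simp_all add: frame_def copy_input_def copy_cell_def)
    have I1: "\<alpha>1 Inp (\<nu>1 Vx0 + 4 + 2 * j) = real (fst (es ! j))" "\<alpha>1 Inp (\<nu>1 Vx0 + 5 + 2 * j) = real (snd (es ! j))"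
      if "j < n - 1" for j
      using 5(3)[of "4 + 2 * j"] 5(3)[of "5 + 2 * j"] that initial_memory_input(4,5)[of j es n k \<tau>] len
      by (simp_all add: 5(2) x add.assoc)
    show ?case
    proof (rule wp_calc_q[where n = n and k = k], goal_cases)
      case (5 \<nu>2 \<rho>2 \<alpha>2)
      have F2: "\<nu>2 Vn = n" "\<rho>2 Rk = real_of_int k" "\<rho>2 Rtau = \<tau>" "\<nu>2 Vx0 = \<nu>1 Vx0" "\<alpha>2 Inp = \<alpha>1 Inp"
        using 5(1) F1 by (simp_all add: frame_def calc_q_def)
      show ?case
      proof (rule wp_calc_B[where q = ?q], goal_cases)
        case (3 \<nu>3 \<rho>3 \<alpha>3)
        have F3: "\<nu>3 Vn = n" "\<rho>3 Rk = real_of_int k" "\<rho>3 Rtau = \<tau>" "\<nu>3 Vx0 = \<nu>1 Vx0" "\<alpha>3 Inp = \<alpha>1 Inp"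
          using 3(1) F2 by (simp_all add: frame_def calc_B_def)
        note B3 = 3(2-4) and Pow = 3(5)
        show ?case
        proof (rule wp_calc_digits[where B = ?B and N = ?N], goal_cases)
          case (7 \<nu>4 \<rho>4 \<alpha>4)
          have F4: "\<nu>4 Vn = n" "\<rho>4 Rk = real_of_int k" "\<rho>4 Rtau = \<tau>" "\<nu>4 Vx0 = \<nu>1 Vx0" "\<alpha>4 Inp = \<alpha>1 Inp"
            "\<nu>4 VB = ?B" "\<nu>4 Vb = Suc ?B" "\<nu>4 VN = ?N"
            using 7(1) F3 B3 by (simp_all add: frame_def calc_digits_def)
          note Dig = 7(2)
          show ?case
          proof (rule wp_calc_order[where T = T and n = n and es = es], goal_cases)
            case (8 \<nu>5 \<rho>5 \<alpha>5 P C)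
            have F5: "\<nu>5 Vn = n" "\<rho>5 Rk = real_of_int k" "\<rho>5 Rtau = \<tau>" "\<alpha>5 Dig = \<alpha>4 Dig"
              "\<nu>5 VB = ?B" "\<nu>5 Vb = Suc ?B" "\<nu>5 VN = ?N"
              using 8(1) F4 by (simp_all add: frame_def calc_order_def scan_edge_def attach_def)
            note m5 = 8(2) and grown = 8(3) and order = 8(4,5)
            show ?case
            proof (rule wp_init_tables[where n = n and N = ?N], goal_cases)
              case (7 \<nu>6 \<rho>6 \<alpha>6)
              have F6: "\<nu>6 Vn = n" "\<rho>6 Rk = real_of_int k" "\<rho>6 Rtau = \<tau>" "\<alpha>6 Dig = \<alpha>4 Dig" "\<nu>6 Vm = n - 1"
                "\<nu>6 VB = ?B" "\<nu>6 Vb = Suc ?B" "\<nu>6 VN = ?N" "\<alpha>6 Par = \<alpha>5 Par" "\<alpha>6 Chi = \<alpha>5 Chi"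
                using 7(1) F5 m5 by (simp_all add: frame_def init_tables_def)
              note T6 = 7(2,3) and init = 7(4)
              show ?case
              proof (rule wp_contract_all[OF grown, where n = n and B = ?B and N = ?N], goal_cases)
                case (17 \<nu>7 \<rho>7 \<alpha>7)
                have F7: "\<rho>7 Rk = real_of_int k" "\<rho>7 Rtau = \<tau>" "\<nu>7 VN = ?N" "\<nu>7 Vn1 = Suc n"
                  using 17(1) F6 T6
                  by (simp_all add: frame_def contract_all_def merge_tables_def merge_entry_def cross_loop_def store_entry_def)
                have "(\<exists>j\<le>n. \<exists>d<?N. int j = k \<and> 0 \<le> table n ?N \<alpha>7 0 j d \<and> table n ?N \<alpha>7 0 j d \<le> \<tau>) \<longleftrightarrow> MinIGL T k \<tau>"
                  by (rule MinIGL_iff_table[OF grown _ n 17(2)]) (simp add: T(2))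
                then show ?case
                  by (intro wp_answer[where n = n and N = ?N and k = k and \<tau> = \<tau>]) (simp_all add: F7 Ws(2) SnW)
              qed (use F6 T6 n nW BW Ws order Dig init bounds(2) T(2) in \<open>simp_all add: num_codes_def del: mult_Suc One_nat_def\<close>)
            qed (use F5 Ws nW n bounds(3) in \<open>simp_all del: mult_Suc\<close>)
          qed (use T I1 F4 nW in simp_all)
        qed (use B3 Pow BW Ws in simp_all)
      qed (use 5 Ws in simp_all)
    qed (use F1 n nW in simp_all)
  qed (use \<nu> Ws inp in simp_all)
qed

definition solver :: program where
  "solver = preamble @ ccode solve (length preamble) @
     [Const 38 0, JumpLess 38 (nreg Vans) (length preamble + size_code solve + 3), Halt False, Halt True]"

lemma solver_halts:
  assumes T: "tree T" "verts T = {0..<n}" "edge_list T es"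
  shows "\<exists>t \<le> length preamble + time_bound (max_iterations n (block n k)) solve + 2.
    halts_with solver (initial_memory (input_cells n es k \<tau>)) t (MinIGL T k \<tau>)"
proof -
  let ?M = "initial_memory (input_cells n es k \<tau>)" and ?W = "max_iterations n (block n k)"
  let ?l = "length preamble" and ?s = "size_code solve"
  obtain M1 where M1: "runs preamble ?M M1" "\<And>a. a < 3 \<Longrightarrow> M1 a = ?M a" "\<And>a. 3 \<le> a \<Longrightarrow> a < 50 \<Longrightarrow> M1 a = 0"
    "\<And>a. 50 \<le> a \<Longrightarrow> a < 2 * n + 2 \<Longrightarrow> M1 a = ?M a"
    "\<And>p. 4 \<le> p \<Longrightarrow> p < 50 \<Longrightarrow> M1 (addr Inp (2 * n + 2 + p)) = ?M p"
    using runs_preamble[of ?M n] initial_memory_input(1) by blast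
  define \<nu> :: nenv where "\<nu> = (\<lambda>x. if x = Vn then n else 0)"
  define \<rho> :: renv where "\<rho> = (\<lambda>x. if x = Rk then real_of_int k else if x = Rtau then \<tau> else 0)"
  define \<alpha> :: arrays where "\<alpha> = (\<lambda>a i. M1 (addr a i))"
  have rep: "represents \<nu> \<rho> \<alpha> M1"
    unfolding represents_def
  proof (intro conjI allI)
    show "M1 (nreg x) = real (\<nu> x)" for x
      using M1(2)[of 0] M1(3) initial_memory_input(1)[of n es k \<tau>] by (cases x) (simp_all add: \<nu>_def)
    show "M1 (rreg x) = \<rho> x" for x
      using M1(2)[of 1] M1(2)[of 2] M1(3) initial_memory_input(2,3)[of n es k \<tau>]
      by (cases x) (simp_all add: \<rho>_def)
  qed (simp add: \<alpha>_def)
  have c: "code_at solver 0 (preamble @ ccode solve ?l @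
      [Const 38 0, JumpLess 38 (nreg Vans) (?l + ?s + 3), Halt False, Halt True])"
    by (fold solver_def) (simp add: code_at_def)
  then have code: "code_at solver 0 preamble" "code_at solver ?l (ccode solve ?l)"
    "?l + ?s < length solver" "solver ! (?l + ?s) = Const 38 0"
    "Suc (?l + ?s) < length solver" "solver ! Suc (?l + ?s) = JumpLess 38 (nreg Vans) (?l + ?s + 3)"
    "Suc (Suc (?l + ?s)) < length solver" "solver ! Suc (Suc (?l + ?s)) = Halt False"
    "?l + ?s + 3 < length solver" "solver ! (?l + ?s + 3) = Halt True"
    using c by (simp_all add: numeral_3_eq_3)
  have "wp ?W solve (\<lambda>\<nu>' \<rho>' \<alpha>'. 0 < \<nu>' Vans \<longleftrightarrow> MinIGL T k \<tau>) \<nu> \<rho> \<alpha>"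
    by (rule wp_solve[OF T _ _ _ refl refl]) (use M1(4,5) addr_ge in \<open>simp_all add: \<nu>_def \<rho>_def \<alpha>_def\<close>)
  from ccode_correct[OF this rep code(2) fits_solve] obtain \<nu>2 \<rho>2 \<alpha>2 M2 where
    2: "reaches solver (time_bound ?W solve) (?l, M1) (?l + ?s, M2)" "represents \<nu>2 \<rho>2 \<alpha>2 M2"
    and ans: "0 < \<nu>2 Vans \<longleftrightarrow> MinIGL T k \<tau>" by (elim exE conjE)
  let ?M3 = "M2(38 := real_of_int 0)"
  let ?pc = "if MinIGL T k \<tau> then ?l + ?s + 3 else Suc (Suc (?l + ?s))"
  have r1: "reaches solver ?l (0, ?M) (?l, M1)" using reaches_runs[OF M1(1) code(1)] by simp
  have r3: "reaches solver 1 (?l + ?s, M2) (Suc (?l + ?s), ?M3)"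
    by (rule reaches_step[OF code(3,4)]) (rule exec.intros)
  have "M2 (nreg Vans) = real (\<nu>2 Vans)" using 2(2) by (simp only: represents_def)
  then have "?M3 38 < ?M3 (nreg Vans) \<longleftrightarrow> MinIGL T k \<tau>" using ans by simp
  then have r4: "reaches solver 1 (Suc (?l + ?s), ?M3) (?pc, ?M3)"
    using reaches_step[OF code(5,6) exec.intros(10)[of 38 "nreg Vans" "?l + ?s + 3" "Suc (?l + ?s)" ?M3]] by (simp only:)
  have "reaches solver (?l + (time_bound ?W solve + (1 + 1))) (0, ?M) (?pc, ?M3)"
    by (rule reaches_trans[OF r1 reaches_trans[OF 2(1) reaches_trans[OF r3 r4]]])
  then obtain t where t: "t \<le> ?l + time_bound ?W solve + 2" "(step solver ^^ t) (0, ?M) (?pc, ?M3)"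
    unfolding reaches_def by auto
  have "?pc < length solver \<and> solver ! ?pc = Halt (MinIGL T k \<tau>)" using code(7-10) by simp
  then have "halts_with solver ?M t (MinIGL T k \<tau>)" using t(2) unfolding halts_with_def by blast
  then show ?thesis using t(1) by blast
qed

lemma computable_num_codes: "computable num_codes"
proof -
  note c = computable_add computable_mult computable_power computable_const computable_id
  have b1: "computable bound1" unfolding bound1_def[abs_def] by (intro c)
  have b: "computable bound" unfolding bound_def[abs_def] by (intro c b1)
  have "computable (\<lambda>q. (bound q + 1) ^ bound q)" by (intro c b)
  then show ?thesis by (simp add: num_codes_def[abs_def])
qed

theorem theorem1:
  shows "\<exists>(P :: program) (f :: nat \<Rightarrow> nat) (c :: nat). computable f \<and>
    (\<forall>(T :: nat graph) (n :: nat) (es :: (nat \<times> nat) list) (k :: int) (\<tau> :: real).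
       tree T \<and> verts T = {0..<n} \<and> edge_list T es \<longrightarrow>
       (\<exists>t. halts_with P (initial_memory (input_cells n es k \<tau>)) t (MinIGL T k \<tau>) \<and>
            (k > 0 \<longrightarrow> t \<le> f (nat \<lceil>real n / real_of_int k\<rceil>) * n ^ c)))"
proof -
  \<comment> \<open>The program is fixed, so its code size and nesting depth are constants, and
    \<open>time_bound 1 solve\<close> collects the coefficients of the running time.\<close>
  define K where "K = length preamble + 2 + time_bound 1 solve"
  define d where "d = nesting solve"
  define f where "f = (\<lambda>q. K * (4 * num_codes q) ^ d)"
  have "computable f" unfolding f_def
    by (intro computable_mult computable_power computable_const computable_num_codes)
  moreover have "\<exists>t. halts_with solver (initial_memory (input_cells n es k \<tau>)) t (MinIGL T k \<tau>) \<and>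
      (k > 0 \<longrightarrow> t \<le> f (nat \<lceil>real n / real_of_int k\<rceil>) * n ^ (2 * d))"
    if T: "tree T" "verts T = {0..<n}" "edge_list T es" for T n es k \<tau>
  proof -
    let ?q = "block n k"
    let ?W = "max_iterations n ?q"
    obtain t where t: "t \<le> length preamble + time_bound ?W solve + 2"
      "halts_with solver (initial_memory (input_cells n es k \<tau>)) t (MinIGL T k \<tau>)"
      using solver_halts[OF T] by blast
    have W: "1 \<le> ?W" using max_iterations_ge(1)[OF n_pos[OF T(1,2)], of ?q] by linarith
    then have "(length preamble + 2) * 1 \<le> (length preamble + 2) * ?W ^ d"
      by (intro mult_le_mono2) simp
    moreover have "time_bound ?W solve \<le> time_bound 1 solve * ?W ^ d"
      by (rule time_bound_le[OF W]) (simp add: d_def)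
    ultimately have "t \<le> K * ?W ^ d" using t(1) by (simp add: K_def add_mult_distrib)
    \<comment> \<open>Here the bound splits into a factor depending on \<open>q\<close> alone and a
      power of \<open>n\<close> with a fixed exponent.\<close>
    also have "?W ^ d = (4 * num_codes ?q) ^ d * n ^ (2 * d)"
      by (simp add: max_iterations_def power_mult_distrib power_mult power2_eq_square)
    finally have "t \<le> f ?q * n ^ (2 * d)" by (simp add: f_def mult.assoc)
    then show ?thesis using t(2) by (auto simp: block_def)
  qed
  ultimately show ?thesis by blast
qed

end
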